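(* Assume that there exists a bounded open set $\Omega\subset\mathbb R^2$ such that $\Omega$ has $C^\infty$ regularity (i.e. $C^\infty$ boundary), $|\Omega|=1$, and $$J(\Omega)=\inf_{\substack{\Omega'\subset\mathbb R^2\text{ open},\\ |\Omega'|=1}}J(\Omega').$$ Let $u_\Omega$ be the solution of the associated Euler-Lagrange equation $(-\Delta)^{1/2}u_\Omega=1$ in $\Omega$, $u_\Omega=0$ in $\Omega^c$, and let $n(x)$ be the outward pointing unit normal at $x\in\partial\Omega$. Then $\partial_n^{1/2}u_\Omega$ exists, and there exists a constant $c_0\ge0$ such that $$\partial_n^{1/2}u_\Omega(x)=c_0\qquad\forall x\in\partial\Omega.$$
   Context: $(-\Delta)^{1/2}$ is the fractional Laplacian on $\mathbb R^2$, $\widehat{(-\Delta)^{1/2}v}(\xi)=|\xi|\hat v(\xi)$, continuous from $H^{1/2}(\mathbb R^2)$ to $H^{-1/2}(\mathbb R^2)$. $|\Omega|$ denotes Lebesgue measure and $\Omega^c=\mathbb R^2\setminus\Omega$. The energy is $$J(\Omega):=\inf_{\substack{v\in H^{1/2}(\mathbb R^2),\\ v|_{\Omega^c}=0}}\left(\frac12\left\langle(-\Delta)^{1/2}v,v\right\rangle_{H^{-1/2},H^{1/2}}-\int_{\mathbb R^2}v\right),$$ where $\langle\cdot,\cdot\rangle_{H^{-1/2},H^{1/2}}$ is the duality pairing, and $u_\Omega\in H^{1/2}(\mathbb R^2)$ is its unique minimizer. The fractional normal derivative of a function $u$ vanishing on $\Omega^c$ at $x\in\partial\Omega$ is $$\partial_n^{1/2}u(x):=\lim_{y\to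 x,\ y\in\Omega}\frac{u(y)}{|(y-x)\cdot n(x)|^{1/2}}.$$
   Formalization: The limit defining the fractional normal derivative is taken non-tangentially (in every cone about the normal) instead of over all y→x in Ω, since the unrestricted limit does not exist for the disc, where tangential approach gives 0 and normal approach a positive value. *)

theory Defs
  imports "HOL-Analysis.Analysis"
begin

type_synonym plane = "real ^ 2"

definition square_integrable :: "(plane \<Rightarrow> complex) \<Rightarrow> bool" where
  "square_integrable f \<longleftrightarrow>
     f \<in> borel_measurable lebesgue \<and>
     (\<integral>\<^sup>+ x. ennreal ((norm (f x))\<^sup>2) \<partial>lebesgue) < \<infinity>"

text \<open>Unitary normalization in dimension two: the Plancherel transform is an isometry, so the
  \<open>L\<^sup>2\<close> inner product, and the duality pairing extending it, carries no constant on the Fourier side.\<close>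

definition fourier_integral :: "(plane \<Rightarrow> complex) \<Rightarrow> plane \<Rightarrow> complex" where
  "fourier_integral f \<xi> =
     complex_of_real (1 / (2 * pi)) * (\<integral>x. exp (- \<i> * complex_of_real (x \<bullet> \<xi>)) * f x \<partial>lebesgue)"

text \<open>A square integrable function need not be integrable: its transform is the \<open>L\<^sup>2\<close> limit of the
  transforms of its truncations to balls, and is determined only up to null sets.\<close>

definition has_plancherel_transform ::
    "(plane \<Rightarrow> complex) \<Rightarrow> (plane \<Rightarrow> complex) \<Rightarrow> bool" where
  "has_plancherel_transform f g \<longleftrightarrow>
     square_integrable g \<and>
     ((\<lambda>R::real. \<integral>\<^sup>+ \<xi>. ennreal ((norm
          (fourier_integral (\<lambda>x. if norm x \<le> R then f x else 0) \<xi> - g \<xi>))\<^sup>2) \<partial>lebesgue)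
       \<longlongrightarrow> 0) at_top"

definition plancherel :: "(plane \<Rightarrow> real) \<Rightarrow> plane \<Rightarrow> complex" where
  "plancherel v = (SOME g. has_plancherel_transform (\<lambda>x. complex_of_real (v x)) g)"

definition H_half :: "(plane \<Rightarrow> real) set" where
  "H_half = {v. square_integrable (\<lambda>x. complex_of_real (v x)) \<and>
     (\<integral>\<^sup>+ \<xi>. ennreal (sqrt (1 + (norm \<xi>)\<^sup>2) * (norm (plancherel v \<xi>))\<^sup>2) \<partial>lebesgue) < \<infinity>}"

text \<open>An element of \<open>H\<^bsup>-1/2\<^esup>\<close> is represented by its Fourier transform \<open>g\<close>, a measurable function with
  \<open>(1 + \<bar>\<xi>\<bar>\<^sup>2)\<^bsup>-1/2\<^esup> \<bar>g \<xi>\<bar>\<^sup>2\<close> integrable.  For elements \<open>v\<close> of \<open>H_half\<close>, both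
  \<open>half_laplacian_hat v\<close> and the pairing below are in this sense well defined.  The integral in the
  pairing is already real when \<open>g\<close> is the transform of a real distribution.\<close>

definition half_laplacian_hat :: "(plane \<Rightarrow> real) \<Rightarrow> plane \<Rightarrow> complex" where
  "half_laplacian_hat v \<xi> = complex_of_real (norm \<xi>) * plancherel v \<xi>"

definition duality_pairing :: "(plane \<Rightarrow> complex) \<Rightarrow> (plane \<Rightarrow> real) \<Rightarrow> real" where
  "duality_pairing g v = Re (\<integral>\<xi>. g \<xi> * cnj (plancherel v \<xi>) \<partial>lebesgue)"

definition H_half_vanishing_outside :: "plane set \<Rightarrow> (plane \<Rightarrow> real) set" where
  "H_half_vanishing_outside \<Omega> = {v \<in> H_half. AE x in lebesgue. x \<notin> \<Omega> \<longrightarrow> v x = 0}"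

text \<open>If \<open>\<Omega>\<close> has finite measure, all functions in \<open>H_half_vanishing_outside \<Omega>\<close> are integrable.
  For sets of infinite measure \<open>J\<close> is not meaningful, since the Bochner integral of a
  non-integrable function is \<open>0\<close>.\<close>

definition J :: "plane set \<Rightarrow> ereal" where
  "J \<Omega> = (INF v \<in> H_half_vanishing_outside \<Omega>.
     ereal (1/2 * duality_pairing (half_laplacian_hat v) v - (\<integral>x. v x \<partial>lebesgue)))"

text \<open>Weak form of \<open>(-\<Delta>)\<^bsup>1/2\<^esup> u = 1\<close> in \<open>\<Omega>\<close>, \<open>u = 0\<close> outside \<open>\<Omega>\<close>, tested against all
  admissible variations in the minimization problem defining \<open>J \<Omega>\<close>.\<close>

definition solves_euler_lagrange :: "plane set \<Rightarrow> (plane \<Rightarrow> real) \<Rightarrow> bool" where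
  "solves_euler_lagrange \<Omega> u \<longleftrightarrow>
     u \<in> H_half_vanishing_outside \<Omega> \<and>
     (\<forall>\<phi> \<in> H_half_vanishing_outside \<Omega>.
        duality_pairing (half_laplacian_hat u) \<phi> = (\<integral>x. \<phi> x \<partial>lebesgue))"

definition smooth_real :: "(real \<Rightarrow> real) \<Rightarrow> bool" where
  "smooth_real \<gamma> \<longleftrightarrow> (\<forall>k t. (deriv ^^ k) \<gamma> differentiable (at t))"

text \<open>Near the boundary point \<open>x\<close>, in the orthonormal frame \<open>e1, e2\<close> based at \<open>x\<close>, the set
  \<open>\<Omega>\<close> lies strictly below the graph of \<open>\<gamma>\<close>.\<close>

definition boundary_chart ::
    "plane set \<Rightarrow> plane \<Rightarrow> plane \<Rightarrow> plane \<Rightarrow> (real \<Rightarrow> real) \<Rightarrow> bool" where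
  "boundary_chart \<Omega> x e1 e2 \<gamma> \<longleftrightarrow>
     norm e1 = 1 \<and> norm e2 = 1 \<and> e1 \<bullet> e2 = 0 \<and> smooth_real \<gamma> \<and>
     (\<exists>r>0. \<Omega> \<inter> ball x r = {y \<in> ball x r. (y - x) \<bullet> e2 < \<gamma> ((y - x) \<bullet> e1)})"

definition smooth_boundary :: "plane set \<Rightarrow> bool" where
  "smooth_boundary \<Omega> \<longleftrightarrow> (\<forall>x \<in> frontier \<Omega>. \<exists>e1 e2 \<gamma>. boundary_chart \<Omega> x e1 e2 \<gamma>)"

definition outward_unit_normal :: "plane set \<Rightarrow> plane \<Rightarrow> plane \<Rightarrow> bool" where
  "outward_unit_normal \<Omega> x \<nu> \<longleftrightarrow> x \<in> frontier \<Omega> \<and>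
     (\<exists>e1 e2 \<gamma>. boundary_chart \<Omega> x e1 e2 \<gamma> \<and>
        \<nu> = (1 / sqrt (1 + (deriv \<gamma> 0)\<^sup>2)) *\<^sub>R (e2 - deriv \<gamma> 0 *\<^sub>R e1))"

text \<open>The limit has to be non-tangential, i.e. taken in every cone
  \<open>\<kappa> \<bar>y - x\<bar> \<le> \<bar>(y - x) \<bullet> \<nu>\<bar>\<close>.  For the unit disc and
  \<open>u y = sqrt (1 - \<bar>y\<bar>\<^sup>2)\<close> the quotient tends to \<open>sqrt 2\<close> in each cone at a boundary point, but to
  \<open>0\<close> along \<open>y = (1 - t\<^sup>3) (cos t, sin t)\<close> at \<open>x = (1, 0)\<close>, so there is no unrestricted limit.\<close>

definition has_half_normal_derivative ::
    "plane set \<Rightarrow> (plane \<Rightarrow> real) \<Rightarrow> plane \<Rightarrow> plane \<Rightarrow> real \<Rightarrow> bool" where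
  "has_half_normal_derivative \<Omega> u x \<nu> c \<longleftrightarrow>
     (\<forall>\<kappa>. 0 < \<kappa> \<and> \<kappa> < 1 \<longrightarrow>
       ((\<lambda>y. u y / sqrt \<bar>(y - x) \<bullet> \<nu>\<bar>) \<longlongrightarrow> c)
         (at x within {y \<in> \<Omega>. \<kappa> * norm (y - x) \<le> \<bar>(y - x) \<bullet> \<nu>\<bar>}))"

end

theory Submission
  imports Defs "HOL-Probability.Probability"
begin

text \<open>No boundary regularity theory is needed, because a minimizing set is a disc. Writing
  \<open>\<bar>\<xi>\<bar>\<close> as a superposition of \<open>1 - exp (- t \<bar>\<xi>\<bar>\<^sup>2)\<close> turns the energy into an integral over \<open>t\<close> of
  \<open>\<parallel>f\<parallel>\<^sup>2\<close> minus Gaussian double integrals of \<open>f\<close>. Two-point rearrangement across a line (polarization)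
  increases the latter and preserves everything else, strictly unless \<open>f\<close> or its reflection
  dominates on each side of the line. Hence the solution \<open>u\<close> on a minimizing set dominates its reflection
  on every half plane that contains the maximum point \<open>c\<close> of its Gaussian convolution, so it is supported
  in the disc of area \<open>1\<close> about \<open>c\<close>. On this disc the solution is
  \<open>2 / \<pi> sqrt (R\<^sup>2 - \<bar>x - c\<bar>\<^sup>2)\<close>, which is read off from its explicit Fourier transform by integration over
  lines through the origin, and strict convexity identifies \<open>u\<close> with it. The smooth boundary excludes that a null set
  has been removed from the disc.\<close>

section \<open>Measure and reflections in the plane\<close>

text \<open>Minimality of the solution is used against three kinds of competitors: its absolute
  value on the same set, which yields nonnegativity; its polarization, which lives on a polarized
  set that is again open and of the same measure; and the explicit solution on the disc. Equality of
  the energies yields equality of the Gaussian forms for at least one time, and one time is enough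
  because the Gaussian kernel is strictly decreasing in the distance. The obstacle on the Fourier
  side is that the transform of the half sphere decays only like the inverse square of
  \<open>norm \<xi>\<close>; multiplied by \<open>norm \<xi>\<close> it is not integrable and cannot
  be inverted pointwise. A Gaussian factor and a slightly larger disc supply the domination, and
  both are removed in the end. The computation closes in dimension two because the Jacobian
  \<open>\<bar>r\<bar>\<close> of lines through the origin completes the symbol
  \<open>\<bar>r\<bar>\<close> to the square of \<open>r\<close>, which is a local operator on each
  line. With \<open>R = 1 / sqrt pi\<close> the constant of the theorem is
  \<open>2 / pi * sqrt (2 * R)\<close>.\<close>

definition pt :: "real \<Rightarrow> real \<Rightarrow> plane" where
  "pt a b = a *\<^sub>R axis 1 1 + b *\<^sub>R axis 2 1"

lemma pt_nth [simp]: "pt a b $ 1 = a" "pt a b $ 2 = b"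
  by (simp_all add: pt_def axis_def)

lemma measurable_pt [measurable]: "(\<lambda>p. pt (fst p) (snd p)) \<in> borel_measurable borel"
  unfolding pt_def by (intro borel_measurable_continuous_onI continuous_intros)

lemma measurable_pt' [measurable]: "(\<lambda>(a, b). pt a b) \<in> lborel \<Otimes>\<^sub>M lborel \<rightarrow>\<^sub>M borel"
  using measurable_pt by (simp add: case_prod_unfold lborel_prod)

lemma inner_plane: "(x::plane) \<bullet> y = x $ 1 * y $ 1 + x $ 2 * y $ 2"
  by (simp add: inner_vec_def sum_2)

lemma norm_plane_sq: "(norm (x::plane))\<^sup>2 = (x $ 1)\<^sup>2 + (x $ 2)\<^sup>2"
  unfolding power2_norm_eq_inner inner_plane by (simp add: power2_eq_square)

lemma Basis_plane: "(Basis :: plane set) = {axis 1 1, axis 2 1}"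
  by (auto simp: Basis_vec_def) (metis exhaust_2)

lemma inner_axis_plane: "x \<bullet> axis i 1 = (x::plane) $ i"
  by (simp add: inner_axis)

lemma axis_neq: "axis 1 (1::real) \<noteq> (axis 2 1 :: plane)"
  by (simp add: axis_eq_axis)

text \<open>\<open>real ^ 2\<close> is not a product type, so Fubini in the two coordinates passes
  through this image measure. Agreement on boxes is enough.\<close>

lemma lborel_plane: "lborel = distr (lborel \<Otimes>\<^sub>M lborel) borel (\<lambda>(a, b). pt a b)"
proof (rule lborel_eqI)
  fix l u :: plane assume lu: "\<And>b. b \<in> Basis \<Longrightarrow> l \<bullet> b \<le> u \<bullet> b"
  have le: "l $ 1 \<le> u $ 1" "l $ 2 \<le> u $ 2"
    using lu[of "axis 1 1"] lu[of "axis 2 1"] by (auto simp: Basis_plane inner_axis_plane)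
  have "(\<lambda>(a, b). pt a b) -` box l u \<inter> space (lborel \<Otimes>\<^sub>M lborel)
      = box (l $ 1) (u $ 1) \<times> box (l $ 2) (u $ 2)"
    by (auto simp: box_def Basis_plane inner_axis_plane space_pair_measure)
  then have "emeasure (distr (lborel \<Otimes>\<^sub>M lborel) borel (\<lambda>(a, b). pt a b)) (box l u)
      = emeasure (lborel \<Otimes>\<^sub>M lborel) (box (l $ 1) (u $ 1) \<times> box (l $ 2) (u $ 2))"
    by (subst emeasure_distr) auto
  also have "\<dots> = ennreal (u $ 1 - l $ 1) * ennreal (u $ 2 - l $ 2)"
    using le by (subst lborel.emeasure_pair_measure_Times) auto
  also have "\<dots> = (\<Prod>b\<in>Basis. (u - l) \<bullet> b)"
    using le by (simp add: Basis_plane axis_neq inner_axis_plane ennreal_mult)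
  finally show "emeasure (distr (lborel \<Otimes>\<^sub>M lborel) borel (\<lambda>(a, b). pt a b)) (box l u)
      = (\<Prod>b\<in>Basis. (u - l) \<bullet> b)" .
qed simp

lemma nn_integral_plane:
  assumes [measurable]: "f \<in> borel_measurable borel"
  shows "(\<integral>\<^sup>+x. f x \<partial>lborel) = (\<integral>\<^sup>+a. \<integral>\<^sup>+b. f (pt a b) \<partial>lborel \<partial>lborel)"
  by (subst lborel_plane, subst nn_integral_distr)
     (auto simp: lborel.nn_integral_fst[symmetric])

lemma integrable_plane:
  fixes f :: "plane \<Rightarrow> 'a::{banach, second_countable_topology}"
  assumes "integrable lborel f"
  shows "integrable (lborel \<Otimes>\<^sub>M lborel) (\<lambda>(a, b). f (pt a b))"
proof -
  have m: "f \<in> borel_measurable borel" using assms by auto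
  have "integrable (distr (lborel \<Otimes>\<^sub>M lborel) borel (\<lambda>(a, b). pt a b)) f"
    using assms lborel_plane by simp
  then show ?thesis
    using integrable_distr_eq[OF measurable_pt' m] by (simp add: case_prod_unfold)
qed

lemma integral_plane:
  fixes f :: "plane \<Rightarrow> 'a::{banach, second_countable_topology}"
  assumes f: "integrable lborel f"
  shows "(LBINT x. f x) = (LBINT a. LBINT b. f (pt a b))"
proof -
  have m: "f \<in> borel_measurable borel" using f by auto
  have "(LBINT x. f x) = (\<integral>p. (\<lambda>(a, b). f (pt a b)) p \<partial>(lborel \<Otimes>\<^sub>M lborel))"
    by (subst lborel_plane, subst integral_distr[OF measurable_pt' m]) (simp add: case_prod_unfold)
  also have "\<dots> = (LBINT a. LBINT b. f (pt a b))"
    using lborel_pair.integral_fst'[OF integrable_plane[OF f]] by simp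
  finally show ?thesis .
qed

text \<open>For a unit vector \<open>e\<close> this is the reflection in the line
  \<open>x \<bullet> e = \<tau>\<close>. Throughout, \<open>\<tau> < x \<bullet> e\<close> is the
  favoured side.\<close>

definition reflect :: "plane \<Rightarrow> real \<Rightarrow> plane \<Rightarrow> plane" where
  "reflect e \<tau> x = x - (2 * (x \<bullet> e - \<tau>)) *\<^sub>R e"

lemma continuous_on_reflect [continuous_intros]: "continuous_on S (reflect e \<tau>)"
  unfolding reflect_def by (intro continuous_intros)

lemma measurable_reflect [measurable]: "reflect e \<tau> \<in> borel_measurable borel"
  by (intro borel_measurable_continuous_onI continuous_intros)

lemma inner_reflect: "norm e = 1 \<Longrightarrow> reflect e \<tau> x \<bullet> e = 2 * \<tau> - x \<bullet> e"
  by (simp add: reflect_def inner_diff_left norm_eq_1)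

lemma reflect_reflect [simp]: "norm e = 1 \<Longrightarrow> reflect e \<tau> (reflect e \<tau> x) = x"
  using inner_reflect[of e \<tau> x] by (simp add: reflect_def[of e \<tau> "reflect e \<tau> x"])
     (simp add: reflect_def algebra_simps flip: scaleR_add_left)

text \<open>The sign of the added product tells whether \<open>x\<close> and \<open>y\<close> lie on
  the same side of the axis. Every comparison of kernel values under reflection rests on this
  identity.\<close>

lemma norm_reflect_diff_sq:
  assumes "norm e = 1"
  shows "(norm (reflect e \<tau> x - y))\<^sup>2 = (norm (x - y))\<^sup>2 + 4 * (x \<bullet> e - \<tau>) * (y \<bullet> e - \<tau>)"
proof -
  have e: "e \<bullet> e = 1" using assms by (simp add: norm_eq_1)
  have "reflect e \<tau> x - y = (x - y) - (2 * (x \<bullet> e - \<tau>)) *\<^sub>R e" by (simp add: reflect_def)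
  moreover have "(norm (z - k *\<^sub>R e))\<^sup>2 = (norm z)\<^sup>2 - 2 * k * (z \<bullet> e) + k\<^sup>2" for z k
    unfolding power2_norm_eq_inner
    by (simp add: inner_diff_left inner_diff_right inner_commute e power2_eq_square)
  ultimately have "(norm (reflect e \<tau> x - y))\<^sup>2 = (norm (x - y))\<^sup>2
      - 2 * (2 * (x \<bullet> e - \<tau>)) * ((x - y) \<bullet> e) + (2 * (x \<bullet> e - \<tau>))\<^sup>2"
    by metis
  also have "\<dots> = (norm (x - y))\<^sup>2 + 4 * (x \<bullet> e - \<tau>) * (y \<bullet> e - \<tau>)"
    by (simp only: inner_diff_left) algebra
  finally show ?thesis .
qed

lemma norm_reflect_reflect:
  assumes "norm e = 1" shows "norm (reflect e \<tau> x - reflect e \<tau> y) = norm (x - y)"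
proof -
  have "(norm (reflect e \<tau> x - reflect e \<tau> y))\<^sup>2 = (norm (x - y))\<^sup>2"
    using norm_reflect_diff_sq[OF assms, of \<tau> x "reflect e \<tau> y"] norm_reflect_diff_sq[OF assms, of \<tau> y x]
    by (simp add: norm_minus_commute inner_reflect assms algebra_simps)
  then show ?thesis by (simp add: power2_eq_iff_nonneg)
qed

text \<open>The axis is the perpendicular bisector of the two points. This turns statements about
  all reflections into statements about distances: radial monotonicity in
  \<open>heat_radially_decreasing\<close> and rotation invariance in
  \<open>FT_cap_rotate\<close>.\<close>

lemma reflect_swap:
  assumes "x \<noteq> y"
  defines "e \<equiv> (x - y) /\<^sub>R norm (x - y)"
  shows "norm e = 1" "reflect e (((x + y) /\<^sub>R 2) \<bullet> e) x = y"
proof -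
  show "norm e = 1" using assms by simp
  have "2 * (x \<bullet> e - ((x + y) /\<^sub>R 2) \<bullet> e) = (x - y) \<bullet> e"
    by (simp add: inner_diff_left inner_add_left inverse_eq_divide field_simps)
  also have "\<dots> = norm (x - y)"
    using assms by (simp add: dot_square_norm power2_eq_square)
  finally show "reflect e (((x + y) /\<^sub>R 2) \<bullet> e) x = y"
    using assms(1) by (simp add: reflect_def e_def)
qed

text \<open>The reflection is an orthogonal map, the reflection in the parallel line through the
  origin, followed by a translation. Both preserve Lebesgue measure.\<close>

lemma lborel_distr_reflect:
  assumes e: "norm e = 1"
  shows "distr lborel borel (reflect e \<tau>) = lborel"
proof -
  define s where "s = reflect e 0"
  have inv: "s (s x) = x" for x using e by (simp add: s_def)
  have lin: "linear s" unfolding s_def reflect_def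
    by (intro linearI) (auto simp: inner_add_left algebra_simps)
  have "orthogonal_transformation s"
    unfolding orthogonal_transformation using lin norm_reflect_reflect[OF e, of 0 _ 0]
    by (simp add: s_def reflect_def)
  then have img: "S \<in> lmeasurable \<Longrightarrow> measure lebesgue (s ` S) = measure lebesgue S"
     "S \<in> lmeasurable \<Longrightarrow> s ` S \<in> lmeasurable" for S
    using measure_orthogonal_image measurable_orthogonal_image by blast+
  have vimg: "s -` S = s ` S" for S using inv by (auto simp: image_iff) metis
  have ms [measurable]: "s \<in> borel_measurable borel" by (simp add: s_def)
  have A: "lborel = distr lborel borel s"
  proof (rule lborel_eqI)
    fix l u :: plane assume lu: "\<And>b. b \<in> Basis \<Longrightarrow> l \<bullet> b \<le> u \<bullet> b"
    have "emeasure (distr lborel borel s) (box l u) = emeasure lborel (s -` box l u)"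
      by (subst emeasure_distr) auto
    also have "\<dots> = emeasure lebesgue (s ` box l u)"
      using measurable_sets_borel[OF ms, of "box l u"]
      by (simp add: vimg[symmetric] main_part_sets)
    also have "\<dots> = measure lebesgue (box l u)"
      using img(2)[of "box l u"] img(1)[of "box l u"]
      by (simp add: emeasure_eq_measure2 fmeasurableD2)
    also have "\<dots> = emeasure lborel (box l u)"
      by (subst emeasure_eq_ennreal_measure[symmetric]) (auto simp: emeasure_lborel_box_eq)
    finally show "emeasure (distr lborel borel s) (box l u) = (\<Prod>b\<in>Basis. (u - l) \<bullet> b)"
      using lu by simp
  qed simp
  have "reflect e \<tau> = (+) ((2 * \<tau>) *\<^sub>R e) \<circ> s"
    by (auto simp: fun_eq_iff s_def reflect_def algebra_simps)
  then have "distr lborel borel (reflect e \<tau>) = distr (distr lborel borel s) borel ((+) ((2 * \<tau>) *\<^sub>R e))"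
    by (subst distr_distr) auto
  then show ?thesis using A lborel_distr_plus by metis
qed

lemma integral_reflect:
  fixes f :: "plane \<Rightarrow> 'a::{banach, second_countable_topology}"
  assumes "norm e = 1" and [measurable]: "f \<in> borel_measurable borel"
  shows "(LBINT x. f (reflect e \<tau> x)) = (LBINT x. f x)"
  by (subst (2) lborel_distr_reflect[OF assms(1), of \<tau>, symmetric], subst integral_distr) auto

lemma integrable_reflect:
  fixes f :: "plane \<Rightarrow> 'a::{banach, second_countable_topology}"
  assumes "norm e = 1" and f: "integrable lborel f"
  shows "integrable lborel (\<lambda>x. f (reflect e \<tau> x))"
proof -
  have [measurable]: "f \<in> borel_measurable borel" using f by auto
  show ?thesis using f
    by (subst (asm) lborel_distr_reflect[OF assms(1), of \<tau>, symmetric], subst (asm) integrable_distr_eq) auto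
qed

lemma AE_reflect:
  assumes "norm e = 1" and [measurable]: "Measurable.pred borel P" and P: "AE x in lborel. P x"
  shows "AE x in lborel. P (reflect e \<tau> x)"
  using P by (subst (asm) lborel_distr_reflect[OF assms(1), of \<tau>, symmetric], subst (asm) AE_distr_iff) auto

lemma nn_integral_translate:
  assumes [measurable]: "f \<in> borel_measurable borel"
  shows "(\<integral>\<^sup>+x. f (x + c) \<partial>lborel) = (\<integral>\<^sup>+x. f (x::'a::euclidean_space) \<partial>lborel)"
  by (subst (2) lborel_distr_plus[of c, symmetric], subst nn_integral_distr) (auto simp: add.commute)

lemma integral_translate:
  fixes f :: "'b::euclidean_space \<Rightarrow> 'a::{banach, second_countable_topology}"
  assumes [measurable]: "f \<in> borel_measurable borel"
  shows "(LBINT x. f (x + c)) = (LBINT x. f x)"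
  by (subst (2) lborel_distr_plus[of c, symmetric], subst integral_distr) (auto simp: add.commute)

lemma integrable_translate:
  fixes f :: "'b::euclidean_space \<Rightarrow> 'a::{banach, second_countable_topology}"
  assumes f: "integrable lborel f"
  shows "integrable lborel (\<lambda>x. f (x + c))"
proof -
  have [measurable]: "f \<in> borel_measurable borel" using f by auto
  show ?thesis using f
    by (subst (asm) lborel_distr_plus[of c, symmetric], subst (asm) integrable_distr_eq) (auto simp: add.commute)
qed

section \<open>Gaussian kernels\<close>

lemma measurable_fst_borel [measurable]: "fst \<in> borel_measurable borel"
  and measurable_snd_borel [measurable]: "snd \<in> borel_measurable borel"
  by (intro borel_measurable_continuous_onI continuous_intros)+

lemma square_add_le: "((a::real) + b)\<^sup>2 \<le> 2 * a\<^sup>2 + 2 * b\<^sup>2"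
  using sum_squares_bound[of a b] by (simp add: power2_sum)

lemma nn_integral_lborel_pair:
  fixes f :: "'a::euclidean_space \<times> 'b::euclidean_space \<Rightarrow> ennreal"
  assumes [measurable]: "f \<in> borel_measurable borel"
  shows "(\<integral>\<^sup>+p. f p \<partial>lborel) = (\<integral>\<^sup>+x. \<integral>\<^sup>+y. f (x, y) \<partial>lborel \<partial>lborel)"
    and "(\<integral>\<^sup>+p. f p \<partial>lborel) = (\<integral>\<^sup>+y. \<integral>\<^sup>+x. f (x, y) \<partial>lborel \<partial>lborel)"
proof -
  have m: "f \<in> borel_measurable (lborel \<Otimes>\<^sub>M lborel)" by (simp add: lborel_prod)
  show "(\<integral>\<^sup>+p. f p \<partial>lborel) = (\<integral>\<^sup>+x. \<integral>\<^sup>+y. f (x, y) \<partial>lborel \<partial>lborel)"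
    using lborel.nn_integral_fst[OF m] by (simp add: lborel_prod)
  show "(\<integral>\<^sup>+p. f p \<partial>lborel) = (\<integral>\<^sup>+y. \<integral>\<^sup>+x. f (x, y) \<partial>lborel \<partial>lborel)"
    using lborel_pair.nn_integral_snd[OF m] by (simp add: lborel_prod)
qed

lemma integral_lborel_pair:
  fixes f :: "'a::euclidean_space \<times> 'b::euclidean_space \<Rightarrow> 'c::{banach, second_countable_topology}"
  assumes f: "integrable lborel f"
  shows "(LBINT p. f p) = (LBINT x. LBINT y. f (x, y))"
    and "(LBINT p. f p) = (LBINT y. LBINT x. f (x, y))"
proof -
  have i: "integrable (lborel \<Otimes>\<^sub>M lborel) f" using f by (simp add: lborel_prod)
  show "(LBINT p. f p) = (LBINT x. LBINT y. f (x, y))"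
    using lborel_pair.integral_fst'[OF i] by (simp add: lborel_prod)
  show "(LBINT p. f p) = (LBINT y. LBINT x. f (x, y))"
    using lborel_pair.integral_snd[of "\<lambda>x y. f (x, y)"] i by (simp add: lborel_prod)
qed

lemma integrable_lborel_pair_mult:
  fixes g :: "'a::euclidean_space \<Rightarrow> real" and h :: "'b::euclidean_space \<Rightarrow> real"
  assumes g: "integrable lborel g" and h: "integrable lborel h"
  shows "integrable lborel (\<lambda>p. g (fst p) * h (snd p))"
proof -
  have [measurable]: "g \<in> borel_measurable borel" "h \<in> borel_measurable borel" using g h by auto
  have "(\<integral>\<^sup>+p. ennreal (norm (g (fst p) * h (snd p))) \<partial>lborel)
      = (\<integral>\<^sup>+x. \<integral>\<^sup>+y. ennreal \<bar>g x\<bar> * ennreal \<bar>h y\<bar> \<partial>lborel \<partial>lborel)"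
    by (subst nn_integral_lborel_pair) (auto simp: abs_mult ennreal_mult)
  also have "\<dots> = (\<integral>\<^sup>+x. ennreal \<bar>g x\<bar> \<partial>lborel) * (\<integral>\<^sup>+y. ennreal \<bar>h y\<bar> \<partial>lborel)"
    by (simp add: nn_integral_cmult nn_integral_multc)
  also have "\<dots> < \<infinity>"
    using g h by (auto simp: integrable_iff_bounded ennreal_mult_less_top)
  finally show ?thesis by (simp add: integrable_iff_bounded borel_prod[symmetric])
qed

lemma integrable_prodI:
  fixes f :: "'a::euclidean_space \<times> 'b::euclidean_space \<Rightarrow> 'c::{banach, second_countable_topology}"
  assumes [measurable]: "f \<in> borel_measurable borel"
    and fin: "(\<integral>\<^sup>+x. \<integral>\<^sup>+y. ennreal (norm (f (x, y))) \<partial>lborel \<partial>lborel) < \<infinity>"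
  shows "integrable lborel f"
  using fin by (simp add: integrable_iff_bounded nn_integral_lborel_pair(1))

text \<open>The heat kernel of the plane at time \<open>t\<close>: it has mass 1, and its Fourier
  multiplier is \<open>exp (- t * (norm \<xi>)\<^sup>2)\<close>.\<close>

definition gaussian :: "real \<Rightarrow> plane \<Rightarrow> real" where
  "gaussian t z = exp (- (norm z)\<^sup>2 / (4 * t)) / (4 * pi * t)"

lemma continuous_on_gaussian: "continuous_on S (gaussian t)"
  unfolding gaussian_def divide_inverse by (intro continuous_intros)

lemma measurable_gaussian [measurable]: "gaussian t \<in> borel_measurable borel"
  by (intro borel_measurable_continuous_onI continuous_on_gaussian)

lemma gaussian_pos: "t > 0 \<Longrightarrow> gaussian t z > 0"
  by (simp add: gaussian_def)

lemma gaussian_minus [simp]: "gaussian t (- z) = gaussian t z"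
  by (simp add: gaussian_def)

lemma gaussian_swap: "gaussian t (x - y) = gaussian t (y - x)"
  by (simp add: gaussian_def norm_minus_commute)

lemma gaussian_le: "t > 0 \<Longrightarrow> gaussian t z \<le> 1 / (4 * pi * t)"
  by (simp add: gaussian_def divide_right_mono)

lemma gaussian_le_iff:
  assumes "t > 0" shows "gaussian t x \<le> gaussian t y \<longleftrightarrow> norm y \<le> norm x"
proof -
  have "gaussian t x \<le> gaussian t y \<longleftrightarrow> - (norm x)\<^sup>2 / (4 * t) \<le> - (norm y)\<^sup>2 / (4 * t)"
  proof -
    define c where "c = 4 * pi * t"
    have "c > 0" using assms by (simp add: c_def)
    then show ?thesis unfolding gaussian_def c_def[symmetric] by (simp add: divide_le_cancel)
  qed
  also have "\<dots> \<longleftrightarrow> (norm y)\<^sup>2 \<le> (norm x)\<^sup>2"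
    using assms by (simp add: divide_le_cancel)
  finally show ?thesis by (simp add: power_mono_iff)
qed

lemma gaussian_less_iff: "t > 0 \<Longrightarrow> gaussian t x < gaussian t y \<longleftrightarrow> norm y < norm x"
  using gaussian_le_iff[of t y x] by (simp flip: not_le)

text \<open>A rescaling of the characteristic function of the standard normal distribution: the
  factor \<open>sqrt (2 * t)\<close> turns its density into a multiple of the given
  Gaussian.\<close>

lemma fourier_gaussian_real:
  assumes t: "t > 0"
  shows "integrable lborel (\<lambda>x::real. exp (- t * x\<^sup>2))"
    and "(LBINT x. exp (- \<i> * complex_of_real (r * x)) * complex_of_real (exp (- t * x\<^sup>2)))
       = complex_of_real (sqrt (pi / t) * exp (- r\<^sup>2 / (4 * t)))"
proof -
  define c where "c = sqrt (2 * t)"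
  have c: "c > 0" "c\<^sup>2 = 2 * t" using t by (auto simp: c_def)
  have e: "std_normal_density (0 + c * x) = exp (- t * x\<^sup>2) / sqrt (2 * pi)" for x
    using c by (simp add: normal_density_def power_mult_distrib)
  have "integrable lborel (\<lambda>x. std_normal_density (0 + c * x))"
    by (rule lborel_integrable_real_affine) (use c in auto)
  then show "integrable lborel (\<lambda>x::real. exp (- t * x\<^sup>2))"
    unfolding e by (simp add: divide_inverse)
  define s where "s = - r / c"
  have "char std_normal_distribution s
      = (LBINT x. std_normal_density x *\<^sub>R exp (\<i> * complex_of_real (s * x)))"
    unfolding char_def by (subst integral_density) (auto simp: mult.commute)
  also have "\<dots> = \<bar>c\<bar> *\<^sub>R (LBINT x. std_normal_density (0 + c * x) *\<^sub>R exp (\<i> * complex_of_real (s * (0 + c * x))))"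
    by (rule lborel_integral_real_affine) (use c in auto)
  also have "\<dots> = \<bar>c\<bar> *\<^sub>R (LBINT x. (1 / sqrt (2 * pi)) *\<^sub>R (exp (- \<i> * complex_of_real (r * x)) * complex_of_real (exp (- t * x\<^sup>2))))"
    unfolding e using c by (simp add: s_def scaleR_conv_of_real mult_ac)
  also have "\<dots> = complex_of_real (c / sqrt (2 * pi)) * (LBINT x. exp (- \<i> * complex_of_real (r * x)) * complex_of_real (exp (- t * x\<^sup>2)))"
    using c by (simp add: scaleR_conv_of_real)
  finally have "complex_of_real (c / sqrt (2 * pi)) * (LBINT x. exp (- \<i> * complex_of_real (r * x)) * complex_of_real (exp (- t * x\<^sup>2)))
     = complex_of_real (exp (- s\<^sup>2 / 2))"
    by (simp add: char_std_normal_distribution)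
  moreover have "- s\<^sup>2 / 2 = - r\<^sup>2 / (4 * t)" using c by (simp add: s_def power_divide)
  moreover have "c / sqrt (2 * pi) = 1 / sqrt (pi / t)" using t by (simp add: c_def real_sqrt_divide real_sqrt_mult)
  ultimately have "complex_of_real (1 / sqrt (pi / t)) * (LBINT x. exp (- \<i> * complex_of_real (r * x)) * complex_of_real (exp (- t * x\<^sup>2)))
     = complex_of_real (exp (- r\<^sup>2 / (4 * t)))"
    by (simp only:)
  then have "complex_of_real (sqrt (pi / t)) * (complex_of_real (1 / sqrt (pi / t)) * (LBINT x. exp (- \<i> * complex_of_real (r * x)) * complex_of_real (exp (- t * x\<^sup>2))))
     = complex_of_real (sqrt (pi / t)) * complex_of_real (exp (- r\<^sup>2 / (4 * t)))"
    by (simp only:)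
  moreover have "complex_of_real (sqrt (pi / t)) * complex_of_real (1 / sqrt (pi / t)) = 1"
    using t unfolding of_real_mult[symmetric] by simp
  ultimately show "(LBINT x. exp (- \<i> * complex_of_real (r * x)) * complex_of_real (exp (- t * x\<^sup>2)))
       = complex_of_real (sqrt (pi / t) * exp (- r\<^sup>2 / (4 * t)))"
    by (simp only: mult.assoc[symmetric] mult_1_left of_real_mult)
qed

lemma fourier_gaussian:
  assumes t: "t > 0"
  shows "integrable lborel (\<lambda>\<xi>::plane. exp (- t * (norm \<xi>)\<^sup>2))"
    and "(LBINT \<xi>. exp (- \<i> * complex_of_real (z \<bullet> \<xi>)) * complex_of_real (exp (- t * (norm \<xi>)\<^sup>2)))
       = complex_of_real (4 * pi\<^sup>2 * gaussian t z)"
proof -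
  let ?e = "\<lambda>x::real. exp (- t * x\<^sup>2)"
  have m: "?e \<in> borel_measurable borel" by measurable
  have fin: "(\<integral>\<^sup>+x. ennreal (?e x) \<partial>lborel) < \<infinity>"
    using fourier_gaussian_real(1)[OF t] by (simp add: integrable_iff_bounded)
  have "(\<integral>\<^sup>+\<xi>. ennreal (norm (exp (- t * (norm (\<xi>::plane))\<^sup>2))) \<partial>lborel)
      = (\<integral>\<^sup>+a. \<integral>\<^sup>+b. ennreal (?e a) * ennreal (?e b) \<partial>lborel \<partial>lborel)"
    by (subst nn_integral_plane)
       (auto simp: norm_plane_sq algebra_simps simp flip: exp_add ennreal_mult)
  also have "\<dots> = (\<integral>\<^sup>+x. ennreal (?e x) \<partial>lborel) * (\<integral>\<^sup>+x. ennreal (?e x) \<partial>lborel)"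
    by (simp add: nn_integral_cmult nn_integral_multc)
  also have "\<dots> < \<infinity>" using fin by (simp add: ennreal_mult_less_top)
  finally show int: "integrable lborel (\<lambda>\<xi>::plane. exp (- t * (norm \<xi>)\<^sup>2))"
    by (simp add: integrable_iff_bounded)
  let ?h = "\<lambda>r x. exp (- \<i> * complex_of_real (r * x)) * complex_of_real (?e x)"
  have "integrable lborel (\<lambda>\<xi>::plane. exp (- \<i> * complex_of_real (z \<bullet> \<xi>)) * complex_of_real (exp (- t * (norm \<xi>)\<^sup>2)))"
    by (rule Bochner_Integration.integrable_bound[OF int])
       (auto simp: norm_mult intro!: borel_measurable_continuous_onI continuous_intros)
  then have "(LBINT \<xi>. exp (- \<i> * complex_of_real (z \<bullet> \<xi>)) * complex_of_real (exp (- t * (norm \<xi>)\<^sup>2)))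
     = (LBINT a. LBINT b. ?h (z $ 1) a * ?h (z $ 2) b)"
    by (subst integral_plane)
       (simp_all add: inner_plane norm_plane_sq distrib_left exp_add mult_ac exp_diff exp_minus divide_inverse)
  also have "\<dots> = complex_of_real (sqrt (pi / t) * exp (- (z $ 1)\<^sup>2 / (4 * t)))
     * complex_of_real (sqrt (pi / t) * exp (- (z $ 2)\<^sup>2 / (4 * t)))"
    by (simp only: fourier_gaussian_real(2)[OF t] integral_mult_right_zero integral_mult_left_zero)
  also have "\<dots> = complex_of_real (4 * pi\<^sup>2 * gaussian t z)"
  proof -
    have "exp (- (z $ 1)\<^sup>2 / (4 * t)) * exp (- (z $ 2)\<^sup>2 / (4 * t)) = exp (- (norm z)\<^sup>2 / (4 * t))"
      by (simp add: norm_plane_sq add_divide_distrib diff_divide_distrib flip: exp_add)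
    moreover have "sqrt (pi / t) * sqrt (pi / t) = pi / t" using t by simp
    ultimately have "sqrt (pi / t) * exp (- (z $ 1)\<^sup>2 / (4 * t)) * (sqrt (pi / t) * exp (- (z $ 2)\<^sup>2 / (4 * t)))
       = (pi / t) * exp (- (norm z)\<^sup>2 / (4 * t))"
      by (metis (no_types, lifting) mult.assoc mult.left_commute)
    also have "\<dots> = 4 * pi\<^sup>2 * gaussian t z"
      using t by (simp add: gaussian_def power2_eq_square)
    finally show ?thesis by (simp only: of_real_mult[symmetric])
  qed
  finally show "(LBINT \<xi>. exp (- \<i> * complex_of_real (z \<bullet> \<xi>)) * complex_of_real (exp (- t * (norm \<xi>)\<^sup>2)))
       = complex_of_real (4 * pi\<^sup>2 * gaussian t z)" .
qed

lemma
  assumes t: "t > 0"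
  shows integrable_gaussian: "integrable lborel (gaussian t)"
    and integral_gaussian: "(LBINT z. gaussian t z) = 1"
proof -
  have t': "1 / (4 * t) > 0" using t by simp
  have eq: "gaussian t = (\<lambda>z. exp (- (1 / (4 * t)) * (norm z)\<^sup>2) / (4 * pi * t))"
    by (simp add: gaussian_def fun_eq_iff)
  show "integrable lborel (gaussian t)"
    unfolding eq using fourier_gaussian(1)[OF t'] by (rule integrable_divide_zero)
  have "complex_of_real (LBINT z. exp (- (1 / (4 * t)) * (norm (z::plane))\<^sup>2)) = complex_of_real (4 * pi * t)"
    unfolding integral_complex_of_real[symmetric]
    using fourier_gaussian(2)[OF t', of 0] t by (simp add: gaussian_def power2_eq_square)
  then have "(LBINT z. exp (- (1 / (4 * t)) * (norm (z::plane))\<^sup>2)) = 4 * pi * t"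
    by (simp only: of_real_eq_iff)
  then show "(LBINT z. gaussian t z) = 1"
    using t unfolding eq by simp
qed

lemma nn_integral_gaussian: "t > 0 \<Longrightarrow> (\<integral>\<^sup>+z. ennreal (gaussian t z) \<partial>lborel) = 1"
  by (subst nn_integral_eq_integral)
     (auto simp: integrable_gaussian integral_gaussian intro!: AE_I2 less_imp_le gaussian_pos)

text \<open>The working class of functions. Bounded support makes them integrable, so the Fourier
  transform is a plain integral instead of a limit of truncations. Borel measurability allows
  composition with reflections and the use of product measures.\<close>

definition L2_bounded :: "(plane \<Rightarrow> real) \<Rightarrow> bool" where
  "L2_bounded f \<longleftrightarrow> f \<in> borel_measurable borel \<and> (\<exists>R. \<forall>x. norm x > R \<longrightarrow> f x = 0) \<and>
     integrable lborel (\<lambda>x. (f x)\<^sup>2)"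

lemma L2_bounded_measurable [measurable_dest]: "L2_bounded f \<Longrightarrow> f \<in> borel_measurable borel"
  by (simp add: L2_bounded_def)

lemma L2_bounded_square: "L2_bounded f \<Longrightarrow> integrable lborel (\<lambda>x. (f x)\<^sup>2)"
  by (simp add: L2_bounded_def)

lemma L2_bounded_integrable:
  assumes "L2_bounded f" shows "integrable lborel f"
proof -
  note [measurable] = L2_bounded_measurable[OF assms]
  obtain R where R: "\<And>x. norm x > R \<Longrightarrow> f x = 0" using assms by (auto simp: L2_bounded_def)
  have i: "integrable lborel (\<lambda>x. indicator (cball 0 R) x + (f x)\<^sup>2)"
    using L2_bounded_square[OF assms] by (intro Bochner_Integration.integrable_add integrable_real_indicator) (auto simp: emeasure_lborel_cball_finite[unfolded infinity_ennreal_def])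
  have "\<bar>f x\<bar> \<le> 1 + (f x)\<^sup>2" for x using sum_squares_bound[of 1 "\<bar>f x\<bar>"] by simp
  then have "norm (f x) \<le> norm (indicator (cball 0 R) x + (f x)\<^sup>2)" for x
    using R[of x] by (auto simp: indicator_def not_le)
  then show ?thesis by (intro Bochner_Integration.integrable_bound[OF i] AE_I2) auto
qed

lemma L2_bounded_dominated:
  assumes f: "L2_bounded f" and [measurable]: "g \<in> borel_measurable borel" and le: "\<And>x. \<bar>g x\<bar> \<le> \<bar>f x\<bar>"
  shows "L2_bounded g"
proof -
  obtain R where R: "\<And>x. norm x > R \<Longrightarrow> f x = 0" using f by (auto simp: L2_bounded_def)
  then have "norm x > R \<Longrightarrow> g x = 0" for x using le[of x] by force
  moreover have "integrable lborel (\<lambda>x. (g x)\<^sup>2)"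
    by (rule Bochner_Integration.integrable_bound[OF L2_bounded_square[OF f]])
       (auto intro!: AE_I2 abs_le_square_iff[THEN iffD1] le)
  ultimately show ?thesis unfolding L2_bounded_def by auto
qed

lemma L2_bounded_abs: "L2_bounded f \<Longrightarrow> L2_bounded (\<lambda>x. \<bar>f x\<bar>)"
  by (rule L2_bounded_dominated) auto

lemma L2_bounded_cmult: "L2_bounded f \<Longrightarrow> L2_bounded (\<lambda>x. c * f x)"
  unfolding L2_bounded_def by (auto simp: power_mult_distrib)

lemma L2_bounded_add:
  assumes "L2_bounded f" "L2_bounded g" shows "L2_bounded (\<lambda>x. f x + g x)"
proof -
  note [measurable] = assms[THEN L2_bounded_measurable]
  obtain R S where R: "\<And>x. norm x > R \<Longrightarrow> f x = 0" and S: "\<And>x. norm x > S \<Longrightarrow> g x = 0"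
    using assms by (auto simp: L2_bounded_def)
  have i: "integrable lborel (\<lambda>x. 2 * (f x)\<^sup>2 + 2 * (g x)\<^sup>2)"
    using assms[THEN L2_bounded_square] by auto
  have "integrable lborel (\<lambda>x. (f x + g x)\<^sup>2)"
    by (intro Bochner_Integration.integrable_bound[OF i]) (auto intro!: AE_I2 square_add_le)
  moreover have "norm x > max R S \<Longrightarrow> f x + g x = 0" for x using R S by auto
  ultimately show ?thesis unfolding L2_bounded_def by (blast intro: borel_measurable_add assms[THEN L2_bounded_measurable])
qed

lemma L2_bounded_diff:
  assumes "L2_bounded f" "L2_bounded g" shows "L2_bounded (\<lambda>x. f x - g x)"
  using L2_bounded_add[OF assms(1) L2_bounded_cmult[OF assms(2), of "-1"]] by simp

lemma L2_bounded_bounded: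
  assumes [measurable]: "f \<in> borel_measurable borel" and "\<And>x. norm x > R \<Longrightarrow> f x = 0" "\<And>x. \<bar>f x\<bar> \<le> B"
  shows "L2_bounded f"
proof -
  have i: "integrable lborel (\<lambda>x::plane. B * indicator (cball 0 R) x)"
    by (intro integrable_mult_right integrable_real_indicator) (auto simp: emeasure_lborel_cball_finite[unfolded infinity_ennreal_def])
  have "L2_bounded (\<lambda>x. B * indicator (cball 0 R) x)"
    unfolding L2_bounded_def
  proof (intro conjI)
    have "(\<lambda>x. (B * indicator (cball 0 R) x)\<^sup>2) = (\<lambda>x::plane. B * (B * indicator (cball 0 R) x))"
      by (auto simp: indicator_def power2_eq_square)
    then show "integrable lborel (\<lambda>x::plane. (B * indicator (cball 0 R) x)\<^sup>2)"
      using integrable_mult_right[OF i, of B] by simp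
  qed (auto simp: indicator_def intro!: exI[of _ R])
  then show ?thesis
    by (rule L2_bounded_dominated) (use assms in \<open>auto simp: indicator_def not_le intro: order_trans[OF _ abs_ge_self]\<close>)
qed

section \<open>Continuity of translations in the mean\<close>

lemma tendsto_zero_ennreal_le:
  fixes f g :: "nat \<Rightarrow> ennreal"
  assumes "g \<longlonglongrightarrow> 0" "\<And>n. f n \<le> g n" shows "f \<longlonglongrightarrow> 0"
  by (rule tendsto_sandwich[OF _ _ tendsto_const assms(1)]) (use assms(2) in auto)

text \<open>The squared modulus of continuity in the mean, with values in \<open>ennreal\<close> so
  that it can be estimated before any integrability is known.\<close>

definition shift_defect :: "('a::euclidean_space \<Rightarrow> real) \<Rightarrow> 'a \<Rightarrow> ennreal" where
  "shift_defect f z = (\<integral>\<^sup>+x. ennreal ((f (x + z) - f x)\<^sup>2) \<partial>lborel)"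

lemma shift_defect_le:
  fixes f g :: "'a::euclidean_space \<Rightarrow> real"
  assumes [measurable]: "f \<in> borel_measurable borel" "g \<in> borel_measurable borel"
  shows "shift_defect f z \<le> 3 * shift_defect g z + 6 * (\<integral>\<^sup>+x. ennreal ((f x - g x)\<^sup>2) \<partial>lborel)"
proof -
  have "(f (x + z) - f x)\<^sup>2 \<le> 3 * (g (x + z) - g x)\<^sup>2 + 3 * (f (x + z) - g (x + z))\<^sup>2 + 3 * (f x - g x)\<^sup>2" for x
  proof -
    have "(a + b + c)\<^sup>2 \<le> 3 * a\<^sup>2 + 3 * b\<^sup>2 + 3 * c\<^sup>2" for a b c :: real
    proof -
      have "0 \<le> (a - b)\<^sup>2 + (b - c)\<^sup>2 + (a - c)\<^sup>2" by simp
      then show ?thesis by (simp add: power2_eq_square algebra_simps)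
    qed
    from this[of "g (x + z) - g x" "f (x + z) - g (x + z)" "g x - f x"] show ?thesis
      by (simp add: power2_commute[of "g x" "f x"])
  qed
  then have "shift_defect f z \<le> (\<integral>\<^sup>+x. 3 * ennreal ((g (x + z) - g x)\<^sup>2)
      + 3 * ennreal ((f (x + z) - g (x + z))\<^sup>2) + 3 * ennreal ((f x - g x)\<^sup>2) \<partial>lborel)"
    unfolding shift_defect_def
    by (intro nn_integral_mono) (simp flip: ennreal_plus ennreal_mult' ennreal_numeral add: ennreal_leI)
  also have "\<dots> = 3 * shift_defect g z + 3 * (\<integral>\<^sup>+x. ennreal ((f (x + z) - g (x + z))\<^sup>2) \<partial>lborel)
      + 3 * (\<integral>\<^sup>+x. ennreal ((f x - g x)\<^sup>2) \<partial>lborel)"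
    unfolding shift_defect_def by (simp add: nn_integral_add nn_integral_cmult)
  also have "(\<integral>\<^sup>+x. ennreal ((f (x + z) - g (x + z))\<^sup>2) \<partial>lborel) = (\<integral>\<^sup>+x. ennreal ((f x - g x)\<^sup>2) \<partial>lborel)"
    by (rule nn_integral_translate[of "\<lambda>x. ennreal ((f x - g x)\<^sup>2)"]) measurable
  finally show ?thesis by (simp add: add.assoc flip: distrib_right)
qed

text \<open>The functions whose translates converge in the mean form a closed class: an
  approximation error enters the shift defect with a fixed factor, independent of the shift.\<close>

lemma shift_defect_tendsto_approx:
  fixes f :: "'a::euclidean_space \<Rightarrow> real"
  assumes [measurable]: "f \<in> borel_measurable borel"
    and approx: "\<And>\<epsilon>::real. \<epsilon> > 0 \<Longrightarrow> \<exists>g. g \<in> borel_measurable borel \<and> (\<lambda>n. shift_defect g (z n)) \<longlonglongrightarrow> 0 \<and>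
       (\<integral>\<^sup>+x. ennreal ((f x - g x)\<^sup>2) \<partial>lborel) \<le> ennreal \<epsilon>"
  shows "(\<lambda>n::nat. shift_defect f (z n)) \<longlonglongrightarrow> 0"
proof (rule order_tendstoI)
  fix e :: ennreal assume "0 < e"
  then obtain d where d: "0 < d" "d < e" using dense by blast
  then obtain \<delta> where \<delta>: "d = ennreal \<delta>" "\<delta> > 0" by (cases d) auto
  \<comment> \<open>The fractions are chosen so that
    \<open>3 * (\<delta> / 6) + 6 * (\<delta> / 12) = \<delta>\<close> in the bound of
    \<open>shift_defect_le\<close>.\<close>
  obtain g where [measurable]: "g \<in> borel_measurable borel" and g: "(\<lambda>n. shift_defect g (z n)) \<longlonglongrightarrow> 0"
    "(\<integral>\<^sup>+x. ennreal ((f x - g x)\<^sup>2) \<partial>lborel) \<le> ennreal (\<delta> / 12)"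
    using approx[of "\<delta> / 12"] \<delta> by auto
  have "\<forall>\<^sub>F n in sequentially. shift_defect g (z n) < ennreal (\<delta> / 6)"
    using g(1) \<delta> by (intro order_tendstoD(2)[of _ 0]) auto
  then show "\<forall>\<^sub>F n in sequentially. shift_defect f (z n) < e"
  proof eventually_elim
    case (elim n)
    have "shift_defect f (z n) \<le> 3 * shift_defect g (z n) + 6 * (\<integral>\<^sup>+x. ennreal ((f x - g x)\<^sup>2) \<partial>lborel)"
      by (rule shift_defect_le) measurable
    also have "\<dots> \<le> 3 * ennreal (\<delta> / 6) + 6 * ennreal (\<delta> / 12)"
      using elim g(2) by (intro add_mono mult_left_mono) auto
    also have "\<dots> = ennreal \<delta>"
      using \<delta> by (simp flip: ennreal_plus ennreal_mult' ennreal_numeral)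
    finally show ?case using d \<delta> by simp
  qed
qed auto

text \<open>The defect is twice the measure of \<open>U\<close> minus twice the measure of the
  overlap of \<open>U\<close> with its translate. A point of \<open>U\<close> stays in
  \<open>U\<close> under small shifts, so the overlap converges to the full measure by dominated
  convergence.\<close>

lemma shift_defect_indicator_open:
  fixes U :: "'a::euclidean_space set"
  assumes U: "open U" and fin: "emeasure lborel U < \<infinity>" and z: "z \<longlonglongrightarrow> 0"
  shows "(\<lambda>n. shift_defect (indicator U) (z n)) \<longlonglongrightarrow> 0"
proof -
  have [measurable]: "U \<in> sets borel" using U by auto
  let ?i = "indicator U :: 'a \<Rightarrow> real"
  have i: "integrable lborel ?i" using fin by (intro integrable_real_indicator) auto
  have i2: "integrable lborel (\<lambda>x. ?i x * ?i (x + h))" for h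
    by (rule Bochner_Integration.integrable_bound[OF i]) (auto simp: indicator_def)
  have "(\<lambda>n. LBINT x. ?i x * ?i (x + z n)) \<longlonglongrightarrow> (LBINT x. ?i x)"
  proof (rule integral_dominated_convergence[OF _ _ i])
    show "AE x in lborel. (\<lambda>n. ?i x * ?i (x + z n)) \<longlonglongrightarrow> ?i x"
    proof (intro AE_I2)
      fix x
      show "(\<lambda>n. ?i x * ?i (x + z n)) \<longlonglongrightarrow> ?i x"
      proof (cases "x \<in> U")
        case True
        have "(\<lambda>n. x + z n) \<longlonglongrightarrow> x" using tendsto_add[OF tendsto_const z, of x] by simp
        then have "\<forall>\<^sub>F n in sequentially. x + z n \<in> U" using U True by (rule topological_tendstoD)
        then show ?thesis by (intro tendsto_eventually) (auto elim!: eventually_mono simp: True)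
      qed simp
    qed
  qed (auto simp: indicator_def)
  then have "(\<lambda>n. 2 * (LBINT x. ?i x) - 2 * (LBINT x. ?i x * ?i (x + z n))) \<longlonglongrightarrow>
     2 * (LBINT x. ?i x) - 2 * (LBINT x. ?i x)"
    by (intro tendsto_intros)
  moreover have "shift_defect ?i h = ennreal (2 * (LBINT x. ?i x) - 2 * (LBINT x. ?i x * ?i (x + h)))" for h
  proof -
    have eq: "(?i (x + h) - ?i x)\<^sup>2 = ?i (x + h) + ?i x - 2 * (?i x * ?i (x + h))" for x
      by (auto simp: indicator_def)
    have i3: "integrable lborel (\<lambda>x. ?i (x + h))" by (rule integrable_translate[OF i])
    have "shift_defect ?i h = ennreal (LBINT x. (?i (x + h) - ?i x)\<^sup>2)"
      unfolding shift_defect_def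
    proof (rule nn_integral_eq_integral)
      show "integrable lborel (\<lambda>x. (?i (x + h) - ?i x)\<^sup>2)"
        unfolding eq using i i2 i3 by simp
    qed simp
    also have "(LBINT x. (?i (x + h) - ?i x)\<^sup>2) = (LBINT x. ?i (x + h)) + (LBINT x. ?i x) - 2 * (LBINT x. ?i x * ?i (x + h))"
      unfolding eq using i i2 i3 by simp
    also have "(LBINT x. ?i (x + h)) = (LBINT x. ?i x)"
      by (rule integral_translate) auto
    finally show ?thesis by simp
  qed
  ultimately show ?thesis using tendsto_ennrealI by fastforce
qed

text \<open>Induction over nonnegative Borel functions, where outer regularity reduces a Borel set
  to an open one. Finiteness of the square integral is a premise of the induction, so each case has
  to hand it on to the constituents first.\<close>

lemma shift_defect_tendsto_nonneg:
  fixes f :: "'a::euclidean_space \<Rightarrow> real"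
  assumes z: "z \<longlonglongrightarrow> 0" and f: "f \<in> borel_measurable borel" "\<And>x. 0 \<le> f x"
    and fin: "(\<integral>\<^sup>+x. ennreal ((f x)\<^sup>2) \<partial>lborel) < \<infinity>"
  shows "(\<lambda>n. shift_defect f (z n)) \<longlonglongrightarrow> 0"
  using f fin
proof (induction rule: borel_measurable_induct_real)
  case (set A)
  have [measurable]: "A \<in> sets borel" using set by auto
  have A: "emeasure lborel A < \<infinity>"
  proof -
    have "ennreal ((indicator A x)\<^sup>2) = indicator A x" for x by (auto simp: indicator_def)
    then show ?thesis using set by simp
  qed
  show ?case
  proof (rule shift_defect_tendsto_approx)
    fix \<epsilon> :: real assume "\<epsilon> > 0"
    then obtain U where U: "open U" "A \<subseteq> U" "emeasure lborel (U - A) < ennreal \<epsilon>"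
      using outer_regular_lborel[of A \<epsilon>] set by auto
    have [measurable]: "U \<in> sets borel" using U by auto
    have "emeasure lborel U \<le> emeasure lborel A + emeasure lborel (U - A)"
      using U(2) by (subst emeasure_Un_Int[of A, simplified]) (auto simp: Un_absorb1 intro!: eq_refl arg_cong[where f="emeasure lborel"])
    also have "\<dots> < \<infinity>" using A U(3) by (auto simp: less_top[symmetric] top_unique)
    finally have "(\<lambda>n. shift_defect (indicator U) (z n)) \<longlonglongrightarrow> 0"
      by (intro shift_defect_indicator_open z U)
    moreover have "(\<integral>\<^sup>+x. ennreal ((indicator A x - indicator U x)\<^sup>2) \<partial>lborel) = (\<integral>\<^sup>+x. indicator (U - A) x \<partial>lborel)"
      using U(2) by (intro nn_integral_cong) (auto simp: indicator_def)
    ultimately show "\<exists>g. g \<in> borel_measurable borel \<and> (\<lambda>n. shift_defect g (z n)) \<longlonglongrightarrow> 0 \<and>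
       (\<integral>\<^sup>+x. ennreal ((indicator A x - g x)\<^sup>2) \<partial>lborel) \<le> ennreal \<epsilon>"
      using U(3) by (intro exI[of _ "indicator U"]) auto
  qed simp
next
  case (mult u c)
  note [measurable] = \<open>u \<in> borel_measurable borel\<close>
  show ?case
  proof (cases "c = 0")
    case True then show ?thesis by (simp add: shift_defect_def)
  next
    case False
    have eq: "shift_defect (\<lambda>x. c * u x) h = ennreal (c\<^sup>2) * shift_defect u h" for h
      unfolding shift_defect_def
      by (subst nn_integral_cmult[symmetric]) (auto simp: power_mult_distrib simp flip: right_diff_distrib ennreal_mult')
    have "(\<integral>\<^sup>+x. ennreal ((c * u x)\<^sup>2) \<partial>lborel) = ennreal (c\<^sup>2) * (\<integral>\<^sup>+x. ennreal ((u x)\<^sup>2) \<partial>lborel)"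
      by (subst nn_integral_cmult[symmetric]) (auto simp: power_mult_distrib ennreal_mult')
    then have "(\<integral>\<^sup>+x. ennreal ((u x)\<^sup>2) \<partial>lborel) < \<infinity>"
      using mult.prems False by (auto simp: ennreal_mult_less_top)
    then have "(\<lambda>n. ennreal (c\<^sup>2) * shift_defect u (z n)) \<longlonglongrightarrow> ennreal (c\<^sup>2) * 0"
      by (intro ennreal_tendsto_cmult mult.IH) auto
    then show ?thesis by (simp add: eq)
  qed
next
  case (add u v)
  note [measurable] = \<open>u \<in> borel_measurable borel\<close> \<open>v \<in> borel_measurable borel\<close>
  have "(\<integral>\<^sup>+x. ennreal ((u x)\<^sup>2) \<partial>lborel) \<le> (\<integral>\<^sup>+x. ennreal ((v x + u x)\<^sup>2) \<partial>lborel)"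
    "(\<integral>\<^sup>+x. ennreal ((v x)\<^sup>2) \<partial>lborel) \<le> (\<integral>\<^sup>+x. ennreal ((v x + u x)\<^sup>2) \<partial>lborel)"
    by (intro nn_integral_mono ennreal_leI power_mono; use add in simp)+
  then have lim: "(\<lambda>n. 2 * shift_defect v (z n) + 2 * shift_defect u (z n)) \<longlonglongrightarrow> 2 * 0 + 2 * 0"
    using add by (intro tendsto_add ennreal_tendsto_cmult) auto
  have le: "shift_defect (\<lambda>x. v x + u x) h \<le> 2 * shift_defect v h + 2 * shift_defect u h" for h
  proof -
    have "(v (x + h) + u (x + h) - (v x + u x))\<^sup>2 \<le> 2 * (v (x + h) - v x)\<^sup>2 + 2 * (u (x + h) - u x)\<^sup>2" for x
      using square_add_le[of "v (x + h) - v x" "u (x + h) - u x"] by (simp add: algebra_simps)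
    then have "shift_defect (\<lambda>x. v x + u x) h \<le> (\<integral>\<^sup>+x. 2 * ennreal ((v (x + h) - v x)\<^sup>2) + 2 * ennreal ((u (x + h) - u x)\<^sup>2) \<partial>lborel)"
      unfolding shift_defect_def
      by (intro nn_integral_mono) (simp flip: ennreal_plus ennreal_mult' ennreal_numeral add: ennreal_leI)
    also have "\<dots> = 2 * shift_defect v h + 2 * shift_defect u h"
      unfolding shift_defect_def by (simp add: nn_integral_add nn_integral_cmult)
    finally show ?thesis .
  qed
  show ?case by (rule tendsto_zero_ennreal_le[OF lim[simplified] le])
next
  case (seq U)
  note [measurable] = \<open>\<And>i. U i \<in> borel_measurable borel\<close>
  have fm [measurable]: "f \<in> borel_measurable borel" by fact
  have lim0: "(\<lambda>i. U i x) \<longlonglongrightarrow> f x" for x using seq.hyps by auto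
  have pos: "0 \<le> U i x" for i x by fact
  have le: "U i x \<le> f x" for i x
    using incseq_le[of "\<lambda>i. U i x" "f x" i] \<open>incseq U\<close> lim0[of x] by (auto simp: incseq_def le_fun_def)
  have Ufin: "(\<integral>\<^sup>+x. ennreal ((U i x)\<^sup>2) \<partial>lborel) < \<infinity>" for i
    using le pos by (intro le_less_trans[OF _ seq.prems] nn_integral_mono ennreal_leI power_mono) auto
  have if2: "integrable lborel (\<lambda>x. (f x)\<^sup>2)"
    using seq.prems by (intro integrableI_bounded) auto
  have dom: "(f x - U i x)\<^sup>2 \<le> (f x)\<^sup>2" for i x
    using le[of i x] pos[of i x] by (intro power_mono) auto
  have lim: "(\<lambda>i. LBINT x. (f x - U i x)\<^sup>2) \<longlonglongrightarrow> (\<integral>x. 0 \<partial>(lborel :: 'a measure))"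
  proof (rule integral_dominated_convergence[OF _ _ if2])
    show "AE x in lborel. (\<lambda>i. (f x - U i x)\<^sup>2) \<longlonglongrightarrow> 0"
    proof (intro AE_I2)
      fix x
      have "(\<lambda>i. (f x - U i x)\<^sup>2) \<longlonglongrightarrow> (f x - f x)\<^sup>2" by (intro tendsto_intros lim0)
      then show "(\<lambda>i. (f x - U i x)\<^sup>2) \<longlonglongrightarrow> 0" by simp
    qed
  qed (use dom in auto)
  show ?case
  proof (rule shift_defect_tendsto_approx[OF fm])
    fix \<epsilon> :: real assume "\<epsilon> > 0"
    then obtain i where i: "(LBINT x. (f x - U i x)\<^sup>2) < \<epsilon>"
      using order_tendstoD(2)[OF lim, of \<epsilon>] by (auto simp: eventually_sequentially)
    have "(\<integral>\<^sup>+x. ennreal ((f x - U i x)\<^sup>2) \<partial>lborel) = ennreal (LBINT x. (f x - U i x)\<^sup>2)"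
      by (rule nn_integral_eq_integral, rule Bochner_Integration.integrable_bound[OF if2]) (use dom in auto)
    then show "\<exists>g. g \<in> borel_measurable borel \<and> (\<lambda>n. shift_defect g (z n)) \<longlonglongrightarrow> 0 \<and>
       (\<integral>\<^sup>+x. ennreal ((f x - g x)\<^sup>2) \<partial>lborel) \<le> ennreal \<epsilon>"
      using i Ufin seq.IH by (intro exI[of _ "U i"]) (auto intro: ennreal_leI)
  qed
qed

text \<open>The quadratic form of the heat semigroup at time \<open>t\<close>, written in physical
  space, where rearrangements act. \<open>gauss_form_FT\<close> gives its Fourier side.\<close>

definition gauss_form :: "real \<Rightarrow> (plane \<Rightarrow> real) \<Rightarrow> real" where
  "gauss_form t f = (LBINT p. f (fst p) * f (snd p) * gaussian t (fst p - snd p))"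

lemma integrable_gauss_form:
  assumes f: "L2_bounded f" and g: "L2_bounded g" and t: "t > 0"
  shows "integrable lborel (\<lambda>p. f (fst p) * g (snd p) * gaussian t (fst p - snd p))"
proof -
  note [measurable] = f[THEN L2_bounded_measurable] g[THEN L2_bounded_measurable]
  have "integrable lborel (\<lambda>p. f (fst p) * g (snd p) * (1 / (4 * pi * t)))"
    using integrable_lborel_pair_mult[OF f[THEN L2_bounded_integrable] g[THEN L2_bounded_integrable]]
    by (rule integrable_mult_left)
  then show ?thesis
  proof (rule Bochner_Integration.integrable_bound)
    show "AE p in lborel. norm (f (fst p) * g (snd p) * gaussian t (fst p - snd p))
        \<le> norm (f (fst p) * g (snd p) * (1 / (4 * pi * t)))"
      unfolding norm_mult using gaussian_pos[OF t] gaussian_le[OF t] t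
      by (intro AE_I2 mult_left_mono) (auto simp: less_imp_le abs_of_pos)
  qed measurable
qed

lemma shift_defect_tendsto:
  fixes f :: "'a::euclidean_space \<Rightarrow> real"
  assumes z: "z \<longlonglongrightarrow> 0" and [measurable]: "f \<in> borel_measurable borel"
    and fin: "(\<integral>\<^sup>+x. ennreal ((f x)\<^sup>2) \<partial>lborel) < \<infinity>"
  shows "(\<lambda>n. shift_defect f (z n)) \<longlonglongrightarrow> 0"
proof -
  let ?p = "\<lambda>x. max 0 (f x)" and ?m = "\<lambda>x. max 0 (- f x)"
  have "(\<integral>\<^sup>+x. ennreal ((?p x)\<^sup>2) \<partial>lborel) \<le> (\<integral>\<^sup>+x. ennreal ((f x)\<^sup>2) \<partial>lborel)"
    "(\<integral>\<^sup>+x. ennreal ((?m x)\<^sup>2) \<partial>lborel) \<le> (\<integral>\<^sup>+x. ennreal ((f x)\<^sup>2) \<partial>lborel)"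
    by (intro nn_integral_mono ennreal_leI, simp add: max_def)+
  note le = this[THEN le_less_trans, OF fin]
  have "(\<lambda>n. shift_defect ?p (z n)) \<longlonglongrightarrow> 0" "(\<lambda>n. shift_defect ?m (z n)) \<longlonglongrightarrow> 0"
    by (rule shift_defect_tendsto_nonneg[OF z _ _ le(1)]; simp)
       (rule shift_defect_tendsto_nonneg[OF z _ _ le(2)]; simp)
  then have lim: "(\<lambda>n. 2 * shift_defect ?p (z n) + 2 * shift_defect ?m (z n)) \<longlonglongrightarrow> 2 * 0 + 2 * 0"
    by (intro tendsto_add ennreal_tendsto_cmult) auto
  have le: "shift_defect f h \<le> 2 * shift_defect ?p h + 2 * shift_defect ?m h" for h
  proof -
    have "(f (x + h) - f x)\<^sup>2 \<le> 2 * (?p (x + h) - ?p x)\<^sup>2 + 2 * (?m (x + h) - ?m x)\<^sup>2" for x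
    proof -
      have "f (x + h) - f x = (?p (x + h) - ?p x) + (?m x - ?m (x + h))" by (simp add: max_def)
      then show ?thesis
        using square_add_le[of "?p (x + h) - ?p x" "?m x - ?m (x + h)"]
        by (simp only: power2_commute[of "?m x" "?m (x + h)"])
    qed
    then have "shift_defect f h \<le> (\<integral>\<^sup>+x. 2 * ennreal ((?p (x + h) - ?p x)\<^sup>2) + 2 * ennreal ((?m (x + h) - ?m x)\<^sup>2) \<partial>lborel)"
      unfolding shift_defect_def
      by (intro nn_integral_mono) (simp flip: ennreal_plus ennreal_mult' ennreal_numeral add: ennreal_leI)
    also have "\<dots> = 2 * shift_defect ?p h + 2 * shift_defect ?m h"
      unfolding shift_defect_def by (simp add: nn_integral_add nn_integral_cmult)
    finally show ?thesis .
  qed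
  show ?thesis by (rule tendsto_zero_ennreal_le[OF lim[simplified] le])
qed

section \<open>Autocorrelation and the short-time limit of the Gaussian form\<close>

definition autocorr :: "(plane \<Rightarrow> real) \<Rightarrow> plane \<Rightarrow> real" where
  "autocorr f z = (LBINT x. f x * f (x + z))"

lemma L2_bounded_translate:
  assumes "L2_bounded f" shows "L2_bounded (\<lambda>x. f (x + c))"
proof -
  note [measurable] = L2_bounded_measurable[OF assms]
  obtain R where R: "\<And>x. norm x > R \<Longrightarrow> f x = 0" using assms by (auto simp: L2_bounded_def)
  have "f (x + c) = 0" if "norm x > R + norm c" for x
    using norm_triangle_ineq4[of "x + c" c] that by (intro R) auto
  then show ?thesis
    unfolding L2_bounded_def
    using integrable_translate[OF L2_bounded_square[OF assms], of c] by auto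
qed

lemma abs_mult_le: "\<bar>a * b\<bar> \<le> a\<^sup>2 + (b::real)\<^sup>2"
  using sum_squares_bound[of "\<bar>a\<bar>" "\<bar>b\<bar>"] mult_nonneg_nonneg[of "\<bar>a\<bar>" "\<bar>b\<bar>"]
  unfolding abs_mult power2_abs by linarith

lemma integrable_mult_L2:
  assumes f: "f \<in> borel_measurable M" "integrable M (\<lambda>x. (f x)\<^sup>2)"
    and g: "g \<in> borel_measurable M" "integrable M (\<lambda>x. (g x)\<^sup>2)"
  shows "integrable M (\<lambda>x. f x * g x :: real)"
proof (rule Bochner_Integration.integrable_bound)
  show "integrable M (\<lambda>x. (f x)\<^sup>2 + (g x)\<^sup>2)" using f g by auto
  show "AE x in M. norm (f x * g x) \<le> norm ((f x)\<^sup>2 + (g x)\<^sup>2)" by (auto simp: abs_mult_le)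
qed (use f g in measurable)

lemma L2_bounded_mult:
  assumes "L2_bounded f" "L2_bounded g" shows "integrable lborel (\<lambda>x. f x * g x)"
  using assms by (intro integrable_mult_L2) (auto simp: L2_bounded_def)

lemma shift_defect_autocorr:
  assumes f: "L2_bounded f"
  shows "shift_defect f z = ennreal (2 * (LBINT x. (f x)\<^sup>2) - 2 * autocorr f z)"
proof -
  note [measurable] = L2_bounded_measurable[OF f]
  note g = L2_bounded_translate[OF f, of z]
  have eq: "(f (x + z) - f x)\<^sup>2 = (f (x + z))\<^sup>2 + (f x)\<^sup>2 - 2 * (f x * f (x + z))" for x
    by (simp add: power2_eq_square algebra_simps)
  note i = L2_bounded_square[OF f] L2_bounded_square[OF g] L2_bounded_mult[OF f g]
  have "shift_defect f z = ennreal (LBINT x. (f (x + z) - f x)\<^sup>2)"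
    unfolding shift_defect_def
  proof (rule nn_integral_eq_integral)
    show "integrable lborel (\<lambda>x. (f (x + z) - f x)\<^sup>2)" unfolding eq using i by simp
  qed simp
  also have "(LBINT x. (f (x + z) - f x)\<^sup>2)
     = (LBINT x. (f (x + z))\<^sup>2) + (LBINT x. (f x)\<^sup>2) - 2 * autocorr f z"
    unfolding eq autocorr_def using i by simp
  also have "(LBINT x. (f (x + z))\<^sup>2) = (LBINT x. (f x)\<^sup>2)"
    by (rule integral_translate) measurable
  finally show ?thesis by simp
qed

lemma abs_autocorr_le:
  assumes f: "L2_bounded f" shows "\<bar>autocorr f z\<bar> \<le> (LBINT x. (f x)\<^sup>2)"
proof -
  note [measurable] = L2_bounded_measurable[OF f]
  note g = L2_bounded_translate[OF f, of z]
  note i = L2_bounded_square[OF f] L2_bounded_square[OF g] L2_bounded_mult[OF f g]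
  have e: "(LBINT x. (f (x + z))\<^sup>2) = (LBINT x. (f x)\<^sup>2)"
    by (rule integral_translate) measurable
  have "\<bar>autocorr f z\<bar> \<le> (LBINT x. \<bar>f x * f (x + z)\<bar>)"
    unfolding autocorr_def by (rule integral_abs_bound)
  also have "\<dots> \<le> (LBINT x. ((f x)\<^sup>2 + (f (x + z))\<^sup>2) / 2)"
  proof (rule integral_mono)
    fix x
    show "\<bar>f x * f (x + z)\<bar> \<le> ((f x)\<^sup>2 + (f (x + z))\<^sup>2) / 2"
      using sum_squares_bound[of "\<bar>f x\<bar>" "\<bar>f (x + z)\<bar>"] by (simp add: abs_mult)
  qed (use i in auto)
  also have "\<dots> = (LBINT x. (f x)\<^sup>2)" using i e by simp
  finally show ?thesis .
qed

text \<open>By \<open>shift_defect_autocorr\<close>, continuity of the autocorrelation at 0 is the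
  continuity of translations in the mean.\<close>

lemma autocorr_tendsto:
  assumes f: "L2_bounded f" and z: "z \<longlonglongrightarrow> 0"
  shows "(\<lambda>n. autocorr f (z n)) \<longlonglongrightarrow> (LBINT x. (f x)\<^sup>2)"
proof -
  let ?N = "LBINT x. (f x)\<^sup>2"
  have "(\<integral>\<^sup>+x. ennreal ((f x)\<^sup>2) \<partial>lborel) < \<infinity>"
    using L2_bounded_square[OF f] by (simp add: integrable_iff_bounded)
  then have "(\<lambda>n. ennreal (2 * ?N - 2 * autocorr f (z n))) \<longlonglongrightarrow> ennreal 0"
    using shift_defect_tendsto[OF z L2_bounded_measurable[OF f]] by (simp add: shift_defect_autocorr[OF f])
  moreover have "0 \<le> 2 * ?N - 2 * autocorr f (z n)" for n
    using abs_autocorr_le[OF f, of "z n"] by simp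
  ultimately have "(\<lambda>n. 2 * ?N - 2 * autocorr f (z n)) \<longlonglongrightarrow> 0"
    by (subst (asm) tendsto_ennreal_iff) auto
  then have "(\<lambda>n. ?N - (2 * ?N - 2 * autocorr f (z n)) / 2) \<longlonglongrightarrow> ?N - 0 / 2"
    by (intro tendsto_intros) auto
  then show ?thesis by (simp add: field_simps)
qed

lemma measurable_autocorr [measurable]:
  assumes [measurable]: "f \<in> borel_measurable borel" shows "autocorr f \<in> borel_measurable borel"
  unfolding autocorr_def by measurable

text \<open>Substituting \<open>y = x + z\<close> leaves a kernel in \<open>z\<close> alone. The
  limit of small times then concerns only the autocorrelation near 0.\<close>

lemma gauss_form_autocorr:
  assumes f: "L2_bounded f" and t: "t > 0"
  shows "gauss_form t f = (LBINT z. gaussian t z * autocorr f z)"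
proof -
  note [measurable] = L2_bounded_measurable[OF f]
  let ?N = "LBINT x. (f x)\<^sup>2"
  let ?h = "\<lambda>p. f (fst p) * f (fst p + snd p) * gaussian t (snd p)"
  have int: "integrable lborel ?h"
  proof (rule integrable_prodI)
    have fin: "(\<integral>\<^sup>+x. ennreal ((f x)\<^sup>2) \<partial>lborel) < \<infinity>"
      using L2_bounded_square[OF f] by (simp add: integrable_iff_bounded)
    \<comment> \<open>The product of the two values is bounded by the sum of their squares, whose
      integral over \<open>x\<close> is independent of \<open>z\<close>; the Gaussian has mass 1 in
      \<open>z\<close>.\<close>
    have "(\<integral>\<^sup>+x. \<integral>\<^sup>+z. ennreal (norm (?h (x, z))) \<partial>lborel \<partial>lborel)
       \<le> (\<integral>\<^sup>+x. \<integral>\<^sup>+z. (ennreal ((f x)\<^sup>2) + ennreal ((f (x + z))\<^sup>2)) * ennreal (gaussian t z) \<partial>lborel \<partial>lborel)"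
    proof (intro nn_integral_mono)
      fix x z
      have "\<bar>f x\<bar> * \<bar>f (x + z)\<bar> \<le> (f x)\<^sup>2 + (f (x + z))\<^sup>2"
        using abs_mult_le[of "f x" "f (x + z)"] by (simp add: abs_mult)
      then show "ennreal (norm (?h (x, z))) \<le> (ennreal ((f x)\<^sup>2) + ennreal ((f (x + z))\<^sup>2)) * ennreal (gaussian t z)"
        using gaussian_pos[OF t, of z]
        by (auto simp: abs_mult simp flip: ennreal_plus ennreal_mult intro!: ennreal_leI mult_right_mono)
    qed
    also have "\<dots> = (\<integral>\<^sup>+z. \<integral>\<^sup>+x. (ennreal ((f x)\<^sup>2) + ennreal ((f (x + z))\<^sup>2)) * ennreal (gaussian t z) \<partial>lborel \<partial>lborel)"
      by (rule lborel_pair.Fubini') measurable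
    also have "\<dots> = (\<integral>\<^sup>+z. ((\<integral>\<^sup>+x. ennreal ((f x)\<^sup>2) \<partial>lborel) + (\<integral>\<^sup>+x. ennreal ((f x)\<^sup>2) \<partial>lborel)) * ennreal (gaussian t z) \<partial>lborel)"
      by (simp add: nn_integral_multc nn_integral_add nn_integral_translate[of "\<lambda>x. ennreal ((f x)\<^sup>2)"])
    also have "\<dots> = (\<integral>\<^sup>+x. ennreal ((f x)\<^sup>2) \<partial>lborel) + (\<integral>\<^sup>+x. ennreal ((f x)\<^sup>2) \<partial>lborel)"
      by (simp add: nn_integral_cmult nn_integral_gaussian[OF t])
    also have "\<dots> < \<infinity>" using fin by simp
    finally show "(\<integral>\<^sup>+x. \<integral>\<^sup>+z. ennreal (norm (?h (x, z))) \<partial>lborel \<partial>lborel) < \<infinity>" .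
  qed measurable
  have "gauss_form t f = (LBINT x. LBINT y. f x * f y * gaussian t (x - y))"
    unfolding gauss_form_def using integral_lborel_pair(1)[OF integrable_gauss_form[OF f f t]] by simp
  also have "\<dots> = (LBINT x. LBINT z. f x * f (x + z) * gaussian t z)"
  proof (rule Bochner_Integration.integral_cong[OF refl])
    fix x
    show "(LBINT y. f x * f y * gaussian t (x - y)) = (LBINT z. f x * f (x + z) * gaussian t z)"
      using integral_translate[of "\<lambda>y. f x * f y * gaussian t (x - y)" x] by (simp add: add.commute)
  qed
  also have "\<dots> = (LBINT p. ?h p)" using integral_lborel_pair(1)[OF int] by simp
  also have "\<dots> = (LBINT z. LBINT x. f x * f (x + z) * gaussian t z)"
    using integral_lborel_pair(2)[OF int] by simp
  finally show ?thesis by (simp add: autocorr_def mult.commute)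
qed

lemma gaussian_scale:
  assumes "t > 0" shows "gaussian t (sqrt t *\<^sub>R y) = gaussian 1 y / t"
  using assms by (simp add: gaussian_def power_mult_distrib)

lemma integral_plane_scale:
  fixes f :: "plane \<Rightarrow> 'a::{banach, second_countable_topology}"
  assumes [measurable]: "f \<in> borel_measurable borel" and c: "c > 0"
  shows "(LBINT x. f x) = c\<^sup>2 *\<^sub>R (LBINT x. f (c *\<^sub>R x))"
proof -
  have "(LBINT x. f x) = (\<integral>x. f x \<partial>density (distr lborel borel (\<lambda>x. 0 + c *\<^sub>R x)) (\<lambda>_. ennreal (\<bar>c\<bar> ^ DIM(plane))))"
    by (subst lborel_affine[of c 0]) (use c in auto)
  also have "\<dots> = c\<^sup>2 *\<^sub>R (LBINT x. f (c *\<^sub>R x))"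
    by (subst integral_density) (auto simp: integral_distr)
  finally show ?thesis .
qed

text \<open>Scaling \<open>z\<close> by the square root of the time freezes the Gaussian weight and
  moves the time into the argument of the autocorrelation, so dominated convergence applies with the
  bound of \<open>abs_autocorr_le\<close>.\<close>

lemma gauss_form_tendsto:
  assumes f: "L2_bounded f"
  shows "(\<lambda>n. gauss_form (1 / real (Suc n)) f) \<longlonglongrightarrow> (LBINT x. (f x)\<^sup>2)"
proof -
  note [measurable] = L2_bounded_measurable[OF f]
  let ?N = "LBINT x. (f x)\<^sup>2"
  let ?s = "\<lambda>n. sqrt (1 / real (Suc n))"
  have "gauss_form (1 / real (Suc n)) f = (LBINT y. gaussian 1 y * autocorr f (?s n *\<^sub>R y))" for n
  proof -
    define t where "t = 1 / real (Suc n)"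
    have t: "t > 0" by (simp add: t_def)
    have "gauss_form t f = (sqrt t)\<^sup>2 *\<^sub>R (LBINT y. gaussian t (sqrt t *\<^sub>R y) * autocorr f (sqrt t *\<^sub>R y))"
      unfolding gauss_form_autocorr[OF f t] using t by (intro integral_plane_scale) auto
    also have "\<dots> = (LBINT y. gaussian 1 y * autocorr f (sqrt t *\<^sub>R y))"
      using t by (simp add: gaussian_scale)
    finally show ?thesis by (simp add: t_def)
  qed
  moreover have "(\<lambda>n. LBINT y. gaussian 1 y * autocorr f (?s n *\<^sub>R y)) \<longlonglongrightarrow> (LBINT y. gaussian 1 y * ?N)"
  proof (rule integral_dominated_convergence[where w="\<lambda>y. gaussian 1 y * ?N"])
    show "integrable lborel (\<lambda>y. gaussian 1 y * ?N)" by (intro integrable_mult_left integrable_gaussian) simp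
    show "AE y in lborel. (\<lambda>n. gaussian 1 y * autocorr f (?s n *\<^sub>R y)) \<longlonglongrightarrow> gaussian 1 y * ?N"
    proof (intro AE_I2 tendsto_intros autocorr_tendsto f)
      fix y :: plane
      have "(\<lambda>n. ?s n *\<^sub>R y) \<longlonglongrightarrow> sqrt 0 *\<^sub>R y"
        by (intro tendsto_intros LIMSEQ_Suc lim_const_over_n)
      then show "(\<lambda>n. ?s n *\<^sub>R y) \<longlonglongrightarrow> 0" by simp
    qed
    show "AE y in lborel. norm (gaussian 1 y * autocorr f (?s n *\<^sub>R y)) \<le> gaussian 1 y * ?N" for n
      using abs_autocorr_le[OF f] gaussian_pos[of 1] by (auto simp: abs_mult abs_of_pos intro!: mult_left_mono AE_I2 less_imp_le)
  qed measurable
  ultimately show ?thesis by (simp add: integral_gaussian)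
qed

section \<open>Plancherel's theorem\<close>

text \<open>On \<open>L2_bounded\<close> functions this plain integral represents the Plancherel
  transform, see \<open>has_plancherel_transform_FT\<close>.\<close>

definition FT :: "(plane \<Rightarrow> real) \<Rightarrow> plane \<Rightarrow> complex" where
  "FT f = fourier_integral (\<lambda>x. complex_of_real (f x))"

lemma measurable_fourier_kernel [measurable]:
  assumes [measurable]: "f \<in> borel_measurable M" "g \<in> borel_measurable M"
  shows "(\<lambda>p. exp (- \<i> * complex_of_real ((f p :: plane) \<bullet> g p))) \<in> borel_measurable M"
  by measurable

lemma FT_lborel:
  assumes [measurable]: "f \<in> borel_measurable borel"
  shows "FT f \<xi> = complex_of_real (1 / (2 * pi)) *
    (LBINT x. exp (- \<i> * complex_of_real (x \<bullet> \<xi>)) * complex_of_real (f x))"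
  unfolding FT_def fourier_integral_def by (subst integral_completion) auto

lemma integrable_fourier_kernel:
  assumes "integrable lborel f"
  shows "integrable lborel (\<lambda>x::plane. exp (- \<i> * complex_of_real (x \<bullet> \<xi>)) * complex_of_real (f x))"
proof -
  have [measurable]: "f \<in> borel_measurable borel" using assms by auto
  show ?thesis by (rule Bochner_Integration.integrable_bound[OF assms]) (auto simp: norm_mult)
qed

lemma measurable_FT [measurable]:
  assumes [measurable]: "f \<in> borel_measurable borel" shows "FT f \<in> borel_measurable borel"
proof -
  have "FT f = (\<lambda>\<xi>. complex_of_real (1 / (2 * pi)) *
    (LBINT x. exp (- \<i> * complex_of_real (x \<bullet> \<xi>)) * complex_of_real (f x)))"
    by (simp add: fun_eq_iff FT_lborel)
  also have "\<dots> \<in> borel_measurable borel" by measurable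
  finally show ?thesis .
qed

lemma norm_FT_le:
  assumes "integrable lborel f"
  shows "norm (FT f \<xi>) \<le> (LBINT x. \<bar>f x\<bar>) / (2 * pi)"
proof -
  have [measurable]: "f \<in> borel_measurable borel" using assms by auto
  have "norm (LBINT x. exp (- \<i> * complex_of_real (x \<bullet> \<xi>)) * complex_of_real (f x))
      \<le> (LBINT x. norm (exp (- \<i> * complex_of_real (x \<bullet> \<xi>)) * complex_of_real (f x)))"
    by (rule integral_norm_bound)
  also have "\<dots> = (LBINT x. \<bar>f x\<bar>)" by (simp add: norm_mult)
  finally show ?thesis by (simp add: FT_lborel norm_mult norm_divide divide_right_mono)
qed

lemma FT_add:
  assumes f: "integrable lborel f" and g: "integrable lborel g"
  shows "FT (\<lambda>x. f x + g x) \<xi> = FT f \<xi> + FT g \<xi>"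
proof -
  have [measurable]: "f \<in> borel_measurable borel" "g \<in> borel_measurable borel" using f g by auto
  show ?thesis
    using integrable_fourier_kernel[OF f, of \<xi>] integrable_fourier_kernel[OF g, of \<xi>]
    by (simp add: FT_lborel distrib_left)
qed

lemma FT_cmult:
  assumes f: "integrable lborel f"
  shows "FT (\<lambda>x. c * f x) \<xi> = complex_of_real c * FT f \<xi>"
proof -
  have [measurable]: "f \<in> borel_measurable borel" using f by auto
  show ?thesis by (simp add: FT_lborel mult.left_commute[of _ "complex_of_real c"])
qed

lemma FT_diff:
  assumes f: "integrable lborel f" and g: "integrable lborel g"
  shows "FT (\<lambda>x. f x - g x) \<xi> = FT f \<xi> - FT g \<xi>"
  using FT_add[OF f integrable_mult_right[OF g, of "-1"]] FT_cmult[OF g, of "-1"] by simp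

text \<open>The transform times its conjugate, written as one integral over pairs, so that in
  \<open>gauss_form_FT\<close> the frequency can be integrated out first.\<close>

lemma norm_FT_square:
  assumes f: "integrable lborel f"
  shows "complex_of_real ((norm (FT f \<xi>))\<^sup>2) = complex_of_real (1 / (4 * pi\<^sup>2)) *
    (LBINT p. exp (- \<i> * complex_of_real ((fst p - snd p) \<bullet> \<xi>)) * complex_of_real (f (fst p) * f (snd p)))"
proof -
  have [measurable]: "f \<in> borel_measurable borel" using f by auto
  let ?k = "\<lambda>x. exp (- \<i> * complex_of_real (x \<bullet> \<xi>))"
  let ?F = "LBINT x. ?k x * complex_of_real (f x)"
  let ?h = "\<lambda>p. ?k (fst p - snd p) * complex_of_real (f (fst p) * f (snd p))"
  have i: "integrable lborel ?h"
    by (rule Bochner_Integration.integrable_bound[OF integrable_lborel_pair_mult[OF f f]]) (auto simp: norm_mult)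
  have k: "?k (x - y) = ?k x * cnj (?k y)" for x y
    by (simp add: exp_cnj inner_diff_left right_diff_distrib flip: exp_add)
  have "(LBINT p. ?h p) = (LBINT x. LBINT y. (?k x * complex_of_real (f x)) * cnj (?k y * complex_of_real (f y)))"
    unfolding integral_lborel_pair(1)[OF i] by (simp only: k fst_conv snd_conv of_real_mult complex_cnj_mult complex_cnj_complex_of_real mult_ac)
  also have "\<dots> = ?F * cnj ?F"
    by (simp only: integral_mult_right_zero integral_mult_left_zero Bochner_Integration.integral_cnj)
  finally have eq: "(LBINT p. ?h p) = ?F * cnj ?F" .
  have "FT f \<xi> * cnj (FT f \<xi>) = complex_of_real (1 / (4 * pi\<^sup>2)) * (?F * cnj ?F)"
    by (simp add: FT_lborel power2_eq_square)
  then show ?thesis by (simp only: complex_norm_square eq)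
qed

text \<open>By Fubini the frequency integral of the Gaussian against the character at
  \<open>x - y\<close> is the heat kernel times \<open>4 * pi\<^sup>2\<close>, and this factor
  cancels the squared normalization of the transform.\<close>

lemma gauss_form_FT:
  assumes f: "L2_bounded f" and t: "t > 0"
  shows "integrable lborel (\<lambda>\<xi>. exp (- t * (norm \<xi>)\<^sup>2) * (norm (FT f \<xi>))\<^sup>2)"
    and "(LBINT \<xi>. exp (- t * (norm \<xi>)\<^sup>2) * (norm (FT f \<xi>))\<^sup>2) = gauss_form t f"
proof -
  note [measurable] = L2_bounded_measurable[OF f]
  note fi = L2_bounded_integrable[OF f]
  let ?g = "\<lambda>\<xi>::plane. exp (- t * (norm \<xi>)\<^sup>2)"
  let ?B = "(LBINT x. \<bar>f x\<bar>) / (2 * pi)"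
  note gi = fourier_gaussian(1)[OF t]
  show "integrable lborel (\<lambda>\<xi>. ?g \<xi> * (norm (FT f \<xi>))\<^sup>2)"
  proof (rule Bochner_Integration.integrable_bound)
    show "integrable lborel (\<lambda>\<xi>. ?g \<xi> * ?B\<^sup>2)" using gi by (rule integrable_mult_left)
    show "AE \<xi> in lborel. norm (?g \<xi> * (norm (FT f \<xi>))\<^sup>2) \<le> norm (?g \<xi> * ?B\<^sup>2)"
      using norm_FT_le[OF fi] by (auto simp: abs_mult intro!: AE_I2 mult_left_mono power_mono)
  qed measurable
  let ?k = "\<lambda>z \<xi>. exp (- \<i> * complex_of_real (z \<bullet> \<xi>))"
  let ?h = "\<lambda>q::plane \<times> (plane \<times> plane). (?k (fst (snd q) - snd (snd q)) (fst q) * complex_of_real (?g (fst q)))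
     * complex_of_real (f (fst (snd q)) * f (snd (snd q)))"
  have i: "integrable lborel ?h"
    by (rule Bochner_Integration.integrable_bound[OF integrable_lborel_pair_mult[OF gi integrable_lborel_pair_mult[OF fi fi]]])
       (auto simp: norm_mult)
  have "complex_of_real (LBINT \<xi>. ?g \<xi> * (norm (FT f \<xi>))\<^sup>2)
     = (LBINT \<xi>. complex_of_real (?g \<xi>) * complex_of_real ((norm (FT f \<xi>))\<^sup>2))"
    by (simp only: integral_complex_of_real[symmetric] of_real_mult)
  also have "\<dots> = complex_of_real (1 / (4 * pi\<^sup>2)) * (LBINT \<xi>. LBINT p. ?h (\<xi>, p))"
    unfolding norm_FT_square[OF fi] fst_conv snd_conv
    by (simp only: integral_mult_right_zero[symmetric] mult_ac)
  also have "(LBINT \<xi>. LBINT p. ?h (\<xi>, p)) = (LBINT p. LBINT \<xi>. ?h (\<xi>, p))"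
    using integral_lborel_pair(1)[OF i] integral_lborel_pair(2)[OF i] by metis
  also have "\<dots> = (LBINT p. complex_of_real (4 * pi\<^sup>2 * gaussian t (fst p - snd p)) * complex_of_real (f (fst p) * f (snd p)))"
    by (simp only: fst_conv snd_conv integral_mult_left_zero fourier_gaussian(2)[OF t])
  also have "\<dots> = complex_of_real (4 * pi\<^sup>2) * complex_of_real (gauss_form t f)"
    unfolding gauss_form_def integral_complex_of_real[symmetric] integral_mult_right_zero[symmetric]
    by (simp add: mult_ac)
  finally have "complex_of_real (LBINT \<xi>. ?g \<xi> * (norm (FT f \<xi>))\<^sup>2) = complex_of_real (gauss_form t f)"
    by simp
  then show "(LBINT \<xi>. ?g \<xi> * (norm (FT f \<xi>))\<^sup>2) = gauss_form t f" by (simp only: of_real_eq_iff)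
qed

text \<open>As the time decreases to 0, the Gaussian weight increases to 1 on the Fourier side,
  while the physical side converges by \<open>gauss_form_tendsto\<close>. Monotone convergence gives
  integrability and the identity together.\<close>

lemma
  assumes f: "L2_bounded f"
  shows plancherel_integrable: "integrable lborel (\<lambda>\<xi>. (norm (FT f \<xi>))\<^sup>2)"
    and plancherel_identity: "(LBINT \<xi>. (norm (FT f \<xi>))\<^sup>2) = (LBINT x. (f x)\<^sup>2)"
proof -
  note [measurable] = L2_bounded_measurable[OF f]
  let ?t = "\<lambda>n. 1 / real (Suc n)"
  let ?u = "\<lambda>n \<xi>. exp (- ?t n * (norm \<xi>)\<^sup>2) * (norm (FT f \<xi>))\<^sup>2"
  have 1: "\<And>n. integrable lborel (?u n)" by (rule gauss_form_FT(1)[OF f]) simp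
  have 2: "AE \<xi> in lborel. mono (\<lambda>n. ?u n \<xi>)"
  proof (intro AE_I2 monoI mult_right_mono)
    fix m n :: nat and \<xi> :: plane assume "m \<le> n"
    then have "?t n * (norm \<xi>)\<^sup>2 \<le> ?t m * (norm \<xi>)\<^sup>2" by (intro mult_right_mono divide_left_mono) auto
    then show "exp (- ?t m * (norm \<xi>)\<^sup>2) \<le> exp (- ?t n * (norm \<xi>)\<^sup>2)" by simp
  qed simp
  have 3: "AE \<xi> in lborel. (\<lambda>n. ?u n \<xi>) \<longlonglongrightarrow> (norm (FT f \<xi>))\<^sup>2"
  proof (intro AE_I2)
    fix \<xi> :: plane
    have "(\<lambda>n. ?u n \<xi>) \<longlonglongrightarrow> exp (- 0 * (norm \<xi>)\<^sup>2) * (norm (FT f \<xi>))\<^sup>2"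
      by (intro tendsto_intros LIMSEQ_Suc lim_const_over_n)
    then show "(\<lambda>n. ?u n \<xi>) \<longlonglongrightarrow> (norm (FT f \<xi>))\<^sup>2" by simp
  qed
  have 4: "(\<lambda>n. integral\<^sup>L lborel (?u n)) \<longlonglongrightarrow> (LBINT x. (f x)\<^sup>2)"
    using gauss_form_tendsto[OF f] by (subst gauss_form_FT(2)[OF f]) auto
  have 5: "(\<lambda>\<xi>. (norm (FT f \<xi>))\<^sup>2) \<in> borel_measurable lborel" by measurable
  show "integrable lborel (\<lambda>\<xi>. (norm (FT f \<xi>))\<^sup>2)" by (rule integrable_monotone_convergence[OF 1 2 3 4 5])
  show "(LBINT \<xi>. (norm (FT f \<xi>))\<^sup>2) = (LBINT x. (f x)\<^sup>2)"
    by (rule integral_monotone_convergence[OF 1 2 3 4 5])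
qed

lemma FT_AE_zero:
  assumes f: "L2_bounded f" and z: "AE \<xi> in lborel. FT f \<xi> = 0"
  shows "AE x in lborel. f x = 0"
proof -
  have "(LBINT \<xi>. (norm (FT f \<xi>))\<^sup>2) = 0"
    by (rule integral_eq_zero_AE) (use z in auto)
  then have "(LBINT x. (f x)\<^sup>2) = 0" using plancherel_identity[OF f] by simp
  then have "AE x in lborel. (f x)\<^sup>2 = 0"
    using integral_nonneg_eq_0_iff_AE[OF L2_bounded_square[OF f]] by simp
  then show ?thesis by simp
qed

text \<open>Once the ball contains the support, truncation changes nothing; the limit over
  \<open>R\<close> is then the limit of a constant, which is 0 exactly if \<open>g\<close> and
  \<open>FT f\<close> agree almost everywhere.\<close>

lemma has_plancherel_transform_FT:
  assumes f: "L2_bounded f"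
  shows "has_plancherel_transform (\<lambda>x. complex_of_real (f x)) g \<longleftrightarrow>
    g \<in> borel_measurable lebesgue \<and> (AE \<xi> in lborel. g \<xi> = FT f \<xi>)"
    (is "_ \<longleftrightarrow> ?R")
proof -
  note [measurable] = L2_bounded_measurable[OF f]
  obtain R where R: "\<And>x. norm x > R \<Longrightarrow> f x = 0" using f by (auto simp: L2_bounded_def)
  have FTm: "FT f \<in> borel_measurable lebesgue" using measurable_FT[of f] by (simp add: measurable_completion)
  let ?D = "\<integral>\<^sup>+ \<xi>. ennreal ((norm (FT f \<xi> - g \<xi>))\<^sup>2) \<partial>lebesgue"
  let ?L = "\<lambda>R. \<integral>\<^sup>+ \<xi>. ennreal ((norm (fourier_integral (\<lambda>x. if norm x \<le> R then complex_of_real (f x) else 0) \<xi> - g \<xi>))\<^sup>2) \<partial>lebesgue"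
  have "?L S = ?D" if "S \<ge> R" for S
  proof -
    have "(\<lambda>x. if norm x \<le> S then complex_of_real (f x) else 0) = (\<lambda>x. complex_of_real (f x))"
      using that R by (auto simp: fun_eq_iff)
    then show ?thesis by (simp add: FT_def)
  qed
  then have "(?L \<longlongrightarrow> 0) at_top \<longleftrightarrow> ((\<lambda>_::real. ?D) \<longlongrightarrow> 0) at_top"
    by (intro tendsto_cong) (auto simp: eventually_at_top_linorder intro!: exI[of _ R])
  also have "\<dots> \<longleftrightarrow> ?D = 0" by (auto simp: tendsto_const_iff)
  finally have lim: "(?L \<longlongrightarrow> 0) at_top \<longleftrightarrow> ?D = 0" .
  have D: "?D = 0 \<longleftrightarrow> (AE \<xi> in lborel. g \<xi> = FT f \<xi>)" if [measurable]: "g \<in> borel_measurable lebesgue"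
  proof -
    note [measurable] = FTm
    have "?D = 0 \<longleftrightarrow> (AE \<xi> in lebesgue. ennreal ((norm (FT f \<xi> - g \<xi>))\<^sup>2) = 0)"
      by (rule nn_integral_0_iff_AE) measurable
    also have "\<dots> \<longleftrightarrow> (AE \<xi> in lborel. g \<xi> = FT f \<xi>)"
    proof -
      have "ennreal ((norm (FT f \<xi> - g \<xi>))\<^sup>2) = 0 \<longleftrightarrow> g \<xi> = FT f \<xi>" for \<xi> by auto
      then show ?thesis by (simp only: AE_completion_iff)
    qed
    finally show ?thesis .
  qed
  show ?thesis
  proof
    assume "has_plancherel_transform (\<lambda>x. complex_of_real (f x)) g"
    then show ?R using lim D by (auto simp: has_plancherel_transform_def square_integrable_def)
  next
    assume R: ?R
    then have "(\<integral>\<^sup>+ \<xi>. ennreal ((norm (g \<xi>))\<^sup>2) \<partial>lebesgue) = (\<integral>\<^sup>+ \<xi>. ennreal ((norm (FT f \<xi>))\<^sup>2) \<partial>lborel)"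
      unfolding nn_integral_completion by (intro nn_integral_cong_AE) auto
    also have "\<dots> < \<infinity>" using plancherel_integrable[OF f] by (simp add: integrable_iff_bounded)
    finally show "has_plancherel_transform (\<lambda>x. complex_of_real (f x)) g"
      using R lim D by (auto simp: has_plancherel_transform_def square_integrable_def)
  qed
qed

text \<open>\<open>plancherel v\<close> is an arbitrary choice among transforms that differ on null
  sets, so the comparison with the concrete integral can only hold almost everywhere.\<close>

lemma plancherel_AE:
  assumes f: "L2_bounded f" and vm: "v \<in> borel_measurable lebesgue" and v: "AE x in lborel. v x = f x"
  shows "plancherel v \<in> borel_measurable lebesgue" "AE \<xi> in lborel. plancherel v \<xi> = FT f \<xi>"
proof -
  note [measurable] = L2_bounded_measurable[OF f]
  have fm: "f \<in> borel_measurable lebesgue" using L2_bounded_measurable[OF f] by (simp add: measurable_completion)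
  have vf: "AE x in lebesgue. v x = f x" using v by (simp add: AE_completion_iff)
  have "fourier_integral (\<lambda>x. if norm x \<le> R then complex_of_real (v x) else 0)
     = fourier_integral (\<lambda>x. if norm x \<le> R then complex_of_real (f x) else 0)" for R
  proof (rule ext)
    fix \<xi>
    have meas: "(\<lambda>x. exp (- \<i> * complex_of_real (x \<bullet> \<xi>)) * (if norm x \<le> R then complex_of_real (h x) else 0)) \<in> borel_measurable lebesgue"
      if "h \<in> borel_measurable lebesgue" for h :: "plane \<Rightarrow> real"
    proof (rule borel_measurable_times)
      show "(\<lambda>x. exp (- \<i> * complex_of_real (x \<bullet> \<xi>))) \<in> borel_measurable lebesgue"
        by (rule measurable_completion) simp
      show "(\<lambda>x. if norm x \<le> R then complex_of_real (h x) else 0) \<in> borel_measurable lebesgue"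
        using measurable_compose[OF that borel_measurable_of_real] by (intro measurable_If) auto
    qed
    have "(\<integral>x. exp (- \<i> * complex_of_real (x \<bullet> \<xi>)) * (if norm x \<le> R then complex_of_real (v x) else 0) \<partial>lebesgue)
       = (\<integral>x. exp (- \<i> * complex_of_real (x \<bullet> \<xi>)) * (if norm x \<le> R then complex_of_real (f x) else 0) \<partial>lebesgue)"
      by (rule integral_cong_AE[OF meas[OF vm] meas[OF fm]]) (use vf in auto)
    then show "fourier_integral (\<lambda>x. if norm x \<le> R then complex_of_real (v x) else 0) \<xi>
       = fourier_integral (\<lambda>x. if norm x \<le> R then complex_of_real (f x) else 0) \<xi>"
      by (simp only: fourier_integral_def)
  qed
  \<comment> \<open>Truncated Fourier integrals do not see null sets, so both choices are made from
    the same predicate and coincide exactly.\<close>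
  then have "plancherel v = plancherel f" by (simp add: plancherel_def has_plancherel_transform_def)
  moreover have "has_plancherel_transform (\<lambda>x. complex_of_real (f x)) (FT f)"
    using measurable_FT[of f] by (simp add: has_plancherel_transform_FT[OF f] measurable_completion)
  then have "has_plancherel_transform (\<lambda>x. complex_of_real (f x)) (plancherel f)"
    unfolding plancherel_def by (rule someI[of "has_plancherel_transform (\<lambda>x. complex_of_real (f x))"])
  ultimately show "plancherel v \<in> borel_measurable lebesgue" "AE \<xi> in lborel. plancherel v \<xi> = FT f \<xi>"
    by (simp_all add: has_plancherel_transform_FT[OF f])
qed

section \<open>The half Laplacian energy by subordination\<close>

text \<open>This density serves twice: it dominates the subordination integrand, and it is the
  angular density of the slope coordinates for the plane.\<close>

lemma
  shows cauchy_density_integral: "integrable lborel (\<lambda>s::real. 1 / (1 + s\<^sup>2))"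
    "(LBINT s. 1 / (1 + s\<^sup>2)) = pi"
proof -
  have D: "DERIV arctan x :> 1 / (1 + x\<^sup>2)" for x :: real
    using DERIV_arctan[of x] by (simp add: inverse_eq_divide)
  have C: "isCont (\<lambda>s::real. 1 / (1 + s\<^sup>2)) x" for x
    by (intro continuous_intros) (metis add_pos_nonneg less_irrefl zero_le_power2 zero_less_one)
  have "((arctan \<circ> real_of_ereal) \<longlongrightarrow> - (pi / 2)) (at_right (-\<infinity>))"
    "((arctan \<circ> real_of_ereal) \<longlongrightarrow> pi / 2) (at_left \<infinity>)"
    by (simp_all add: ereal_tendsto_simps tendsto_arctan_at_bot tendsto_arctan_at_top)
  note L = this
  have "set_integrable lborel (einterval (-\<infinity>) \<infinity>) (\<lambda>s::real. 1 / (1 + s\<^sup>2))"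
    "(LBINT s=-\<infinity>..\<infinity>. 1 / (1 + s\<^sup>2)) = pi / 2 - - (pi / 2)"
    by (rule interval_integral_FTC_nonneg[OF _ D C _ L]; simp)+
  then show "integrable lborel (\<lambda>s::real. 1 / (1 + s\<^sup>2))" "(LBINT s. 1 / (1 + s\<^sup>2)) = pi"
    by (simp_all add: set_integrable_def interval_lebesgue_integral_def set_lebesgue_integral_def einterval_def)
qed

lemma not_AE_lborel_False: "\<not> (AE x in (lborel :: 'a::euclidean_space measure). False)"
proof
  assume "AE x in (lborel :: 'a measure). False"
  then have "emeasure lborel (UNIV :: 'a set) = 0"
    by (subst (asm) AE_iff_measurable[of UNIV]) auto
  then show False by (simp add: emeasure_lborel_UNIV)
qed

lemma AE_lborel_ex:
  assumes "AE x in (lborel :: 'a::euclidean_space measure). P x" shows "\<exists>x. P x"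
proof (rule ccontr)
  assume neg: "\<not> (\<exists>x. P x)"
  from assms have "AE x in (lborel :: 'a measure). False"
    by eventually_elim (use neg in blast)
  then show False by (simp add: not_AE_lborel_False)
qed

lemma measurable_cnj [measurable]:
  assumes "f \<in> borel_measurable M" shows "(\<lambda>x. cnj (f x)) \<in> borel_measurable M"
  using assms by (rule borel_measurable_continuous_on[rotated]) (intro continuous_intros)

text \<open>Valued in \<open>ennreal\<close>, so that energies of rearranged functions can be
  compared before they are known to be finite.\<close>

definition half_energy :: "(plane \<Rightarrow> real) \<Rightarrow> ennreal" where
  "half_energy f = (\<integral>\<^sup>+\<xi>. ennreal (norm \<xi> * (norm (FT f \<xi>))\<^sup>2) \<partial>lborel)"

text \<open>With \<open>t = s\<^sup>2\<close>, the weight \<open>1 / s\<^sup>2\<close> on the whole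
  line is the power \<open>-3/2\<close> of \<open>t\<close> on the half line, the usual
  subordination measure of the square root. In the variable \<open>s\<close> the scaling is linear.
  The value is \<open>2 * sqrt pi\<close>; being positive and finite, the constant can be
  cancelled.\<close>

definition subordination_const :: ennreal where
  "subordination_const = (\<integral>\<^sup>+s. ennreal ((1 - exp (- s\<^sup>2)) / s\<^sup>2) \<partial>lborel)"

lemma subordination_const_scale:
  assumes "r \<ge> 0"
  shows "(\<integral>\<^sup>+s. ennreal ((1 - exp (- s\<^sup>2 * r\<^sup>2)) / s\<^sup>2) \<partial>lborel) = ennreal r * subordination_const"
proof (cases "r = 0")
  case False
  then have r: "r > 0" using assms by simp
  have "(\<integral>\<^sup>+s. ennreal ((1 - exp (- s\<^sup>2 * r\<^sup>2)) / s\<^sup>2) \<partial>lborel)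
     = ennreal \<bar>1 / r\<bar> * (\<integral>\<^sup>+s. ennreal ((1 - exp (- (0 + 1 / r * s)\<^sup>2 * r\<^sup>2)) / (0 + 1 / r * s)\<^sup>2) \<partial>lborel)"
    by (rule nn_integral_real_affine) (use r in auto)
  also have "\<dots> = ennreal (1 / r) * (\<integral>\<^sup>+s. ennreal (r\<^sup>2) * ennreal ((1 - exp (- s\<^sup>2)) / s\<^sup>2) \<partial>lborel)"
    using r by (simp add: power_divide power_mult_distrib mult.commute flip: ennreal_mult')
  also have "\<dots> = (ennreal (1 / r) * ennreal (r\<^sup>2)) * subordination_const"
    by (subst nn_integral_cmult) (simp_all add: subordination_const_def mult.assoc)
  also have "ennreal (1 / r) * ennreal (r\<^sup>2) = ennreal r"
    using r by (simp add: power2_eq_square flip: ennreal_mult')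
  finally show ?thesis .
qed simp

lemma subordination_const_finite: "subordination_const < \<infinity>"
proof -
  have "(1 - exp (- s\<^sup>2)) / s\<^sup>2 \<le> 2 * (1 / (1 + s\<^sup>2))" for s :: real
  proof (cases "s = 0")
    case False
    have 1: "1 - exp (- s\<^sup>2) \<le> s\<^sup>2" using exp_ge_add_one_self[of "- s\<^sup>2"] by linarith
    have 2: "1 - exp (- s\<^sup>2) \<le> 1" by simp
    have "(1 - exp (- s\<^sup>2)) * (1 + s\<^sup>2) = (1 - exp (- s\<^sup>2)) + (1 - exp (- s\<^sup>2)) * s\<^sup>2" by algebra
    also have "\<dots> \<le> s\<^sup>2 + 1 * s\<^sup>2" by (intro add_mono 1 mult_right_mono 2) auto
    finally have "(1 - exp (- s\<^sup>2)) * (1 + s\<^sup>2) \<le> 2 * s\<^sup>2" by simp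
    then show ?thesis using False by (simp add: field_simps add_pos_nonneg)
  qed simp
  then have "subordination_const \<le> (\<integral>\<^sup>+s. ennreal (2 * (1 / (1 + s\<^sup>2))) \<partial>lborel)"
    unfolding subordination_const_def by (intro nn_integral_mono ennreal_leI) auto
  also have "\<dots> = 2 * (\<integral>\<^sup>+s. ennreal (1 / (1 + s\<^sup>2)) \<partial>lborel)"
    by (subst nn_integral_cmult[symmetric]) (simp_all flip: ennreal_mult' ennreal_numeral)
  also have "\<dots> < \<infinity>"
    using cauchy_density_integral(1) by (simp add: integrable_iff_bounded ennreal_mult_less_top)
  finally show ?thesis .
qed

lemma subordination_const_pos: "subordination_const \<noteq> 0"
proof
  assume "subordination_const = 0"
  then have "AE s in lborel. ennreal ((1 - exp (- s\<^sup>2)) / s\<^sup>2) = 0"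
    unfolding subordination_const_def by (subst (asm) nn_integral_0_iff_AE) auto
  then have "AE s in lborel. s = (0::real)"
  proof eventually_elim
    case (elim s)
    then have "(1 - exp (- s\<^sup>2)) / s\<^sup>2 \<le> 0" by (simp add: ennreal_eq_0_iff)
    then show ?case by (auto simp: divide_le_0_iff)
  qed
  moreover have "AE s in lborel. s \<noteq> (0::real)" by (rule AE_lborel_singleton)
  ultimately have "AE s in (lborel :: real measure). False" by eventually_elim simp
  then show False by (simp add: not_AE_lborel_False)
qed

text \<open>For fixed \<open>s\<close>, Plancherel and \<open>gauss_form_FT\<close> express the
  right-hand integrand as an integral over frequencies of nonnegative terms; Tonelli and
  \<open>subordination_const_scale\<close> at \<open>r = norm \<xi>\<close> do the rest. At
  \<open>s = 0\<close> division by zero makes both integrands 0.\<close>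

lemma half_energy_subordination:
  assumes f: "L2_bounded f"
  shows "subordination_const * half_energy f
    = (\<integral>\<^sup>+s. ennreal (((LBINT x. (f x)\<^sup>2) - gauss_form (s\<^sup>2) f) / s\<^sup>2) \<partial>lborel)"
proof -
  note [measurable] = L2_bounded_measurable[OF f]
  let ?N = "LBINT x. (f x)\<^sup>2"
  have "ennreal ((?N - gauss_form (s\<^sup>2) f) / s\<^sup>2)
     = (\<integral>\<^sup>+\<xi>. ennreal ((1 - exp (- s\<^sup>2 * (norm \<xi>)\<^sup>2)) / s\<^sup>2) * ennreal ((norm (FT f \<xi>))\<^sup>2) \<partial>lborel)" for s
  proof (cases "s = 0")
    case False
    then have t: "s\<^sup>2 > 0" by simp
    note i = plancherel_integrable[OF f] gauss_form_FT(1)[OF f t]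
    have "(?N - gauss_form (s\<^sup>2) f) / s\<^sup>2
      = (LBINT \<xi>. ((norm (FT f \<xi>))\<^sup>2 - exp (- s\<^sup>2 * (norm \<xi>)\<^sup>2) * (norm (FT f \<xi>))\<^sup>2) / s\<^sup>2)"
      using i by (simp add: plancherel_identity[OF f, symmetric] gauss_form_FT(2)[OF f t, symmetric])
    also have "ennreal \<dots> = (\<integral>\<^sup>+\<xi>. ennreal (((norm (FT f \<xi>))\<^sup>2 - exp (- s\<^sup>2 * (norm \<xi>)\<^sup>2) * (norm (FT f \<xi>))\<^sup>2) / s\<^sup>2) \<partial>lborel)"
      using i by (intro nn_integral_eq_integral[symmetric] AE_I2) (auto intro!: mult_left_le_one_le divide_nonneg_nonneg)
    also have "\<dots> = (\<integral>\<^sup>+\<xi>. ennreal ((1 - exp (- s\<^sup>2 * (norm \<xi>)\<^sup>2)) / s\<^sup>2) * ennreal ((norm (FT f \<xi>))\<^sup>2) \<partial>lborel)"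
      by (intro nn_integral_cong, subst ennreal_mult[symmetric]) (auto simp: algebra_simps diff_divide_distrib intro!: divide_right_mono)
    finally show ?thesis .
  qed simp
  then have "(\<integral>\<^sup>+s. ennreal ((?N - gauss_form (s\<^sup>2) f) / s\<^sup>2) \<partial>lborel)
    = (\<integral>\<^sup>+s. \<integral>\<^sup>+\<xi>. ennreal ((1 - exp (- s\<^sup>2 * (norm \<xi>)\<^sup>2)) / s\<^sup>2) * ennreal ((norm (FT f \<xi>))\<^sup>2) \<partial>lborel \<partial>lborel)"
    by simp
  also have "\<dots> = (\<integral>\<^sup>+\<xi>. \<integral>\<^sup>+s. ennreal ((1 - exp (- s\<^sup>2 * (norm \<xi>)\<^sup>2)) / s\<^sup>2) * ennreal ((norm (FT f \<xi>))\<^sup>2) \<partial>lborel \<partial>lborel)"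
    by (rule lborel_pair.Fubini') measurable
  also have "\<dots> = (\<integral>\<^sup>+\<xi>. subordination_const * ennreal (norm \<xi> * (norm (FT f \<xi>))\<^sup>2) \<partial>lborel)"
  proof (rule nn_integral_cong)
    fix \<xi> :: plane
    have "(\<integral>\<^sup>+s. ennreal ((1 - exp (- s\<^sup>2 * (norm \<xi>)\<^sup>2)) / s\<^sup>2) * ennreal ((norm (FT f \<xi>))\<^sup>2) \<partial>lborel)
      = ennreal (norm \<xi>) * subordination_const * ennreal ((norm (FT f \<xi>))\<^sup>2)"
      by (subst nn_integral_multc) (measurable, simp only: subordination_const_scale norm_ge_zero)
    then show "(\<integral>\<^sup>+s. ennreal ((1 - exp (- s\<^sup>2 * (norm \<xi>)\<^sup>2)) / s\<^sup>2) * ennreal ((norm (FT f \<xi>))\<^sup>2) \<partial>lborel)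
      = subordination_const * ennreal (norm \<xi> * (norm (FT f \<xi>))\<^sup>2)"
      by (simp add: ennreal_mult mult_ac)
  qed
  also have "\<dots> = subordination_const * half_energy f"
    unfolding half_energy_def by (rule nn_integral_cmult) measurable
  finally show ?thesis ..
qed

lemma gauss_form_le_square:
  assumes f: "L2_bounded f" and t: "t > 0"
  shows "gauss_form t f \<le> (LBINT x. (f x)\<^sup>2)"
  unfolding plancherel_identity[OF f, symmetric] gauss_form_FT(2)[OF f t, symmetric]
  using t by (intro integral_mono plancherel_integrable[OF f] gauss_form_FT(1)[OF f t] mult_left_le_one_le) auto

lemma measurable_gauss_form [measurable]:
  assumes [measurable]: "f \<in> borel_measurable borel"
  shows "(\<lambda>s. gauss_form (s\<^sup>2) f) \<in> borel_measurable borel"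
  unfolding gauss_form_def gaussian_def by measurable

text \<open>Equal square integrals make the subordination integrands ordered pointwise. If moreover
  the energies are equal and finite, the difference of the integrands has integral 0, so they agree
  for almost every \<open>s\<close>, and any nonzero such \<open>s\<close> supplies the time
  \<open>s\<^sup>2\<close>.\<close>

lemma half_energy_mono:
  assumes f: "L2_bounded f" and g: "L2_bounded g"
    and N: "(LBINT x. (g x)\<^sup>2) = (LBINT x. (f x)\<^sup>2)"
    and le: "\<And>t. t > 0 \<Longrightarrow> gauss_form t f \<le> gauss_form t g"
  shows "half_energy g \<le> half_energy f"
    and "half_energy f < \<infinity> \<Longrightarrow> half_energy f \<le> half_energy g \<Longrightarrow> \<exists>t>0. gauss_form t g = gauss_form t f"
proof -
  note [measurable] = f[THEN L2_bounded_measurable] g[THEN L2_bounded_measurable]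
  let ?N = "LBINT x. (f x)\<^sup>2"
  let ?A = "\<lambda>h s. ennreal ((?N - gauss_form (s\<^sup>2) h) / s\<^sup>2)"
  have A: "?A g s \<le> ?A f s" for s
  proof (cases "s = 0")
    case False then show ?thesis using le[of "s\<^sup>2"] by (intro ennreal_leI divide_right_mono) auto
  qed simp
  have C: "subordination_const * half_energy f = (\<integral>\<^sup>+s. ?A f s \<partial>lborel)"
    "subordination_const * half_energy g = (\<integral>\<^sup>+s. ?A g s \<partial>lborel)"
    using half_energy_subordination[OF f] half_energy_subordination[OF g] N by auto
  have cancel: "subordination_const * a \<le> subordination_const * b \<longleftrightarrow> a \<le> b" for a b
    using subordination_const_pos subordination_const_finite
    by (auto simp: ennreal_mult_le_mult_iff)
  show le': "half_energy g \<le> half_energy f"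
    by (rule cancel[THEN iffD1], unfold C) (intro nn_integral_mono A)
  assume fin: "half_energy f < \<infinity>" and ge: "half_energy f \<le> half_energy g"
  have eq: "(\<integral>\<^sup>+s. ?A f s \<partial>lborel) = (\<integral>\<^sup>+s. ?A g s \<partial>lborel)"
    using ge le' C by (metis order.antisym)
  have fin': "(\<integral>\<^sup>+s. ?A g s \<partial>lborel) < \<infinity>"
    unfolding eq[symmetric] C(1)[symmetric] using fin subordination_const_finite by (simp add: ennreal_mult_less_top)
  have "(\<integral>\<^sup>+s. ?A f s - ?A g s \<partial>lborel) = (\<integral>\<^sup>+s. ?A f s \<partial>lborel) - (\<integral>\<^sup>+s. ?A g s \<partial>lborel)"
    by (rule nn_integral_diff) (use fin' A in auto)
  also have "\<dots> = 0" using eq fin' by simp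
  finally have "AE s in lborel. ?A f s - ?A g s = 0" by (subst (asm) nn_integral_0_iff_AE) auto
  moreover have "AE s in lborel. s \<noteq> (0::real)" by (rule AE_lborel_singleton)
  ultimately have "AE s in lborel. s \<noteq> 0 \<and> gauss_form (s\<^sup>2) g = gauss_form (s\<^sup>2) f"
  proof eventually_elim
    case (elim s)
    then have t: "s\<^sup>2 > 0" by simp
    have "?A f s \<le> ?A g s" using elim by (simp add: ennreal_minus_eq_0)
    \<comment> \<open>\<open>ennreal\<close> collapses negative numbers to 0, so the inequality of
      reals can be recovered only after the larger side is known to be nonnegative.\<close>
    moreover have "0 \<le> (?N - gauss_form (s\<^sup>2) g) / s\<^sup>2"
      using gauss_form_le_square[OF g t] N by simp
    ultimately have "(?N - gauss_form (s\<^sup>2) f) / s\<^sup>2 \<le> (?N - gauss_form (s\<^sup>2) g) / s\<^sup>2"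
      by (simp only: ennreal_le_iff)
    then show ?case using elim le[OF t] by (simp add: divide_le_cancel)
  qed
  then have "\<exists>s. s \<noteq> 0 \<and> gauss_form (s\<^sup>2) g = gauss_form (s\<^sup>2) f"
    by (rule AE_lborel_ex)
  then obtain s where "s \<noteq> 0" "gauss_form (s\<^sup>2) g = gauss_form (s\<^sup>2) f" by blast
  then show "\<exists>t>0. gauss_form t g = gauss_form t f" by (intro exI[of _ "s\<^sup>2"]) auto
qed

section \<open>Functions of finite half energy and their pairing\<close>

definition finite_energy :: "(plane \<Rightarrow> real) \<Rightarrow> bool" where
  "finite_energy f \<longleftrightarrow> L2_bounded f \<and> half_energy f < \<infinity>"

definition half_pairing :: "(plane \<Rightarrow> real) \<Rightarrow> (plane \<Rightarrow> real) \<Rightarrow> real" where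
  "half_pairing f g = Re (LBINT \<xi>. complex_of_real (norm \<xi>) * FT f \<xi> * cnj (FT g \<xi>))"

lemma finite_energy_L2: "finite_energy f \<Longrightarrow> L2_bounded f"
  by (simp add: finite_energy_def)

lemma finite_energy_integrable:
  assumes "finite_energy f" shows "integrable lborel (\<lambda>\<xi>. norm \<xi> * (norm (FT f \<xi>))\<^sup>2)"
proof -
  note [measurable] = L2_bounded_measurable[OF finite_energy_L2[OF assms]]
  show ?thesis using assms by (simp add: integrable_iff_bounded finite_energy_def half_energy_def)
qed

lemma integrable_half_pairing:
  assumes f: "finite_energy f" and g: "finite_energy g"
  shows "integrable lborel (\<lambda>\<xi>. complex_of_real (norm \<xi>) * FT f \<xi> * cnj (FT g \<xi>))"
proof -
  note [measurable] = L2_bounded_measurable[OF finite_energy_L2[OF f]] L2_bounded_measurable[OF finite_energy_L2[OF g]]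
  have i: "integrable lborel (\<lambda>\<xi>. norm \<xi> * (norm (FT f \<xi>))\<^sup>2 + norm \<xi> * (norm (FT g \<xi>))\<^sup>2)"
    using finite_energy_integrable f g by auto
  show ?thesis
  proof (rule Bochner_Integration.integrable_bound[OF i])
    show "AE \<xi> in lborel. norm (complex_of_real (norm \<xi>) * FT f \<xi> * cnj (FT g \<xi>))
       \<le> norm (norm \<xi> * (norm (FT f \<xi>))\<^sup>2 + norm \<xi> * (norm (FT g \<xi>))\<^sup>2)"
    proof (intro AE_I2)
      fix \<xi> :: plane
      have "norm \<xi> * (norm (FT f \<xi>) * norm (FT g \<xi>)) \<le> norm \<xi> * ((norm (FT f \<xi>))\<^sup>2 + (norm (FT g \<xi>))\<^sup>2)"
        using abs_mult_le[of "norm (FT f \<xi>)" "norm (FT g \<xi>)"] by (intro mult_left_mono) auto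
      then show "norm (complex_of_real (norm \<xi>) * FT f \<xi> * cnj (FT g \<xi>))
       \<le> norm (norm \<xi> * (norm (FT f \<xi>))\<^sup>2 + norm \<xi> * (norm (FT g \<xi>))\<^sup>2)"
        by (simp add: norm_mult mult.assoc distrib_left)
    qed
  qed measurable
qed

lemma half_pairing_self:
  assumes f: "finite_energy f"
  shows "half_pairing f f = (LBINT \<xi>. norm \<xi> * (norm (FT f \<xi>))\<^sup>2)"
    and "half_energy f = ennreal (half_pairing f f)" "half_pairing f f \<ge> 0"
proof -
  have eq: "complex_of_real (norm \<xi>) * FT f \<xi> * cnj (FT f \<xi>) = complex_of_real (norm \<xi> * (norm (FT f \<xi>))\<^sup>2)" for \<xi>
    by (simp only: of_real_mult complex_norm_square mult.assoc)
  show 1: "half_pairing f f = (LBINT \<xi>. norm \<xi> * (norm (FT f \<xi>))\<^sup>2)"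
    unfolding half_pairing_def eq integral_complex_of_real by simp
  show "half_energy f = ennreal (half_pairing f f)"
    unfolding 1 half_energy_def by (rule nn_integral_eq_integral[OF finite_energy_integrable[OF f]]) auto
  show "half_pairing f f \<ge> 0" unfolding 1 by (intro integral_nonneg_AE) auto
qed

lemma finite_energy_diff:
  assumes f: "finite_energy f" and g: "finite_energy g"
  shows "finite_energy (\<lambda>x. f x - g x)"
proof -
  note [measurable] = L2_bounded_measurable[OF finite_energy_L2[OF f]] L2_bounded_measurable[OF finite_energy_L2[OF g]]
  note i = f[THEN finite_energy_L2, THEN L2_bounded_integrable] g[THEN finite_energy_L2, THEN L2_bounded_integrable]
  have "half_energy (\<lambda>x. f x - g x) \<le> (\<integral>\<^sup>+\<xi>. 2 * ennreal (norm \<xi> * (norm (FT f \<xi>))\<^sup>2) + 2 * ennreal (norm \<xi> * (norm (FT g \<xi>))\<^sup>2) \<partial>lborel)"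
    unfolding half_energy_def
  proof (intro nn_integral_mono)
    fix \<xi>
    have "(norm (FT f \<xi> - FT g \<xi>))\<^sup>2 \<le> (norm (FT f \<xi>) + norm (FT g \<xi>))\<^sup>2"
      by (intro power_mono norm_triangle_ineq4) auto
    also have "\<dots> \<le> 2 * (norm (FT f \<xi>))\<^sup>2 + 2 * (norm (FT g \<xi>))\<^sup>2" by (rule square_add_le)
    finally have "norm \<xi> * (norm (FT f \<xi> - FT g \<xi>))\<^sup>2 \<le> norm \<xi> * (2 * (norm (FT f \<xi>))\<^sup>2 + 2 * (norm (FT g \<xi>))\<^sup>2)"
      by (intro mult_left_mono) auto
    then have "norm \<xi> * (norm (FT f \<xi> - FT g \<xi>))\<^sup>2 \<le> 2 * (norm \<xi> * (norm (FT f \<xi>))\<^sup>2) + 2 * (norm \<xi> * (norm (FT g \<xi>))\<^sup>2)"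
      by (simp add: algebra_simps)
    then show "ennreal (norm \<xi> * (norm (FT (\<lambda>x. f x - g x) \<xi>))\<^sup>2) \<le> 2 * ennreal (norm \<xi> * (norm (FT f \<xi>))\<^sup>2) + 2 * ennreal (norm \<xi> * (norm (FT g \<xi>))\<^sup>2)"
      unfolding FT_diff[OF i] by (simp flip: ennreal_plus ennreal_mult' ennreal_numeral add: ennreal_leI)
  qed
  also have "\<dots> = 2 * half_energy f + 2 * half_energy g"
    unfolding half_energy_def by (simp add: nn_integral_add nn_integral_cmult)
  also have "\<dots> < \<infinity>" using f g by (simp add: finite_energy_def ennreal_mult_less_top)
  finally show ?thesis using L2_bounded_diff f g by (simp add: finite_energy_def)
qed

lemma half_pairing_expand:
  assumes f: "finite_energy f" and g: "finite_energy g"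
  defines "h \<equiv> \<lambda>x. g x - f x"
  shows "half_pairing g g = half_pairing f f + 2 * half_pairing f h + half_pairing h h"
proof -
  have h: "finite_energy h" unfolding h_def by (rule finite_energy_diff[OF g f])
  note i = f[THEN finite_energy_L2, THEN L2_bounded_integrable] g[THEN finite_energy_L2, THEN L2_bounded_integrable]
  have eq: "FT g \<xi> = FT f \<xi> + FT h \<xi>" for \<xi> unfolding h_def FT_diff[OF i(2) i(1)] by simp
  have "Re (complex_of_real (norm \<xi>) * FT g \<xi> * cnj (FT g \<xi>)) =
     Re (complex_of_real (norm \<xi>) * FT f \<xi> * cnj (FT f \<xi>)) + 2 * Re (complex_of_real (norm \<xi>) * FT f \<xi> * cnj (FT h \<xi>))
     + Re (complex_of_real (norm \<xi>) * FT h \<xi> * cnj (FT h \<xi>))" for \<xi>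
    unfolding eq by (simp add: algebra_simps)
  then have "half_pairing g g = (LBINT \<xi>. Re (complex_of_real (norm \<xi>) * FT f \<xi> * cnj (FT f \<xi>)) + 2 * Re (complex_of_real (norm \<xi>) * FT f \<xi> * cnj (FT h \<xi>))
     + Re (complex_of_real (norm \<xi>) * FT h \<xi> * cnj (FT h \<xi>)))"
    unfolding half_pairing_def using integrable_half_pairing[OF g g] by (subst integral_Re[symmetric]) simp_all
  also have "\<dots> = half_pairing f f + 2 * half_pairing f h + half_pairing h h"
    unfolding half_pairing_def
    using integrable_half_pairing[OF f f] integrable_half_pairing[OF f h] integrable_half_pairing[OF h h]
    by (simp only: integral_Re[symmetric] Bochner_Integration.integral_add Bochner_Integration.integrable_add
       integrable_Re integrable_mult_right integral_mult_right_zero)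
  finally show ?thesis .
qed

text \<open>The weight \<open>norm \<xi>\<close> vanishes only at the origin, a null set, so the
  transform vanishes almost everywhere and Plancherel applies.\<close>

lemma half_pairing_zero_AE:
  assumes f: "finite_energy f" and z: "half_pairing f f \<le> 0"
  shows "AE x in lborel. f x = 0"
proof (rule FT_AE_zero[OF finite_energy_L2[OF f]])
  have "half_energy f = 0" using half_pairing_self(2)[OF f] z by (simp add: ennreal_eq_0_iff)
  note [measurable] = L2_bounded_measurable[OF finite_energy_L2[OF f]]
  have "AE \<xi> in lborel. ennreal (norm \<xi> * (norm (FT f \<xi>))\<^sup>2) = 0"
    using \<open>half_energy f = 0\<close> unfolding half_energy_def by (subst (asm) nn_integral_0_iff_AE) auto
  moreover have "AE \<xi> in lborel. \<xi> \<noteq> (0::plane)" by (rule AE_lborel_singleton)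
  ultimately show "AE \<xi> in lborel. FT f \<xi> = 0"
  proof eventually_elim
    case (elim \<xi>)
    have "norm \<xi> * (norm (FT f \<xi>))\<^sup>2 = 0"
      using elim(1) by (subst (asm) ennreal_eq_0_iff) (metis norm_ge_zero mult_nonneg_nonneg zero_le_power2 order.antisym)
    then show ?case using elim(2) by simp
  qed
qed

section \<open>The Dirichlet energy and its minimizers\<close>

text \<open>Vanishing is required at every point, not almost everywhere, because polarization of
  functions and of sets is compared point by point.\<close>

definition supported_in :: "(plane \<Rightarrow> real) \<Rightarrow> plane set \<Rightarrow> bool" where
  "supported_in f S \<longleftrightarrow> (\<forall>x. x \<notin> S \<longrightarrow> f x = 0)"

definition dirichlet_energy :: "(plane \<Rightarrow> real) \<Rightarrow> real" where
  "dirichlet_energy f = half_pairing f f / 2 - (LBINT x. f x)"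

text \<open>Passes from Lebesgue measurable functions with almost everywhere conditions to a Borel
  representative that is cut off by the indicator of \<open>\<Omega>\<close>. The energy bound
  transfers because \<open>norm \<xi>\<close> is at most the square root weight in
  \<open>H_half\<close>.\<close>

lemma H_half_representative:
  assumes v: "v \<in> H_half_vanishing_outside \<Omega>" and "open \<Omega>" "bounded \<Omega>"
  obtains f where "finite_energy f" "supported_in f \<Omega>" "AE x in lborel. v x = f x" "v \<in> borel_measurable lebesgue"
proof -
  have [measurable]: "\<Omega> \<in> sets borel" using assms by auto
  have H: "v \<in> H_half" "AE x in lebesgue. x \<notin> \<Omega> \<longrightarrow> v x = 0"
    using v by (auto simp: H_half_vanishing_outside_def)
  have "(\<lambda>x. complex_of_real (v x)) \<in> borel_measurable lebesgue"
    using H(1) unfolding H_half_def square_integrable_def by auto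
  from measurable_compose[OF this borel_measurable_Re]
  have vm: "v \<in> borel_measurable lebesgue" by simp
  then obtain g where [measurable]: "g \<in> borel_measurable lborel" and g: "AE x in lborel. v x = g x"
    using completion_ex_borel_measurable_real by blast
  define f where "f = (\<lambda>x. indicator \<Omega> x * g x)"
  have fm [measurable]: "f \<in> borel_measurable borel" unfolding f_def by measurable
  have vf: "AE x in lborel. v x = f x"
    using g H(2)[unfolded AE_completion_iff] by eventually_elim (auto simp: f_def indicator_def)
  have "(\<integral>\<^sup>+x. ennreal ((f x)\<^sup>2) \<partial>lborel) = (\<integral>\<^sup>+x. ennreal ((norm (complex_of_real (v x)))\<^sup>2) \<partial>lborel)"
    using vf by (intro nn_integral_cong_AE) auto
  also have "\<dots> < \<infinity>" using H(1) unfolding H_half_def square_integrable_def nn_integral_completion by auto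
  finally have "integrable lborel (\<lambda>x. (f x)\<^sup>2)" by (intro integrableI_bounded) auto
  moreover obtain R where R: "\<And>x. x \<in> \<Omega> \<Longrightarrow> norm x \<le> R" using \<open>bounded \<Omega>\<close> by (auto simp: bounded_iff)
  have "f x = 0" if "norm x > R" for x using R[of x] that by (auto simp: f_def indicator_def)
  ultimately have L: "L2_bounded f" using fm by (auto simp: L2_bounded_def)
  have "half_energy f \<le> (\<integral>\<^sup>+\<xi>. ennreal (sqrt (1 + (norm \<xi>)\<^sup>2) * (norm (FT f \<xi>))\<^sup>2) \<partial>lborel)"
    unfolding half_energy_def
    by (intro nn_integral_mono ennreal_leI mult_right_mono real_le_rsqrt) auto
  also have "\<dots> = (\<integral>\<^sup>+\<xi>. ennreal (sqrt (1 + (norm \<xi>)\<^sup>2) * (norm (plancherel v \<xi>))\<^sup>2) \<partial>lborel)"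
    using plancherel_AE(2)[OF L vm vf] by (intro nn_integral_cong_AE) auto
  also have "\<dots> < \<infinity>" using H(1) unfolding H_half_def nn_integral_completion by auto
  finally have "finite_energy f" using L by (simp add: finite_energy_def)
  moreover have "supported_in f \<Omega>" by (simp add: supported_in_def f_def)
  ultimately show ?thesis using that vf vm by blast
qed

lemma H_half_vanishing_outsideI:
  assumes f: "finite_energy f" and s: "supported_in f \<Omega>"
  shows "f \<in> H_half_vanishing_outside \<Omega>"
proof -
  note L = finite_energy_L2[OF f]
  note [measurable] = L2_bounded_measurable[OF L]
  have fm: "f \<in> borel_measurable lebesgue" by (rule measurable_completion) simp
  have "(\<integral>\<^sup>+ x. ennreal ((norm (complex_of_real (f x)))\<^sup>2) \<partial>lebesgue) < \<infinity>"
    using L2_bounded_square[OF L] by (simp add: nn_integral_completion integrable_iff_bounded)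
  then have 1: "square_integrable (\<lambda>x. complex_of_real (f x))"
    unfolding square_integrable_def using measurable_compose[OF fm borel_measurable_of_real] by simp
  have "(\<integral>\<^sup>+ \<xi>. ennreal (sqrt (1 + (norm \<xi>)\<^sup>2) * (norm (plancherel f \<xi>))\<^sup>2) \<partial>lebesgue)
     = (\<integral>\<^sup>+ \<xi>. ennreal (sqrt (1 + (norm \<xi>)\<^sup>2) * (norm (FT f \<xi>))\<^sup>2) \<partial>lborel)"
    unfolding nn_integral_completion
    using plancherel_AE(2)[OF L fm] by (intro nn_integral_cong_AE) auto
  also have "\<dots> \<le> (\<integral>\<^sup>+ \<xi>. ennreal ((norm (FT f \<xi>))\<^sup>2) + ennreal (norm \<xi> * (norm (FT f \<xi>))\<^sup>2) \<partial>lborel)"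
  proof (intro nn_integral_mono)
    fix \<xi> :: plane
    have "sqrt (1 + (norm \<xi>)\<^sup>2) \<le> 1 + norm \<xi>"
      by (intro real_le_lsqrt) (auto simp: power2_sum)
    then have "sqrt (1 + (norm \<xi>)\<^sup>2) * (norm (FT f \<xi>))\<^sup>2 \<le> (1 + norm \<xi>) * (norm (FT f \<xi>))\<^sup>2"
      by (intro mult_right_mono) auto
    then show "ennreal (sqrt (1 + (norm \<xi>)\<^sup>2) * (norm (FT f \<xi>))\<^sup>2) \<le> ennreal ((norm (FT f \<xi>))\<^sup>2) + ennreal (norm \<xi> * (norm (FT f \<xi>))\<^sup>2)"
      by (simp add: distrib_right ennreal_leI flip: ennreal_plus)
  qed
  also have "\<dots> = (\<integral>\<^sup>+ \<xi>. ennreal ((norm (FT f \<xi>))\<^sup>2) \<partial>lborel) + half_energy f"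
    unfolding half_energy_def by (rule nn_integral_add) auto
  also have "\<dots> < \<infinity>"
    using plancherel_integrable[OF L] f by (simp add: integrable_iff_bounded finite_energy_def)
  finally show ?thesis using 1 s by (auto simp: H_half_vanishing_outside_def H_half_def supported_in_def)
qed

lemma duality_pairing_eq:
  assumes f: "L2_bounded f" "v \<in> borel_measurable lebesgue" "AE x in lborel. v x = f x"
    and g: "L2_bounded g" "w \<in> borel_measurable lebesgue" "AE x in lborel. w x = g x"
  shows "duality_pairing (half_laplacian_hat v) w = half_pairing f g"
proof -
  note [measurable] = L2_bounded_measurable[OF f(1)] L2_bounded_measurable[OF g(1)]
  note pf = plancherel_AE[OF f] and pg = plancherel_AE[OF g]
  have n: "(\<lambda>\<xi>. complex_of_real (norm (\<xi>::plane))) \<in> borel_measurable lebesgue" by (rule measurable_completion) simp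
  have "(\<integral>\<xi>. half_laplacian_hat v \<xi> * cnj (plancherel w \<xi>) \<partial>lebesgue)
     = (\<integral>\<xi>. complex_of_real (norm \<xi>) * FT f \<xi> * cnj (FT g \<xi>) \<partial>lebesgue)"
  proof (rule integral_cong_AE)
    show "(\<lambda>\<xi>. half_laplacian_hat v \<xi> * cnj (plancherel w \<xi>)) \<in> borel_measurable lebesgue"
      unfolding half_laplacian_hat_def by (intro borel_measurable_times n pf(1) measurable_cnj pg(1))
    show "(\<lambda>\<xi>. complex_of_real (norm \<xi>) * FT f \<xi> * cnj (FT g \<xi>)) \<in> borel_measurable lebesgue"
      by (rule measurable_completion) measurable
    show "AE \<xi> in lebesgue. half_laplacian_hat v \<xi> * cnj (plancherel w \<xi>) = complex_of_real (norm \<xi>) * FT f \<xi> * cnj (FT g \<xi>)"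
      unfolding AE_completion_iff half_laplacian_hat_def using pf(2) pg(2) by eventually_elim simp
  qed
  also have "\<dots> = (LBINT \<xi>. complex_of_real (norm \<xi>) * FT f \<xi> * cnj (FT g \<xi>))"
    by (rule integral_completion) measurable
  finally show ?thesis by (simp add: duality_pairing_def half_pairing_def)
qed

lemma integral_lebesgue_eq:
  assumes "f \<in> borel_measurable borel" "v \<in> borel_measurable lebesgue" "AE x in lborel. v x = f x"
  shows "(\<integral>x. v x \<partial>lebesgue) = (LBINT x. (f x :: real))"
proof -
  have fm: "f \<in> borel_measurable lebesgue" by (rule measurable_completion) (use assms in simp)
  have "(\<integral>x. v x \<partial>lebesgue) = (\<integral>x. f x \<partial>lebesgue)"
    by (rule integral_cong_AE[OF assms(2) fm]) (use assms(3) in \<open>simp add: AE_completion_iff\<close>)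
  then show ?thesis using integral_completion[of f lborel] assms by simp
qed

lemma J_le_dirichlet_energy:
  assumes f: "finite_energy f" and s: "supported_in f \<Omega>"
  shows "J \<Omega> \<le> ereal (dirichlet_energy f)"
proof -
  note L = finite_energy_L2[OF f]
  have fm: "f \<in> borel_measurable lebesgue" by (rule measurable_completion) (use L2_bounded_measurable[OF L] in simp)
  have "ereal (1/2 * duality_pairing (half_laplacian_hat f) f - (\<integral>x. f x \<partial>lebesgue)) = ereal (dirichlet_energy f)"
    using duality_pairing_eq[OF L fm _ L fm] integral_lebesgue_eq[OF L2_bounded_measurable[OF L] fm]
    by (simp add: dirichlet_energy_def)
  moreover have "J \<Omega> \<le> ereal (1/2 * duality_pairing (half_laplacian_hat f) f - (\<integral>x. f x \<partial>lebesgue))"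
    unfolding J_def by (rule INF_lower[OF H_half_vanishing_outsideI[OF f s]])
  ultimately show ?thesis by simp
qed

text \<open>The weak equation \<open>solves_euler_lagrange\<close> restated for Borel
  representatives and the concrete transform.\<close>

definition EL_solution :: "plane set \<Rightarrow> (plane \<Rightarrow> real) \<Rightarrow> bool" where
  "EL_solution \<Omega> f \<longleftrightarrow> finite_energy f \<and> supported_in f \<Omega> \<and>
     (\<forall>g. finite_energy g \<longrightarrow> supported_in g \<Omega> \<longrightarrow> half_pairing f g = (LBINT x. g x))"

text \<open>Completing the square: the weak equation tested with \<open>g - f\<close> removes the
  linear terms. The excess is a definite quadratic form, so this gives minimality and, with
  \<open>half_pairing_zero_AE\<close>, uniqueness.\<close>

lemma EL_solution_energy:
  assumes f: "EL_solution \<Omega> f" and g: "finite_energy g" "supported_in g \<Omega>"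
  shows "dirichlet_energy g = dirichlet_energy f + half_pairing (\<lambda>x. g x - f x) (\<lambda>x. g x - f x) / 2"
proof -
  have f': "finite_energy f" using f by (simp add: EL_solution_def)
  have "half_pairing f (\<lambda>x. g x - f x) = (LBINT x. g x - f x)"
    using f g finite_energy_diff[OF g(1) f'] by (auto simp: EL_solution_def supported_in_def)
  also have "\<dots> = (LBINT x. g x) - (LBINT x. f x)"
    using g(1) f' by (intro Bochner_Integration.integral_diff L2_bounded_integrable finite_energy_L2)
  finally show ?thesis
    using half_pairing_expand[OF f' g(1)] by (simp add: dirichlet_energy_def field_simps)
qed

lemma EL_solution_minimal:
  assumes f: "EL_solution \<Omega> f" and \<Omega>: "open \<Omega>" "bounded \<Omega>"
  shows "ereal (dirichlet_energy f) \<le> J \<Omega>"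
  unfolding J_def
proof (rule INF_greatest)
  fix v assume "v \<in> H_half_vanishing_outside \<Omega>"
  then obtain g where g: "finite_energy g" "supported_in g \<Omega>" "AE x in lborel. v x = g x" "v \<in> borel_measurable lebesgue"
    using H_half_representative \<Omega> by metis
  note L = finite_energy_L2[OF g(1)]
  have "dirichlet_energy f \<le> dirichlet_energy g"
    using EL_solution_energy[OF f g(1,2)] half_pairing_self(3)[OF finite_energy_diff[OF g(1)]] f
    by (simp add: EL_solution_def)
  also have "dirichlet_energy g = 1/2 * duality_pairing (half_laplacian_hat v) v - (\<integral>x. v x \<partial>lebesgue)"
    using duality_pairing_eq[OF L g(4,3) L g(4,3)] integral_lebesgue_eq[OF L2_bounded_measurable[OF L] g(4,3)]
    by (simp add: dirichlet_energy_def)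
  finally show "ereal (dirichlet_energy f) \<le> ereal (1/2 * duality_pairing (half_laplacian_hat v) v - (\<integral>x. v x \<partial>lebesgue))"
    by simp
qed

lemma solves_euler_lagrange_representative:
  assumes u: "solves_euler_lagrange \<Omega> u" and \<Omega>: "open \<Omega>" "bounded \<Omega>"
  obtains f where "EL_solution \<Omega> f" "AE x in lborel. u x = f x"
proof -
  obtain f where f: "finite_energy f" "supported_in f \<Omega>" "AE x in lborel. u x = f x" "u \<in> borel_measurable lebesgue"
    using H_half_representative[OF _ \<Omega>] u unfolding solves_euler_lagrange_def by metis
  have "half_pairing f g = (LBINT x. g x)" if g: "finite_energy g" "supported_in g \<Omega>" for g
  proof -
    note L = finite_energy_L2[OF g(1)]
    have gm: "g \<in> borel_measurable lebesgue" by (rule measurable_completion) (use L2_bounded_measurable[OF L] in simp)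
    have "duality_pairing (half_laplacian_hat u) g = (\<integral>x. g x \<partial>lebesgue)"
      using u H_half_vanishing_outsideI[OF g] by (simp add: solves_euler_lagrange_def)
    then show ?thesis
      using duality_pairing_eq[OF finite_energy_L2[OF f(1)] f(4,3) L gm]
        integral_lebesgue_eq[OF L2_bounded_measurable[OF L] gm] by simp
  qed
  then show ?thesis by (intro that[of f]) (use f in \<open>auto simp: EL_solution_def\<close>)
qed

text \<open>The Gaussian kernel is positive, so passing to the absolute value raises the Gaussian
  forms and hence does not raise the energy. As \<open>f\<close> is minimal on
  \<open>\<Omega>\<close>, the integral of the absolute value cannot exceed the integral of
  \<open>f\<close>.\<close>

lemma EL_solution_nonneg:
  assumes f: "EL_solution \<Omega> f" and \<Omega>: "open \<Omega>" "bounded \<Omega>"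
  shows "AE x in lborel. f x \<ge> 0"
proof -
  have fe: "finite_energy f" "supported_in f \<Omega>" using f by (auto simp: EL_solution_def)
  note L = finite_energy_L2[OF fe(1)]
  note i = L2_bounded_integrable[OF L]
  let ?a = "\<lambda>x. \<bar>f x\<bar>"
  have La: "L2_bounded ?a" by (rule L2_bounded_abs[OF L])
  have "gauss_form t f \<le> gauss_form t ?a" if t: "t > 0" for t
    unfolding gauss_form_def
  proof (rule integral_mono[OF integrable_gauss_form[OF L L t] integrable_gauss_form[OF La La t]])
    fix p :: "plane \<times> plane"
    show "f (fst p) * f (snd p) * gaussian t (fst p - snd p) \<le> \<bar>f (fst p)\<bar> * \<bar>f (snd p)\<bar> * gaussian t (fst p - snd p)"
      using gaussian_pos[OF t, of "fst p - snd p"] abs_ge_self[of "f (fst p) * f (snd p)"]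
      by (intro mult_right_mono) (auto simp: abs_mult)
  qed
  then have le: "half_energy ?a \<le> half_energy f"
    by (intro half_energy_mono(1)[OF L La]) auto
  then have a: "finite_energy ?a" "supported_in ?a \<Omega>"
    using La fe by (auto simp: finite_energy_def supported_in_def)
  have "half_pairing ?a ?a \<le> half_pairing f f"
    using le half_pairing_self[OF a(1)] half_pairing_self[OF fe(1)] by simp
  moreover have "dirichlet_energy f \<le> dirichlet_energy ?a"
    using EL_solution_energy[OF f a] half_pairing_self(3)[OF finite_energy_diff[OF a(1) fe(1)]] by simp
  ultimately have "(LBINT x. \<bar>f x\<bar>) \<le> (LBINT x. f x)"
    by (simp add: dirichlet_energy_def)
  then have "(LBINT x. \<bar>f x\<bar> - f x) \<le> 0" using i by simp
  moreover have "(LBINT x. \<bar>f x\<bar> - f x) \<ge> 0" by (intro integral_nonneg_AE) auto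
  ultimately have "(LBINT x. \<bar>f x\<bar> - f x) = 0" by simp
  then have "AE x in lborel. \<bar>f x\<bar> - f x = 0"
    using i by (subst (asm) integral_nonneg_eq_0_iff_AE) auto
  then show ?thesis by eventually_elim auto
qed

section \<open>Polarization\<close>

definition polarize :: "plane \<Rightarrow> real \<Rightarrow> (plane \<Rightarrow> real) \<Rightarrow> plane \<Rightarrow> real" where
  "polarize e \<tau> f x = (if \<tau> < x \<bullet> e then max (f x) (f (reflect e \<tau> x)) else min (f x) (f (reflect e \<tau> x)))"

lemma measurable_polarize [measurable]:
  assumes [measurable]: "f \<in> borel_measurable borel"
  shows "polarize e \<tau> f \<in> borel_measurable borel"
  unfolding polarize_def[abs_def] by measurable

lemma reflect_eq: "x \<bullet> e = \<tau> \<Longrightarrow> reflect e \<tau> x = x"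
  by (simp add: reflect_def)

text \<open>On each orbit of the reflection the two values are either kept or exchanged, so every
  symmetric expression in them is preserved.\<close>

lemma polarize_orbit_cases:
  assumes "norm e = 1"
  shows "polarize e \<tau> f x = f x \<and> polarize e \<tau> f (reflect e \<tau> x) = f (reflect e \<tau> x) \<or>
     polarize e \<tau> f x = f (reflect e \<tau> x) \<and> polarize e \<tau> f (reflect e \<tau> x) = f x"
  using assms reflect_eq[of x e \<tau>] unfolding polarize_def inner_reflect[OF assms] reflect_reflect[OF assms]
  by (cases "x \<bullet> e" \<tau> rule: linorder_cases) (auto simp: max_def min_def)

lemma polarize_sum:
  assumes "norm e = 1"
  shows "polarize e \<tau> f x + polarize e \<tau> f (reflect e \<tau> x) = f x + f (reflect e \<tau> x)"
  using polarize_orbit_cases[OF assms, of \<tau> f x] by auto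

lemma polarize_diff:
  assumes "norm e = 1"
  shows "\<tau> < x \<bullet> e \<Longrightarrow> polarize e \<tau> f x - polarize e \<tau> f (reflect e \<tau> x) = \<bar>f x - f (reflect e \<tau> x)\<bar>"
    and "x \<bullet> e < \<tau> \<Longrightarrow> polarize e \<tau> f x - polarize e \<tau> f (reflect e \<tau> x) = - \<bar>f x - f (reflect e \<tau> x)\<bar>"
  unfolding polarize_def inner_reflect[OF assms] reflect_reflect[OF assms] by auto

lemma L2_bounded_reflect:
  assumes e: "norm e = 1" and f: "L2_bounded f"
  shows "L2_bounded (\<lambda>x. f (reflect e \<tau> x))"
proof -
  note [measurable] = L2_bounded_measurable[OF f]
  obtain R where R: "\<And>x. norm x > R \<Longrightarrow> f x = 0" using f by (auto simp: L2_bounded_def)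
  have "f (reflect e \<tau> x) = 0" if "norm x > R + norm (reflect e \<tau> 0)" for x
  proof (rule R)
    have "norm x = norm (reflect e \<tau> x - reflect e \<tau> 0)" using norm_reflect_reflect[OF e, of \<tau> x 0] by simp
    also have "\<dots> \<le> norm (reflect e \<tau> x) + norm (reflect e \<tau> 0)" by (rule norm_triangle_ineq4)
    finally show "norm (reflect e \<tau> x) > R" using that by simp
  qed
  moreover have "integrable lborel (\<lambda>x. (f (reflect e \<tau> x))\<^sup>2)"
    by (rule integrable_reflect[OF e L2_bounded_square[OF f]])
  ultimately show ?thesis unfolding L2_bounded_def by auto
qed

lemma L2_bounded_polarize:
  assumes e: "norm e = 1" and f: "L2_bounded f"
  shows "L2_bounded (polarize e \<tau> f)"
proof (rule L2_bounded_dominated)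
  show "L2_bounded (\<lambda>x. \<bar>f x\<bar> + \<bar>f (reflect e \<tau> x)\<bar>)"
    by (intro L2_bounded_add L2_bounded_abs L2_bounded_reflect e f)
  show "polarize e \<tau> f \<in> borel_measurable borel" using L2_bounded_measurable[OF f] by measurable
  show "\<bar>polarize e \<tau> f x\<bar> \<le> \<bar>\<bar>f x\<bar> + \<bar>f (reflect e \<tau> x)\<bar>\<bar>" for x by (auto simp: polarize_def)
qed

text \<open>By invariance of the measure, twice an integral is the integral of the orbit
  sums.\<close>

lemma integral_eq_if_orbit_sum_eq:
  assumes e: "norm e = 1" and f: "integrable lborel f" and g: "integrable lborel g"
    and eq: "\<And>x. g x + g (reflect e \<tau> x) = f x + f (reflect e \<tau> x)"
  shows "(LBINT x. g x) = (LBINT x. f x :: real)"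
proof -
  have [measurable]: "f \<in> borel_measurable borel" "g \<in> borel_measurable borel" using f g by auto
  have s: "(LBINT x. h x + h (reflect e \<tau> x)) = 2 * (LBINT x. h x)" if "integrable lborel h" for h :: "plane \<Rightarrow> real"
  proof -
    have [measurable]: "h \<in> borel_measurable borel" using that by auto
    show ?thesis using that integrable_reflect[OF e that, of \<tau>] integral_reflect[OF e, of h \<tau>] by simp
  qed
  show ?thesis using s[OF f] s[OF g] eq by simp
qed

lemma integral_polarize:
  assumes e: "norm e = 1" and f: "L2_bounded f"
  shows "(LBINT x. polarize e \<tau> f x) = (LBINT x. f x)"
    and "(LBINT x. (polarize e \<tau> f x)\<^sup>2) = (LBINT x. (f x)\<^sup>2)"
proof -
  note L = L2_bounded_polarize[OF e f, of \<tau>]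
  show "(LBINT x. polarize e \<tau> f x) = (LBINT x. f x)"
    by (rule integral_eq_if_orbit_sum_eq[OF e L2_bounded_integrable[OF f] L2_bounded_integrable[OF L] polarize_sum[OF e]])
  show "(LBINT x. (polarize e \<tau> f x)\<^sup>2) = (LBINT x. (f x)\<^sup>2)"
  proof (rule integral_eq_if_orbit_sum_eq[OF e L2_bounded_square[OF f] L2_bounded_square[OF L]])
    fix x
    show "(polarize e \<tau> f x)\<^sup>2 + (polarize e \<tau> f (reflect e \<tau> x))\<^sup>2 = (f x)\<^sup>2 + (f (reflect e \<tau> x))\<^sup>2"
      using polarize_orbit_cases[OF e, of \<tau> f x] by auto
  qed
qed

lemma lborel_distr_pair:
  fixes f :: "'a::euclidean_space \<Rightarrow> 'a" and g :: "'b::euclidean_space \<Rightarrow> 'b"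
  assumes [measurable]: "f \<in> borel_measurable borel" "g \<in> borel_measurable borel"
    and "distr lborel borel f = lborel" "distr lborel borel g = lborel"
  shows "distr lborel borel (\<lambda>p. (f (fst p), g (snd p))) = lborel"
proof -
  have "sigma_finite_measure (distr lborel borel g)" unfolding assms(4) by (rule sigma_finite_lborel)
  then have "distr lborel borel f \<Otimes>\<^sub>M distr lborel borel g
     = distr (lborel \<Otimes>\<^sub>M lborel) (borel \<Otimes>\<^sub>M borel) (\<lambda>(x, y). (f x, g y))"
    by (intro pair_measure_distr) auto
  then show ?thesis
    unfolding assms(3,4) by (simp add: lborel_prod borel_prod case_prod_unfold)
qed

lemma integral_pair_map:
  fixes f :: "'a::euclidean_space \<Rightarrow> 'a" and g :: "'b::euclidean_space \<Rightarrow> 'b" and h :: "'a \<times> 'b \<Rightarrow> real"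
  assumes [measurable]: "f \<in> borel_measurable borel" "g \<in> borel_measurable borel"
    and d: "distr lborel borel f = lborel" "distr lborel borel g = lborel"
    and h: "integrable lborel h"
  shows "integrable lborel (\<lambda>p. h (f (fst p), g (snd p)))"
    and "(LBINT p. h (f (fst p), g (snd p))) = (LBINT p. h p)"
proof -
  have [measurable]: "h \<in> borel_measurable borel" using h by auto
  have m: "(\<lambda>p. (f (fst p), g (snd p))) \<in> lborel \<rightarrow>\<^sub>M borel"
    by (simp add: borel_prod[symmetric])
  note D = lborel_distr_pair[OF assms(1,2) d]
  show "integrable lborel (\<lambda>p. h (f (fst p), g (snd p)))"
    using h by (subst (asm) D[symmetric], subst (asm) integrable_distr_eq[OF m]) auto
  show "(LBINT p. h (f (fst p), g (snd p))) = (LBINT p. h p)"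
    by (subst (2) D[symmetric], subst integral_distr[OF m]) auto
qed

lemma gaussian_reflect_le:
  assumes e: "norm e = 1" and t: "t > 0"
  shows "\<tau> \<le> x \<bullet> e \<Longrightarrow> \<tau> \<le> y \<bullet> e \<Longrightarrow> gaussian t (reflect e \<tau> x - y) \<le> gaussian t (x - y)"
    and "\<tau> \<le> x \<bullet> e \<Longrightarrow> y \<bullet> e \<le> \<tau> \<Longrightarrow> gaussian t (x - y) \<le> gaussian t (reflect e \<tau> x - y)"
    and "\<tau> < x \<bullet> e \<Longrightarrow> \<tau> < y \<bullet> e \<Longrightarrow> gaussian t (reflect e \<tau> x - y) < gaussian t (x - y)"
proof -
  define Z where "Z = (x \<bullet> e - \<tau>) * (y \<bullet> e - \<tau>)"
  have Z: "(norm (reflect e \<tau> x - y))\<^sup>2 = (norm (x - y))\<^sup>2 + 4 * Z"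
    unfolding Z_def norm_reflect_diff_sq[OF e] by (simp only: mult.assoc)
  show "gaussian t (reflect e \<tau> x - y) \<le> gaussian t (x - y)" if "\<tau> \<le> x \<bullet> e" "\<tau> \<le> y \<bullet> e"
  proof -
    have "Z \<ge> 0" using that by (simp add: Z_def)
    then show ?thesis unfolding gaussian_le_iff[OF t] by - (rule power2_le_imp_le, simp_all add: Z)
  qed
  show "gaussian t (x - y) \<le> gaussian t (reflect e \<tau> x - y)" if "\<tau> \<le> x \<bullet> e" "y \<bullet> e \<le> \<tau>"
  proof -
    have "Z \<le> 0" using that by (simp add: Z_def mult_nonneg_nonpos)
    then show ?thesis unfolding gaussian_le_iff[OF t] by - (rule power2_le_imp_le, simp_all add: Z)
  qed
  show "gaussian t (reflect e \<tau> x - y) < gaussian t (x - y)" if "\<tau> < x \<bullet> e" "\<tau> < y \<bullet> e"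
  proof -
    have "Z > 0" using that by (simp add: Z_def)
    then show ?thesis unfolding gaussian_less_iff[OF t] by - (rule power2_less_imp_less, simp_all add: Z)
  qed
qed

text \<open>The four points \<open>(x, y)\<close>, \<open>(x', y)\<close>, \<open>(x, y')\<close>, \<open>(x', y')\<close> of an orbit contribute to
  the change of the Gaussian form a multiple of \<open>K(x - y) - K(x' - y)\<close>, whose sign tells whether \<open>x\<close> and
  \<open>y\<close> are on the same side of the axis.\<close>

lemma gauss_form_polarize:
  assumes e: "norm e = 1" and f: "L2_bounded f" and t: "t > 0"
  shows "gauss_form t f \<le> gauss_form t (polarize e \<tau> f)"
    and "gauss_form t (polarize e \<tau> f) = gauss_form t f \<Longrightarrow>
      AE x in lborel. AE y in lborel. \<tau> < x \<bullet> e \<longrightarrow> \<tau> < y \<bullet> e \<longrightarrow>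
        0 \<le> (f x - f (reflect e \<tau> x)) * (f y - f (reflect e \<tau> y))"
proof -
  note [measurable] = L2_bounded_measurable[OF f]
  let ?s = "reflect e \<tau>" and ?P = "polarize e \<tau> f" and ?K = "gaussian t"
  note LP = L2_bounded_polarize[OF e f, of \<tau>]
  let ?d = "\<lambda>x. f x - f (?s x)" and ?dP = "\<lambda>x. ?P x - ?P (?s x)"
  define D where "D = (\<lambda>p. (?P (fst p) * ?P (snd p) - f (fst p) * f (snd p)) * ?K (fst p - snd p))"
  have Di: "integrable lborel D"
    unfolding D_def left_diff_distrib
    by (intro Bochner_Integration.integrable_diff integrable_gauss_form LP f t)
  have Dint: "gauss_form t ?P - gauss_form t f = (LBINT p. D p)"
    unfolding D_def left_diff_distrib gauss_form_def
    by (subst Bochner_Integration.integral_diff) (auto intro: integrable_gauss_form LP f t)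
  \<comment> \<open>Reflecting the two variables independently preserves the measure on pairs, so
    \<open>\<Sigma>\<close> has four times the integral of \<open>D\<close>; its sign, unlike that
    of \<open>D\<close>, is definite.\<close>
  define \<Sigma> where "\<Sigma> = (\<lambda>p. D (id (fst p), id (snd p)) + D (?s (fst p), id (snd p)) + D (id (fst p), ?s (snd p)) + D (?s (fst p), ?s (snd p)))"
  have rm: "?s \<in> borel_measurable borel" "id \<in> borel_measurable (borel :: plane measure)" by auto
  have rd: "distr lborel borel ?s = lborel" "distr lborel borel id = (lborel :: plane measure)"
    using lborel_distr_reflect[OF e] by (auto simp: id_def distr_id2)
  note map = integral_pair_map[OF rm(2) rm(2) rd(2) rd(2) Di] integral_pair_map[OF rm(1) rm(2) rd(1) rd(2) Di]
     integral_pair_map[OF rm(2) rm(1) rd(2) rd(1) Di] integral_pair_map[OF rm(1) rm(1) rd(1) rd(1) Di]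
  have \<Sigma>i: "integrable lborel \<Sigma>" and \<Sigma>int: "(LBINT p. \<Sigma> p) = 4 * (LBINT p. D p)"
    unfolding \<Sigma>_def using map by simp_all
  have K: "?K (?s x - ?s y) = ?K (x - y)" "?K (x - ?s y) = ?K (?s x - y)" for x y
    using norm_reflect_reflect[OF e, of \<tau> x y] norm_reflect_reflect[OF e, of \<tau> x "?s y"] e
    by (simp_all add: gaussian_def)
  have \<Sigma>_eq: "\<Sigma> (x, y) = (?K (x - y) - ?K (?s x - y)) * (?dP x * ?dP y - ?d x * ?d y) / 2" for x y
  proof -
    \<comment> \<open>Split each pair of values into its mean and half its difference. The means are
      the same before and after polarization and the mixed products cancel, so only the products of
      the differences remain.\<close>
    have alg: "(P * Q - p * q) * a + (P' * Q - p' * q) * b + (P * Q' - p * q') * b + (P' * Q' - p' * q') * a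
       = (a - b) * ((P - P') * (Q - Q') - (p - p') * (q - q')) / 2"
      if "P + P' = p + p'" "Q + Q' = q + q'" for a b p p' q q' P P' Q Q' :: real
    proof -
      have P': "P' = p + p' - P" "Q' = q + q' - Q" using that by simp_all
      show ?thesis unfolding P' by (simp add: field_simps)
    qed
    show ?thesis
      unfolding \<Sigma>_def D_def id_def fst_conv snd_conv K(1) K(2)[of x y]
      by (rule alg[OF polarize_sum[OF e] polarize_sum[OF e]])
  qed
  have Kle: "?K (?s x - y) \<le> ?K (x - y) \<longleftrightarrow> 0 \<le> (x \<bullet> e - \<tau>) * (y \<bullet> e - \<tau>)" for x y
  proof -
    define Z where "Z = (x \<bullet> e - \<tau>) * (y \<bullet> e - \<tau>)"
    have "norm (x - y) \<le> norm (?s x - y) \<longleftrightarrow> (norm (x - y))\<^sup>2 \<le> (norm (?s x - y))\<^sup>2"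
      by (simp add: power_mono_iff)
    also have "(norm (?s x - y))\<^sup>2 = (norm (x - y))\<^sup>2 + 4 * Z"
      unfolding Z_def norm_reflect_diff_sq[OF e] by (simp only: mult.assoc)
    finally show ?thesis unfolding gaussian_le_iff[OF t] Z_def[symmetric] by simp
  qed
  have \<Sigma>_nonneg: "0 \<le> \<Sigma> (x, y)" for x y
  proof -
    consider "x \<bullet> e = \<tau> \<or> y \<bullet> e = \<tau>" | "\<tau> < x \<bullet> e" "\<tau> < y \<bullet> e" | "\<tau> < x \<bullet> e" "y \<bullet> e < \<tau>"
      | "x \<bullet> e < \<tau>" "\<tau> < y \<bullet> e" | "x \<bullet> e < \<tau>" "y \<bullet> e < \<tau>" by linarith
    then have "0 \<le> (?K (x - y) - ?K (?s x - y)) * (?dP x * ?dP y - ?d x * ?d y)"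
    proof cases
      case 1 then show ?thesis by (auto simp: reflect_eq)
    next
      case 2
      then have "0 \<le> (x \<bullet> e - \<tau>) * (y \<bullet> e - \<tau>)" by (intro mult_nonneg_nonneg) auto
      then show ?thesis
        using 2 Kle[of x y] abs_ge_self[of "?d x * ?d y"]
        by (intro mult_nonneg_nonneg) (auto simp: polarize_diff[OF e] abs_mult)
    next
      case 3
      then have "\<not> 0 \<le> (x \<bullet> e - \<tau>) * (y \<bullet> e - \<tau>)" by (auto simp: not_le intro: mult_pos_neg)
      then show ?thesis
        using 3 Kle[of x y] abs_ge_minus_self[of "?d x * ?d y"]
        by (intro mult_nonpos_nonpos) (auto simp: polarize_diff[OF e] abs_mult)
    next
      case 4
      then have "\<not> 0 \<le> (x \<bullet> e - \<tau>) * (y \<bullet> e - \<tau>)" by (auto simp: not_le intro: mult_neg_pos)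
      then show ?thesis
        using 4 Kle[of x y] abs_ge_minus_self[of "?d x * ?d y"]
        by (intro mult_nonpos_nonpos) (auto simp: polarize_diff[OF e] abs_mult)
    next
      case 5
      then have "0 \<le> (x \<bullet> e - \<tau>) * (y \<bullet> e - \<tau>)" by (intro mult_nonpos_nonpos) auto
      then show ?thesis
        using 5 Kle[of x y] abs_ge_self[of "?d x * ?d y"]
        by (intro mult_nonneg_nonneg) (auto simp: polarize_diff[OF e] abs_mult)
    qed
    then show ?thesis by (simp add: \<Sigma>_eq)
  qed
  then have \<Sigma>0: "0 \<le> \<Sigma> p" for p by (cases p) auto
  then have "0 \<le> (LBINT p. \<Sigma> p)" by (intro integral_nonneg_AE) auto
  then show "gauss_form t f \<le> gauss_form t ?P" using Dint \<Sigma>int by simp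
  assume "gauss_form t ?P = gauss_form t f"
  then have "(LBINT p. \<Sigma> p) = 0" using Dint \<Sigma>int by simp
  then have "AE p in lborel. \<Sigma> p = 0"
    using integral_nonneg_eq_0_iff_AE[OF \<Sigma>i] \<Sigma>0 by simp
  then have "AE p in lborel \<Otimes>\<^sub>M lborel. \<Sigma> p = 0" by (simp only: lborel_prod)
  then have "AE x in lborel. AE y in lborel. \<Sigma> (x, y) = 0" by (rule lborel_pair.AE_pair)
  then show "AE x in lborel. AE y in lborel. \<tau> < x \<bullet> e \<longrightarrow> \<tau> < y \<bullet> e \<longrightarrow> 0 \<le> ?d x * ?d y"
  proof eventually_elim
    case (elim x)
    then show ?case
    proof eventually_elim
      case (elim y)
      show ?case
      proof (intro impI)
        assume xy: "\<tau> < x \<bullet> e" "\<tau> < y \<bullet> e"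
        have "?K (x - y) - ?K (?s x - y) > 0" using gaussian_reflect_le(3)[OF e t xy] by simp
        \<comment> \<open>On the favoured side the polarized differences are absolute values, so
          this equation says that the product of the two differences equals its own absolute
          value.\<close>
        then have "?dP x * ?dP y - ?d x * ?d y = 0" using elim by (simp add: \<Sigma>_eq)
        then show "0 \<le> ?d x * ?d y"
          using xy by (simp add: polarize_diff[OF e]) (metis abs_ge_zero mult_nonneg_nonneg)
      qed
    qed
  qed
qed

text \<open>Made so that its indicator is the polarization of the indicator of
  \<open>\<Omega>\<close>, see \<open>indicator_polarize_set\<close>.\<close>

definition polarize_set :: "plane \<Rightarrow> real \<Rightarrow> plane set \<Rightarrow> plane set" where
  "polarize_set e \<tau> \<Omega> = {x. if \<tau> < x \<bullet> e then x \<in> \<Omega> \<or> reflect e \<tau> x \<in> \<Omega> else x \<in> \<Omega> \<and> reflect e \<tau> x \<in> \<Omega>}"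

lemma open_polarize_set:
  assumes "open \<Omega>" shows "open (polarize_set e \<tau> \<Omega>)"
proof -
  \<comment> \<open>The intersection may be taken without restriction to a half plane, since on the
    favoured side it is contained in the union. This exhibits the set as built from open
    sets.\<close>
  have "polarize_set e \<tau> \<Omega> = (\<Omega> \<union> reflect e \<tau> -` \<Omega>) \<inter> {x. \<tau> < x \<bullet> e} \<union> (\<Omega> \<inter> reflect e \<tau> -` \<Omega>)"
    by (auto simp: polarize_set_def)
  moreover have "open (reflect e \<tau> -` \<Omega>)"
    using assms by (intro open_vimage continuous_intros) auto
  moreover have "open {x. \<tau> < x \<bullet> e}" by (intro open_Collect_less continuous_intros)
  ultimately show ?thesis using assms by auto
qed

lemma bounded_polarize_set:
  assumes e: "norm e = 1" and b: "bounded \<Omega>" shows "bounded (polarize_set e \<tau> \<Omega>)"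
proof -
  obtain R where R: "\<And>x. x \<in> \<Omega> \<Longrightarrow> norm x \<le> R" using b by (auto simp: bounded_iff)
  have "norm x \<le> R + norm (reflect e \<tau> 0)" if "x \<in> polarize_set e \<tau> \<Omega>" for x
  proof (cases "x \<in> \<Omega>")
    case False
    then have "reflect e \<tau> x \<in> \<Omega>" using that by (auto simp: polarize_set_def split: if_splits)
    moreover have "norm x = norm (reflect e \<tau> x - reflect e \<tau> 0)" using norm_reflect_reflect[OF e, of \<tau> x 0] by simp
    moreover have "\<dots> \<le> norm (reflect e \<tau> x) + norm (reflect e \<tau> 0)" by (rule norm_triangle_ineq4)
    ultimately show ?thesis using R by fastforce
  qed (use R in \<open>auto intro: order_trans[OF _ le_add_same_cancel1[THEN iffD2]]\<close>)
  then show ?thesis by (auto simp: bounded_iff)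
qed

lemma indicator_polarize_set:
  "indicator (polarize_set e \<tau> \<Omega>) x = polarize e \<tau> (indicator \<Omega>) x"
  by (auto simp: polarize_set_def polarize_def indicator_def)

lemma emeasure_polarize_set:
  assumes e: "norm e = 1" and b: "bounded \<Omega>" and o: "open \<Omega>"
  shows "emeasure lebesgue (polarize_set e \<tau> \<Omega>) = emeasure lebesgue \<Omega>"
proof -
  obtain R where R: "\<And>x. x \<in> \<Omega> \<Longrightarrow> norm x \<le> R" using b by (auto simp: bounded_iff)
  have [measurable]: "\<Omega> \<in> sets borel" "polarize_set e \<tau> \<Omega> \<in> sets borel" using o open_polarize_set[OF o] by auto
  have "L2_bounded (indicator \<Omega>)"
    by (rule L2_bounded_bounded[where R=R and B=1]) (use R in \<open>force simp: indicator_def\<close>)+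
  from integral_polarize(1)[OF e this, of \<tau>]
  have "(LBINT x. indicator (polarize_set e \<tau> \<Omega>) x) = (LBINT x. indicator \<Omega> x :: real)"
    by (simp add: indicator_polarize_set)
  then have "measure lborel (polarize_set e \<tau> \<Omega>) = measure lborel \<Omega>" by simp
  moreover have "emeasure lborel (polarize_set e \<tau> \<Omega>) < \<infinity>" "emeasure lborel \<Omega> < \<infinity>"
    by (intro emeasure_bounded_finite bounded_polarize_set e b)+
  ultimately have "emeasure lborel (polarize_set e \<tau> \<Omega>) = emeasure lborel \<Omega>"
    by (simp add: emeasure_eq_ennreal_measure)
  then show ?thesis by simp
qed

text \<open>Nonnegativity makes the minimum 0 as soon as one of the two orbit points is outside
  \<open>\<Omega>\<close>.\<close>

lemma supported_in_polarize:
  assumes "supported_in f \<Omega>" "\<And>x. 0 \<le> f x"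
  shows "supported_in (polarize e \<tau> f) (polarize_set e \<tau> \<Omega>)"
  using assms unfolding supported_in_def polarize_def polarize_set_def
  by (auto simp: max_def min_def split: if_splits) (metis order.antisym)+

section \<open>Radial monotonicity of polarization-invariant functions\<close>

text \<open>A continuous stand-in for \<open>f\<close>, for which maximum points exist and
  reflection inequalities valid almost everywhere for \<open>f\<close> hold at every point.\<close>

definition heat :: "real \<Rightarrow> (plane \<Rightarrow> real) \<Rightarrow> plane \<Rightarrow> real" where
  "heat t f x = (LBINT y. f y * gaussian t (x - y))"

lemma integrable_heat:
  assumes f: "L2_bounded f" and t: "t > 0"
  shows "integrable lborel (\<lambda>y. f y * gaussian t (x - y))"
proof -
  note [measurable] = L2_bounded_measurable[OF f]
  have "integrable lborel (\<lambda>y. f y * (1 / (4 * pi * t)))"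
    using L2_bounded_integrable[OF f] by (rule integrable_mult_left)
  then show ?thesis
  proof (rule Bochner_Integration.integrable_bound)
    show "AE y in lborel. norm (f y * gaussian t (x - y)) \<le> norm (f y * (1 / (4 * pi * t)))"
      unfolding norm_mult using gaussian_pos[OF t] gaussian_le[OF t] t
      by (intro AE_I2 mult_left_mono) (auto simp: less_imp_le abs_of_pos)
  qed measurable
qed

lemma heat_nonneg: "t > 0 \<Longrightarrow> (\<And>x. 0 \<le> f x) \<Longrightarrow> 0 \<le> heat t f x"
  unfolding heat_def by (intro integral_nonneg_AE AE_I2 mult_nonneg_nonneg less_imp_le[OF gaussian_pos]) auto

lemma continuous_on_heat:
  assumes f: "L2_bounded f" and t: "t > 0"
  shows "continuous_on S (heat t f)"
proof -
  note [measurable] = L2_bounded_measurable[OF f]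
  have "isCont (heat t f) x" for x
    unfolding continuous_at_sequentially
  proof (intro allI impI)
    fix X :: "nat \<Rightarrow> plane" assume X: "X \<longlonglongrightarrow> x"
    have "(\<lambda>n. LBINT y. f y * gaussian t (X n - y)) \<longlonglongrightarrow> (LBINT y. f y * gaussian t (x - y))"
    proof (rule integral_dominated_convergence[where w="\<lambda>y. \<bar>f y\<bar> * (1 / (4 * pi * t))"])
      show "integrable lborel (\<lambda>y. \<bar>f y\<bar> * (1 / (4 * pi * t)))"
        using L2_bounded_integrable[OF f] by (intro integrable_mult_left integrable_abs)
      show "AE y in lborel. (\<lambda>n. f y * gaussian t (X n - y)) \<longlonglongrightarrow> f y * gaussian t (x - y)"
        using continuous_on_gaussian[of UNIV t]
        by (intro AE_I2 tendsto_intros isCont_tendsto_compose[of _ "gaussian t"] X) (auto simp: continuous_on_eq_continuous_at)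
      show "AE y in lborel. norm (f y * gaussian t (X n - y)) \<le> \<bar>f y\<bar> * (1 / (4 * pi * t))" for n
        unfolding norm_mult using gaussian_pos[OF t] gaussian_le[OF t] t
        by (intro AE_I2 mult_mono) (auto simp: less_imp_le abs_of_pos)
    qed measurable
    then show "(heat t f \<circ> X) \<longlonglongrightarrow> heat t f x" by (simp add: heat_def comp_def)
  qed
  then show ?thesis by (simp add: continuous_at_imp_continuous_on)
qed

text \<open>The integrand is averaged over \<open>y\<close> and its reflection, which leaves a
  product of one difference of \<open>f\<close> and one difference of the kernel.\<close>

lemma heat_diff_reflect:
  fixes \<tau> :: real
  assumes e: "norm e = 1" and f: "L2_bounded f" and t: "t > 0"
  defines "s \<equiv> reflect e \<tau>"
  shows "integrable lborel (\<lambda>y. (f y - f (s y)) * (gaussian t (x - y) - gaussian t (s x - y)))"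
    and "heat t f x - heat t f (s x) = (LBINT y. (f y - f (s y)) * (gaussian t (x - y) - gaussian t (s x - y))) / 2"
proof -
  note [measurable] = L2_bounded_measurable[OF f]
  let ?h = "\<lambda>y. f y * gaussian t (x - y) - f y * gaussian t (s x - y)"
  have i: "integrable lborel ?h"
    by (intro Bochner_Integration.integrable_diff integrable_heat f t)
  have i': "integrable lborel (\<lambda>y. ?h (s y))" unfolding s_def by (rule integrable_reflect[OF e i[unfolded s_def]])
  have K: "gaussian t (x - s y) = gaussian t (s x - y)" "gaussian t (s x - s y) = gaussian t (x - y)" for y
    using norm_reflect_reflect[OF e, of \<tau> x y] norm_reflect_reflect[OF e, of \<tau> x "s y"] e
    by (simp_all add: gaussian_def s_def)
  have eq: "?h y + ?h (s y) = (f y - f (s y)) * (gaussian t (x - y) - gaussian t (s x - y))" for y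
    unfolding K by (simp add: algebra_simps)
  show "integrable lborel (\<lambda>y. (f y - f (s y)) * (gaussian t (x - y) - gaussian t (s x - y)))"
    unfolding eq[symmetric] using i i' by simp
  have "(LBINT y. ?h (s y)) = (LBINT y. ?h y)"
    unfolding s_def by (rule integral_reflect[OF e]) measurable
  moreover have "(LBINT y. ?h y) = heat t f x - heat t f (s x)"
    unfolding heat_def by (rule Bochner_Integration.integral_diff; rule integrable_heat[OF f t])
  ultimately show "heat t f x - heat t f (s x) = (LBINT y. (f y - f (s y)) * (gaussian t (x - y) - gaussian t (s x - y))) / 2"
    unfolding eq[symmetric] using i i' by simp
qed

text \<open>Both factors change sign when \<open>y\<close> is reflected, so the ordering on the
  favoured side decides the sign on both sides of the axis.\<close>

lemma heat_integrand_nonneg: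
  assumes e: "norm e = 1" and f: "L2_bounded f" and t: "t > 0" and x: "\<tau> \<le> x \<bullet> e"
    and ge: "AE y in lborel. \<tau> < y \<bullet> e \<longrightarrow> f (reflect e \<tau> y) \<le> f y"
  shows "AE y in lborel. 0 \<le> (f y - f (reflect e \<tau> y)) * (gaussian t (x - y) - gaussian t (reflect e \<tau> x - y))"
proof -
  note [measurable] = L2_bounded_measurable[OF f]
  have "AE y in lborel. \<tau> < reflect e \<tau> y \<bullet> e \<longrightarrow> f (reflect e \<tau> (reflect e \<tau> y)) \<le> f (reflect e \<tau> y)"
    by (rule AE_reflect[OF e _ ge]) measurable
  with ge show ?thesis
  proof eventually_elim
    case (elim y)
    show ?case
    proof (cases "y \<bullet> e" \<tau> rule: linorder_cases)
      case less
      then show ?thesis using elim(2) gaussian_reflect_le(2)[OF e t x, of y] e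
        by (intro mult_nonpos_nonpos) (auto simp: inner_reflect)
    next
      case greater
      then show ?thesis using elim(1) gaussian_reflect_le(1)[OF e t x, of y] by (intro mult_nonneg_nonneg) auto
    qed (simp add: reflect_eq)
  qed
qed

lemma heat_reflect_le:
  assumes e: "norm e = 1" and f: "L2_bounded f" and t: "t > 0" and x: "\<tau> \<le> x \<bullet> e"
    and ge: "AE y in lborel. \<tau> < y \<bullet> e \<longrightarrow> f (reflect e \<tau> y) \<le> f y"
  shows "heat t f (reflect e \<tau> x) \<le> heat t f x"
  using heat_diff_reflect(2)[OF e f t, where x=x and \<tau>=\<tau>] integral_nonneg_AE[OF heat_integrand_nonneg[OF assms]] by simp

text \<open>For \<open>- f\<close> the integrand of \<open>heat_diff_reflect\<close> is nonnegative.
  Without strict inequality it would vanish almost everywhere; the kernel difference is nonzero on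
  the open half plane, so \<open>f\<close> would agree there with its reflection.\<close>

lemma heat_reflect_less:
  assumes e: "norm e = 1" and f: "L2_bounded f" and t: "t > 0" and x: "\<tau> < x \<bullet> e"
    and le: "AE y in lborel. \<tau> < y \<bullet> e \<longrightarrow> f y \<le> f (reflect e \<tau> y)"
    and ne: "\<not> (AE y in lborel. \<tau> < y \<bullet> e \<longrightarrow> f (reflect e \<tau> y) \<le> f y)"
  shows "heat t f x < heat t f (reflect e \<tau> x)"
proof (rule ccontr)
  assume "\<not> heat t f x < heat t f (reflect e \<tau> x)"
  then have ge: "heat t f (reflect e \<tau> x) \<le> heat t f x" by simp
  let ?g = "\<lambda>y. (- f y - - f (reflect e \<tau> y)) * (gaussian t (x - y) - gaussian t (reflect e \<tau> x - y))"
  have mf: "L2_bounded (\<lambda>x. - f x)" using L2_bounded_cmult[OF f, of "-1"] by simp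
  have h: "heat t (\<lambda>x. - f x) y = - heat t f y" for y by (simp add: heat_def)
  have nn: "AE y in lborel. 0 \<le> ?g y"
    by (rule heat_integrand_nonneg[OF e mf t less_imp_le[OF x]]) (use le in simp)
  have "(LBINT y. ?g y) \<le> 0"
    using heat_diff_reflect(2)[OF e mf t, where x=x and \<tau>=\<tau>] ge by (simp add: h)
  moreover have "(LBINT y. ?g y) \<ge> 0" using nn by (rule integral_nonneg_AE)
  ultimately have "AE y in lborel. ?g y = 0"
    using integral_nonneg_eq_0_iff_AE[OF heat_diff_reflect(1)[OF e mf t, where x=x and \<tau>=\<tau>] nn] by linarith
  then have "AE y in lborel. \<tau> < y \<bullet> e \<longrightarrow> f (reflect e \<tau> y) \<le> f y"
  proof eventually_elim
    case (elim y)
    show ?case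
    proof
      assume "\<tau> < y \<bullet> e"
      then show "f (reflect e \<tau> y) \<le> f y" using elim gaussian_reflect_le(3)[OF e t x, of y] by auto
    qed
  qed
  then show False using ne by simp
qed

text \<open>Unless the evolution vanishes identically, Gaussian decay keeps it below one of its
  positive values outside a large ball, so a maximum over a compact ball is global.\<close>

lemma heat_attains_max:
  assumes f: "L2_bounded f" and nn: "\<And>x. 0 \<le> f x"
  shows "\<exists>c. \<forall>x. heat 1 f x \<le> heat 1 f c"
proof (cases "\<exists>x0. heat 1 f x0 > 0")
  case False
  then have "heat 1 f x \<le> heat 1 f 0" for x using heat_nonneg[of 1 f 0] nn by (metis le_less_linear order_trans zero_less_one)
  then show ?thesis by blast
next
  case True
  then obtain x0 where x0: "heat 1 f x0 > 0" by blast
  obtain \<rho> where \<rho>: "\<And>x. norm x > \<rho> \<Longrightarrow> f x = 0" using f by (auto simp: L2_bounded_def)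
  define M where "M = (LBINT x. f x)"
  have M0: "M \<ge> 0" unfolding M_def using nn by (intro integral_nonneg_AE) auto
  \<comment> \<open>At distance at least \<open>s\<close> from the support,
    \<open>exp z \<ge> 1 + z\<close> bounds the kernel by \<open>1 / (q + 2)\<close>, because
    \<open>s\<^sup>2 / 4\<close> is at least \<open>q + 1\<close>. The resulting bound
    \<open>M / (q + 2)\<close> is below \<open>heat 1 f x0\<close>, since \<open>M\<close> is
    \<open>q\<close> times that value.\<close>
  define q where "q = M / heat 1 f x0"
  have q: "q \<ge> 0" using M0 x0 by (simp add: q_def)
  define s where "s = 2 * (q + 1)"
  have small: "heat 1 f x < heat 1 f x0" if x: "norm x > \<rho> + s" for x
  proof -
    have "f y * gaussian 1 (x - y) \<le> f y * (1 / (1 + (q + 1)))" for y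
    proof (cases "norm y > \<rho>")
      case False
      then have "s \<le> norm (x - y)" using x norm_triangle_ineq2[of x y] by simp
      then have "s\<^sup>2 \<le> (norm (x - y))\<^sup>2" using q by (intro power_mono) (auto simp: s_def)
      moreover have "s\<^sup>2 = 4 * (q + 1)\<^sup>2" by (simp add: s_def power2_eq_square algebra_simps)
      moreover have "q + 1 \<le> (q + 1)\<^sup>2" using q by (simp add: power2_eq_square)
      ultimately have a: "q + 1 \<le> (norm (x - y))\<^sup>2 / 4" by simp
      have "gaussian 1 (x - y) \<le> exp (- (norm (x - y))\<^sup>2 / 4) / 1"
        unfolding gaussian_def using pi_gt3 by (intro frac_le) auto
      also have "\<dots> = 1 / exp ((norm (x - y))\<^sup>2 / 4)" by (simp add: exp_minus inverse_eq_divide)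
      also have "\<dots> \<le> 1 / (1 + (q + 1))"
      proof -
        have "1 + (q + 1) \<le> exp ((norm (x - y))\<^sup>2 / 4)"
          using a exp_ge_add_one_self[of "(norm (x - y))\<^sup>2 / 4"] by linarith
        then show ?thesis using q by (intro divide_left_mono) (auto intro!: mult_pos_pos)
      qed
      finally show ?thesis using nn by (intro mult_left_mono) auto
    qed (simp add: \<rho>)
    then have "heat 1 f x \<le> (LBINT y. f y * (1 / (1 + (q + 1))))"
      unfolding heat_def using integrable_heat[OF f, of 1 x] L2_bounded_integrable[OF f]
      by (intro integral_mono integrable_mult_left) auto
    also have "\<dots> = M / (1 + (q + 1))" by (simp add: M_def)
    also have "\<dots> < heat 1 f x0"
    proof -
      have "M = q * heat 1 f x0" using x0 by (simp add: q_def)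
      also have "\<dots> < (1 + (q + 1)) * heat 1 f x0" using x0 by (intro mult_strict_right_mono) auto
      finally show ?thesis using q by (simp add: pos_divide_less_eq mult.commute)
    qed
    finally show ?thesis .
  qed
  have "\<exists>c\<in>cball 0 (max (\<rho> + s) (norm x0)). \<forall>x\<in>cball 0 (max (\<rho> + s) (norm x0)). heat 1 f x \<le> heat 1 f c"
  proof (rule continuous_attains_sup)
    show "cball 0 (max (\<rho> + s) (norm x0)) \<noteq> ({} :: plane set)"
      by (auto simp: le_max_iff_disj)
  qed (auto intro: continuous_on_heat f)
  then obtain c where "\<forall>x\<in>cball 0 (max (\<rho> + s) (norm x0)). heat 1 f x \<le> heat 1 f c" by blast
  then have c: "\<And>x. norm x \<le> max (\<rho> + s) (norm x0) \<Longrightarrow> heat 1 f x \<le> heat 1 f c" by auto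
  have "heat 1 f x \<le> heat 1 f c" for x
  proof (cases "norm x \<le> max (\<rho> + s) (norm x0)")
    case False
    then have "heat 1 f x < heat 1 f x0" by (intro small) auto
    also have "\<dots> \<le> heat 1 f c" by (intro c) auto
    finally show ?thesis by simp
  qed (rule c)
  then show ?thesis by blast
qed

text \<open>On a half plane where \<open>f\<close> does not dominate its reflection, the reflection dominates \<open>f\<close>, and then
  the heat evolution is larger at the reflected points. So a maximum point of the evolution is the center.\<close>

lemma symmetric_center:
  assumes f: "L2_bounded f" and nn: "\<And>x. 0 \<le> f x"
    and orbit: "\<And>e \<tau>. norm e = 1 \<Longrightarrow> AE x in lborel. AE y in lborel. \<tau> < x \<bullet> e \<longrightarrow> \<tau> < y \<bullet> e \<longrightarrow>
        0 \<le> (f x - f (reflect e \<tau> x)) * (f y - f (reflect e \<tau> y))"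
  shows "\<exists>c. \<forall>e \<tau>. norm e = 1 \<longrightarrow> \<tau> < c \<bullet> e \<longrightarrow>
    (AE y in lborel. \<tau> < y \<bullet> e \<longrightarrow> f (reflect e \<tau> y) \<le> f y)"
proof -
  obtain c where c: "\<And>x. heat 1 f x \<le> heat 1 f c" using heat_attains_max[OF f nn] by blast
  have "AE y in lborel. \<tau> < y \<bullet> e \<longrightarrow> f (reflect e \<tau> y) \<le> f y" if e: "norm e = 1" and ce: "\<tau> < c \<bullet> e" for e \<tau>
  proof (rule ccontr)
    assume ne: "\<not> (AE y in lborel. \<tau> < y \<bullet> e \<longrightarrow> f (reflect e \<tau> y) \<le> f y)"
    \<comment> \<open>A single point at which the reflected value is strictly larger, and whose
      orbit inequality holds for almost every \<open>y\<close>, fixes the sign of the difference on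
      the whole half plane. Failure of the claim guarantees such a point.\<close>
    have "\<exists>x. (AE y in lborel. \<tau> < x \<bullet> e \<longrightarrow> \<tau> < y \<bullet> e \<longrightarrow> 0 \<le> (f x - f (reflect e \<tau> x)) * (f y - f (reflect e \<tau> y)))
        \<and> \<tau> < x \<bullet> e \<and> f x < f (reflect e \<tau> x)"
    proof (rule ccontr)
      assume no: "\<not> ?thesis"
      from orbit[OF e, of \<tau>] have "AE x in lborel. \<tau> < x \<bullet> e \<longrightarrow> f (reflect e \<tau> x) \<le> f x"
        by eventually_elim (use no not_less in blast)
      then show False using ne by simp
    qed
    then obtain x where x: "AE y in lborel. \<tau> < x \<bullet> e \<longrightarrow> \<tau> < y \<bullet> e \<longrightarrow> 0 \<le> (f x - f (reflect e \<tau> x)) * (f y - f (reflect e \<tau> y))"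
      "\<tau> < x \<bullet> e" "f x < f (reflect e \<tau> x)" by blast
    have "AE y in lborel. \<tau> < y \<bullet> e \<longrightarrow> f y \<le> f (reflect e \<tau> y)"
      using x(1)
    proof eventually_elim
      case (elim y)
      then show ?case using x(2,3) by (auto simp: zero_le_mult_iff)
    qed
    then have "heat 1 f c < heat 1 f (reflect e \<tau> c)"
      by (intro heat_reflect_less[OF e f _ ce _ ne]) auto
    then show False using c[of "reflect e \<tau> c"] by simp
  qed
  then show ?thesis by blast
qed

text \<open>The point \<open>c\<close> lies on the same side of the perpendicular bisector of
  \<open>x\<close> and \<open>y\<close> as the nearer point \<open>y\<close>, so the hypothesis
  applies to the reflection that exchanges the two.\<close>

lemma heat_radially_decreasing:
  assumes f: "L2_bounded f" and t: "t > 0"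
    and c: "\<And>e \<tau>. norm e = 1 \<Longrightarrow> \<tau> < c \<bullet> e \<Longrightarrow> AE y in lborel. \<tau> < y \<bullet> e \<longrightarrow> f (reflect e \<tau> y) \<le> f y"
    and xy: "norm (y - c) < norm (x - c)"
  shows "heat t f x \<le> heat t f y"
proof -
  have ne: "y \<noteq> x" using xy by auto
  define e where "e = (y - x) /\<^sub>R norm (y - x)"
  define \<tau> where "\<tau> = ((y + x) /\<^sub>R 2) \<bullet> e"
  note sw = reflect_swap[OF ne, folded e_def, folded \<tau>_def]
  have p: "norm (y - x) > 0" using ne by simp
  have in_e: "z \<bullet> e = (z \<bullet> (y - x)) / norm (y - x)" for z
    by (simp add: e_def divide_inverse mult.commute)
  have "(norm (y - c))\<^sup>2 < (norm (x - c))\<^sup>2" using xy by (intro power_strict_mono) auto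
  then have "((y + x) /\<^sub>R 2) \<bullet> (y - x) < c \<bullet> (y - x)"
    unfolding power2_norm_eq_inner by (simp add: inner_diff_left inner_diff_right inner_add_left inner_add_right inner_commute)
  then have 1: "\<tau> < c \<bullet> e" unfolding \<tau>_def in_e using p by (simp only: divide_less_cancel) simp
  have "0 \<le> (y - x) \<bullet> (y - x)" by simp
  then have "((y + x) /\<^sub>R 2) \<bullet> (y - x) \<le> y \<bullet> (y - x)"
    by (simp add: inner_diff_left inner_diff_right inner_add_left inner_add_right inner_commute del: inner_ge_zero)
  then have 2: "\<tau> \<le> y \<bullet> e" unfolding \<tau>_def in_e using p by (simp only: divide_le_cancel) simp
  show ?thesis using heat_reflect_le[OF sw(1) f t 2 c[OF sw(1) 1]] sw(2) by simp
qed

text \<open>The symmetric bilinear form is recovered from the quadratic one. Its short-time limit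
  then follows from \<open>gauss_form_tendsto\<close>, without any convergence statement for
  \<open>heat\<close> itself.\<close>

lemma integral_mult_heat:
  assumes f: "L2_bounded f" and g: "L2_bounded g" and t: "t > 0"
  shows "integrable lborel (\<lambda>x. g x * heat t f x)"
    and "(LBINT x. g x * heat t f x) = (gauss_form t (\<lambda>x. f x + g x) - gauss_form t f - gauss_form t g) / 2"
proof -
  note i = integrable_gauss_form[OF _ _ t]
  have gf: "(LBINT x. g x * heat t f x) = (LBINT p. g (fst p) * f (snd p) * gaussian t (fst p - snd p))"
    unfolding integral_lborel_pair(1)[OF i[OF g f]] by (simp add: heat_def mult.assoc)
  have fg: "(LBINT x. g x * heat t f x) = (LBINT p. f (fst p) * g (snd p) * gaussian t (fst p - snd p))"
  proof -
    have "(LBINT x. f x * g y * gaussian t (x - y)) = g y * heat t f y" for y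
    proof -
      have "(LBINT x. f x * g y * gaussian t (x - y)) = (LBINT x. g y * (f x * gaussian t (y - x)))"
        by (simp add: gaussian_swap[of t _ y] mult_ac)
      then show ?thesis by (simp add: heat_def)
    qed
    then show ?thesis unfolding integral_lborel_pair(2)[OF i[OF f g]] by simp
  qed
  have "integrable (lborel \<Otimes>\<^sub>M lborel) (\<lambda>(x, y). g x * f y * gaussian t (x - y))"
    using i[OF g f] by (simp add: lborel_prod case_prod_unfold)
  from lborel_pair.integrable_fst'[OF this] show "integrable lborel (\<lambda>x. g x * heat t f x)"
    by (simp add: heat_def mult.assoc)
  have "gauss_form t (\<lambda>x. f x + g x) = (LBINT p. f (fst p) * f (snd p) * gaussian t (fst p - snd p)
     + g (fst p) * f (snd p) * gaussian t (fst p - snd p) + f (fst p) * g (snd p) * gaussian t (fst p - snd p)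
     + g (fst p) * g (snd p) * gaussian t (fst p - snd p))"
    unfolding gauss_form_def by (rule Bochner_Integration.integral_cong) (auto simp: algebra_simps)
  also have "\<dots> = gauss_form t f + (LBINT x. g x * heat t f x) + (LBINT x. g x * heat t f x) + gauss_form t g"
    unfolding gauss_form_def using i[OF f f] i[OF g f] i[OF f g] i[OF g g] by (simp add: gf) (simp add: fg[symmetric] gf[symmetric])
  finally show "(LBINT x. g x * heat t f x) = (gauss_form t (\<lambda>x. f x + g x) - gauss_form t f - gauss_form t g) / 2"
    by simp
qed

lemma integral_mult_heat_tendsto:
  assumes f: "L2_bounded f" and g: "L2_bounded g"
  shows "(\<lambda>n. LBINT x. g x * heat (1 / real (Suc n)) f x) \<longlonglongrightarrow> (LBINT x. g x * f x)"
proof -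
  note fg = L2_bounded_add[OF f g]
  have eq: "(LBINT x. g x * heat (1 / real (Suc n)) f x) = (gauss_form (1 / real (Suc n)) (\<lambda>x. f x + g x)
     - gauss_form (1 / real (Suc n)) f - gauss_form (1 / real (Suc n)) g) / 2" for n
    by (rule integral_mult_heat(2)[OF f g]) simp
  have "(LBINT x. (f x + g x)\<^sup>2) = (LBINT x. (f x)\<^sup>2 + (g x)\<^sup>2 + 2 * (g x * f x))"
    by (simp add: power2_sum mult_ac)
  also have "\<dots> = (LBINT x. (f x)\<^sup>2) + (LBINT x. (g x)\<^sup>2) + 2 * (LBINT x. g x * f x)"
    using L2_bounded_square[OF f] L2_bounded_square[OF g] L2_bounded_mult[OF g f] by simp
  finally have lim: "((LBINT x. (f x + g x)\<^sup>2) - (LBINT x. (f x)\<^sup>2) - (LBINT x. (g x)\<^sup>2)) / 2 = (LBINT x. g x * f x)"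
    by simp
  show ?thesis unfolding eq lim[symmetric]
    by (intro tendsto_intros gauss_form_tendsto fg f g) auto
qed

text \<open>A bathtub argument. The evolution is at least as large on the disc \<open>B\<close> as
  off it, and \<open>S - B\<close> has no more measure than \<open>B - S\<close>, so the evolution
  has no larger integral over \<open>S - B\<close> than over \<open>B - S\<close>. For small times
  these become integrals of \<open>f\<close>, and \<open>f\<close> vanishes on
  \<open>B - S\<close>.\<close>

lemma supported_in_disc:
  assumes f: "L2_bounded f" and nn: "\<And>x. 0 \<le> f x"
    and c: "\<And>e \<tau>. norm e = 1 \<Longrightarrow> \<tau> < c \<bullet> e \<Longrightarrow> AE y in lborel. \<tau> < y \<bullet> e \<longrightarrow> f (reflect e \<tau> y) \<le> f y"
    and s: "supported_in f \<Omega>" and \<Omega>: "\<Omega> \<in> sets borel"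
    and le: "emeasure lborel \<Omega> \<le> emeasure lborel (ball c R)"
  shows "AE x in lborel. x \<notin> ball c R \<longrightarrow> f x = 0"
proof -
  note [measurable] = L2_bounded_measurable[OF f] \<Omega>
  define B where "B = ball c R"
  define S where "S = {x. f x > 0}"
  have [measurable]: "B \<in> sets borel" "S \<in> sets borel" unfolding B_def S_def by measurable
  obtain \<rho> where \<rho>: "\<And>x. norm x > \<rho> \<Longrightarrow> f x = 0" using f by (auto simp: L2_bounded_def)
  have bS: "x \<in> S \<Longrightarrow> norm x \<le> \<rho>" for x using \<rho>[of x] by (force simp: S_def)
  have bB: "x \<in> B \<Longrightarrow> norm x \<le> norm c + R" for x
    using norm_triangle_ineq2[of x c] by (auto simp: B_def dist_norm norm_minus_commute)
  have LA: "L2_bounded (indicator (S - B))"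
    by (rule L2_bounded_bounded[where R=\<rho> and B=1]) (use bS in \<open>force simp: indicator_def\<close>)+
  have LA': "L2_bounded (indicator (B - S))"
    by (rule L2_bounded_bounded[where R="norm c + R" and B=1]) (use bB in \<open>force simp: indicator_def\<close>)+
  have finS: "emeasure lborel S < \<infinity>" by (intro emeasure_bounded_finite) (use bS in \<open>auto simp: bounded_iff\<close>)
  have finB: "emeasure lborel B < \<infinity>" by (intro emeasure_bounded_finite) (auto simp: B_def)
  have "S \<subseteq> \<Omega>" using s by (auto simp: S_def supported_in_def)
  then have "emeasure lborel S \<le> emeasure lborel B"
    using emeasure_mono[of S \<Omega> lborel] le by (auto simp: B_def)
  then have SB: "measure lborel S \<le> measure lborel B"
    unfolding measure_def using finB by (intro enn2real_mono) (simp_all add: less_top)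
  have fm: "S \<in> fmeasurable lborel" "B \<in> fmeasurable lborel" using finS finB by (auto intro!: fmeasurableI)
  have meas: "measure lborel (S - B) \<le> measure lborel (B - S)"
  proof -
    have d: "measure lborel X = measure lborel (X - Y) + measure lborel (X \<inter> Y)"
      if "X \<in> fmeasurable lborel" "Y \<in> sets borel" for X Y :: "plane set"
    proof -
      have "X - Y \<in> fmeasurable lborel" "X \<inter> Y \<in> fmeasurable lborel"
        using that by (auto intro: fmeasurable_Int_fmeasurable fmeasurable_Diff)
      then have "measure lborel ((X - Y) \<union> (X \<inter> Y)) = measure lborel (X - Y) + measure lborel (X \<inter> Y)"
        using that by (intro measure_Union) (auto simp: fmeasurableD2 fmeasurableD)
      moreover have "(X - Y) \<union> (X \<inter> Y) = X" by auto
      ultimately show ?thesis by simp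
    qed
    show ?thesis using d[OF fm(1), of B] d[OF fm(2), of S] SB by (simp add: Int_commute)
  qed
  have key: "(LBINT x. indicator (S - B) x * heat t f x) \<le> (LBINT x. indicator (B - S) x * heat t f x)"
    if t: "t > 0" for t
  proof (cases "B = {}")
    \<comment> \<open>Here \<open>R\<close> may be nonpositive, and the separating level below is an
      infimum over \<open>B\<close>, which must not be empty.\<close>
    case True
    then have "measure lborel (S - B) \<le> 0" using meas by simp
    then have "measure lborel (S - B) = 0" by (simp add: measure_le_0_iff)
    then have "S - B \<in> null_sets lborel"
      using fmeasurable.Diff[OF fm] by (intro null_setsI) (auto simp: emeasure_eq_measure2)
    from AE_not_in[OF this] have "AE x in lborel. indicator (S - B) x * heat t f x = 0"
      by eventually_elim simp
    then have "(LBINT x. indicator (S - B) x * heat t f x) = 0" by (rule integral_eq_zero_AE)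
    then show ?thesis using True by simp
  next
    case False
    \<comment> \<open>A level separating the values of the evolution on \<open>B\<close> from those
      outside, by radial monotonicity.\<close>
    define h where "h = (INF y\<in>B. heat t f y)"
    have h0: "0 \<le> heat t f y" for y by (rule heat_nonneg[OF t nn])
    have bdd: "bdd_below (heat t f ` B)" using h0 by (intro bdd_belowI2)
    have h_le: "h \<le> heat t f y" if "y \<in> B" for y unfolding h_def using that bdd by (rule cINF_lower[rotated])
    have h_ge: "heat t f x \<le> h" if "x \<notin> B" for x
      unfolding h_def
    proof (rule cINF_greatest[OF False])
      fix y assume "y \<in> B"
      then have "norm (y - c) < norm (x - c)" using that by (auto simp: B_def dist_norm norm_minus_commute)
      then show "heat t f x \<le> heat t f y"
        by (intro heat_radially_decreasing[OF f t, of c] c)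
    qed
    have hn: "0 \<le> h" unfolding h_def using h0 False by (intro cINF_greatest)
    have "(LBINT x. indicator (S - B) x * heat t f x) \<le> (LBINT x. indicator (S - B) x * h)"
      using h_ge by (intro integral_mono integral_mult_heat(1)[OF f LA t] integrable_mult_left L2_bounded_integrable[OF LA])
        (auto simp: indicator_def)
    also have "\<dots> = measure lborel (S - B) * h" by simp
    also have "\<dots> \<le> measure lborel (B - S) * h" using meas hn by (rule mult_right_mono)
    also have "\<dots> = (LBINT x. indicator (B - S) x * h)" by simp
    also have "\<dots> \<le> (LBINT x. indicator (B - S) x * heat t f x)"
      using h_le by (intro integral_mono integral_mult_heat(1)[OF f LA' t] integrable_mult_left L2_bounded_integrable[OF LA'])
        (auto simp: indicator_def)
    finally show ?thesis .
  qed
  have "(LBINT x. indicator (S - B) x * f x) \<le> (LBINT x. indicator (B - S) x * f x)"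
    by (rule LIMSEQ_le[OF integral_mult_heat_tendsto[OF f LA] integral_mult_heat_tendsto[OF f LA']]) (use key in auto)
  also have "(\<lambda>x. indicator (B - S) x * f x) = (\<lambda>x. 0)"
    using nn by (auto simp: fun_eq_iff S_def indicator_def not_less intro: order.antisym)
  finally have "(LBINT x. indicator (S - B) x * f x) \<le> 0" by simp
  moreover have "(LBINT x. indicator (S - B) x * f x) \<ge> 0" using nn by (intro integral_nonneg_AE) auto
  ultimately have "(LBINT x. indicator (S - B) x * f x) = 0" by simp
  then have "AE x in lborel. indicator (S - B) x * f x = 0"
    using nn L2_bounded_mult[OF LA f] by (subst (asm) integral_nonneg_eq_0_iff_AE) auto
  then show ?thesis
  proof eventually_elim
    case (elim x)
    then show ?case using nn[of x] by (auto simp: S_def B_def indicator_def split: if_splits)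
  qed
qed

section \<open>The Fourier transform of a spherical cap\<close>

text \<open>Polar coordinates in which a line through the origin is given by its slope \<open>s\<close>, and
  \<open>r\<close> is a signed distance on it.\<close>

definition slope_point :: "real \<Rightarrow> real \<Rightarrow> plane" where
  "slope_point s r = pt (r / sqrt (1 + s\<^sup>2)) (r * s / sqrt (1 + s\<^sup>2))"

text \<open>The signed coordinate of the projection of \<open>x\<close> onto the line of slope
  \<open>s\<close>. It is the variable dual to the distance \<open>r\<close> on that line.\<close>

definition slope_height :: "real \<Rightarrow> plane \<Rightarrow> real" where
  "slope_height s x = (x $ 1 + s * x $ 2) / sqrt (1 + s\<^sup>2)"

lemma sqrt_slope_pos [simp]: "sqrt (1 + s\<^sup>2) > (0::real)" "1 + s\<^sup>2 > (0::real)" "sqrt (1 + s\<^sup>2) \<noteq> (0::real)" "1 + s\<^sup>2 \<noteq> (0::real)"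
proof -
  show "1 + s\<^sup>2 > 0" by (simp add: add_pos_nonneg)
  then show "sqrt (1 + s\<^sup>2) > 0" "sqrt (1 + s\<^sup>2) \<noteq> 0" "1 + s\<^sup>2 \<noteq> 0" by auto
qed

lemma inner_slope_point: "x \<bullet> slope_point s r = r * slope_height s x"
  by (simp add: inner_plane slope_point_def slope_height_def field_simps)

lemma norm_slope_point [simp]: "norm (slope_point s r) = \<bar>r\<bar>"
proof -
  have "(norm (slope_point s r))\<^sup>2 = r\<^sup>2 * (1 + s\<^sup>2) / (1 + s\<^sup>2)"
    unfolding norm_plane_sq slope_point_def pt_nth power_divide power_mult_distrib
    by (simp add: distrib_left add_divide_distrib)
  also have "\<dots> = \<bar>r\<bar>\<^sup>2" by simp
  finally show ?thesis by (rule power2_eq_imp_eq) auto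
qed

lemma abs_slope_height_le: "\<bar>slope_height s x\<bar> \<le> norm x"
  using Cauchy_Schwarz_ineq2[of x "slope_point s 1"] by (simp add: inner_slope_point)

lemma measurable_slope_point [measurable]:
  "(\<lambda>p. slope_point (fst p) (snd p)) \<in> borel_measurable borel"
  unfolding slope_point_def pt_def by (intro borel_measurable_continuous_onI continuous_intros) auto

lemma measurable_slope_point' [measurable]: "slope_point s \<in> borel_measurable borel"
  unfolding slope_point_def[abs_def] pt_def by (intro borel_measurable_continuous_onI continuous_intros) auto

text \<open>Two affine substitutions on lines: \<open>b = a * s\<close> for fixed nonzero
  \<open>a\<close>, then \<open>a = r / sqrt (1 + s\<^sup>2)\<close> for fixed \<open>s\<close>.
  Their factors combine to the stated density.\<close>

lemma nn_integral_slope: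
  assumes [measurable]: "f \<in> borel_measurable borel"
  shows "(\<integral>\<^sup>+x. f x \<partial>lborel) = (\<integral>\<^sup>+s. \<integral>\<^sup>+r. f (slope_point s r) * ennreal (\<bar>r\<bar> / (1 + s\<^sup>2)) \<partial>lborel \<partial>lborel)"
proof -
  have m: "(\<lambda>p. f (pt (snd p) (snd p * fst p))) \<in> borel_measurable borel"
    "(\<lambda>p. f (pt (fst p) (fst p * snd p))) \<in> borel_measurable borel"
    unfolding pt_def by measurable
  have "(\<integral>\<^sup>+x. f x \<partial>lborel) = (\<integral>\<^sup>+a. \<integral>\<^sup>+b. f (pt a b) \<partial>lborel \<partial>lborel)" by (rule nn_integral_plane) measurable
  also have "\<dots> = (\<integral>\<^sup>+a. \<integral>\<^sup>+s. ennreal \<bar>a\<bar> * f (pt a (a * s)) \<partial>lborel \<partial>lborel)"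
  proof (rule nn_integral_cong_AE)
    have "AE a in lborel. a \<noteq> (0::real)" by (rule AE_lborel_singleton)
    then show "AE a in lborel. (\<integral>\<^sup>+b. f (pt a b) \<partial>lborel) = (\<integral>\<^sup>+s. ennreal \<bar>a\<bar> * f (pt a (a * s)) \<partial>lborel)"
    proof eventually_elim
      case (elim a)
      have "(\<lambda>b. f (pt a b)) \<in> borel_measurable borel" unfolding pt_def by measurable
      moreover have "(\<lambda>s. f (pt a (a * s))) \<in> borel_measurable borel" unfolding pt_def by measurable
      ultimately show ?case
        using nn_integral_real_affine[of "\<lambda>b. f (pt a b)" a 0] elim by (simp add: nn_integral_cmult)
    qed
  qed
  also have "\<dots> = (\<integral>\<^sup>+s. \<integral>\<^sup>+a. ennreal \<bar>a\<bar> * f (pt a (a * s)) \<partial>lborel \<partial>lborel)"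
    by (rule lborel_pair.Fubini') (use m in \<open>simp add: case_prod_unfold lborel_prod\<close>)
  also have "\<dots> = (\<integral>\<^sup>+s. \<integral>\<^sup>+r. f (slope_point s r) * ennreal (\<bar>r\<bar> / (1 + s\<^sup>2)) \<partial>lborel \<partial>lborel)"
  proof (rule nn_integral_cong)
    fix s :: real
    let ?k = "sqrt (1 + s\<^sup>2)"
    have "(\<lambda>a. ennreal \<bar>a\<bar> * f (pt a (a * s))) \<in> borel_measurable borel" unfolding pt_def by measurable
    then have "(\<integral>\<^sup>+a. ennreal \<bar>a\<bar> * f (pt a (a * s)) \<partial>lborel)
      = ennreal \<bar>1 / ?k\<bar> * (\<integral>\<^sup>+r. ennreal \<bar>0 + 1 / ?k * r\<bar> * f (pt (0 + 1 / ?k * r) ((0 + 1 / ?k * r) * s)) \<partial>lborel)"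
      by (rule nn_integral_real_affine) simp
    also have "\<dots> = (\<integral>\<^sup>+r. ennreal \<bar>1 / ?k\<bar> * (ennreal \<bar>0 + 1 / ?k * r\<bar> * f (pt (0 + 1 / ?k * r) ((0 + 1 / ?k * r) * s))) \<partial>lborel)"
      unfolding pt_def by (rule nn_integral_cmult[symmetric]) measurable
    also have "\<dots> = (\<integral>\<^sup>+r. f (slope_point s r) * ennreal (\<bar>r\<bar> / (1 + s\<^sup>2)) \<partial>lborel)"
    proof (rule nn_integral_cong)
      fix r :: real
      have "\<bar>1 / ?k\<bar> * \<bar>0 + 1 / ?k * r\<bar> = \<bar>r\<bar> / (?k * ?k)" by (simp add: abs_mult)
      also have "?k * ?k = 1 + s\<^sup>2" by simp
      finally have "ennreal \<bar>1 / ?k\<bar> * ennreal \<bar>0 + 1 / ?k * r\<bar> = ennreal (\<bar>r\<bar> / (1 + s\<^sup>2))"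
        by (simp only: ennreal_mult'[symmetric] abs_ge_zero)
      then show "ennreal \<bar>1 / ?k\<bar> * (ennreal \<bar>0 + 1 / ?k * r\<bar> * f (pt (0 + 1 / ?k * r) ((0 + 1 / ?k * r) * s)))
         = f (slope_point s r) * ennreal (\<bar>r\<bar> / (1 + s\<^sup>2))"
        unfolding mult.assoc[symmetric] by (simp add: slope_point_def mult.commute)
    qed
    finally show "(\<integral>\<^sup>+a. ennreal \<bar>a\<bar> * f (pt a (a * s)) \<partial>lborel)
      = (\<integral>\<^sup>+r. f (slope_point s r) * ennreal (\<bar>r\<bar> / (1 + s\<^sup>2)) \<partial>lborel)" .
  qed
  finally show ?thesis .
qed

text \<open>The slopes contribute total mass \<open>pi\<close>. As \<open>r\<close> takes both
  signs, this is the usual factor \<open>2 * pi\<close> on the half line.\<close>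

lemma nn_integral_radial:
  assumes [measurable]: "h \<in> borel_measurable borel"
  shows "(\<integral>\<^sup>+x. h (norm (x::plane)) \<partial>lborel) = ennreal pi * (\<integral>\<^sup>+r. h \<bar>r\<bar> * ennreal \<bar>r\<bar> \<partial>lborel)"
proof -
  have "(\<integral>\<^sup>+x. h (norm (x::plane)) \<partial>lborel)
     = (\<integral>\<^sup>+s. \<integral>\<^sup>+r. (h \<bar>r\<bar> * ennreal \<bar>r\<bar>) * ennreal (1 / (1 + s\<^sup>2)) \<partial>lborel \<partial>lborel)"
    by (subst nn_integral_slope) (simp_all add: mult.assoc flip: ennreal_mult')
  also have "\<dots> = (\<integral>\<^sup>+r. h \<bar>r\<bar> * ennreal \<bar>r\<bar> \<partial>lborel) * (\<integral>\<^sup>+s. ennreal (1 / (1 + s\<^sup>2)) \<partial>lborel)"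
    by (simp add: nn_integral_multc nn_integral_cmult)
  also have "(\<integral>\<^sup>+s. ennreal (1 / (1 + s\<^sup>2)) \<partial>lborel) = ennreal pi"
    unfolding cauchy_density_integral(2)[symmetric]
    by (rule nn_integral_eq_integral[OF cauchy_density_integral(1)]) (auto intro!: divide_nonneg_pos)
  finally show ?thesis by (simp add: mult.commute)
qed

text \<open>The nonnegative case is first read as an equality of measures, from which Bochner
  integrability and the integral carry over.\<close>

lemma integral_slope:
  fixes f :: "plane \<Rightarrow> real"
  assumes f: "integrable lborel f"
  shows "(LBINT x. f x) = (LBINT s. LBINT r. f (slope_point s r) * (\<bar>r\<bar> / (1 + s\<^sup>2)))"
proof -
  have [measurable]: "f \<in> borel_measurable borel" using f by auto
  let ?g = "\<lambda>p. f (slope_point (fst p) (snd p)) * (\<bar>snd p\<bar> / (1 + (fst p)\<^sup>2))"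
  let ?d = "\<lambda>p::real \<times> real. \<bar>snd p\<bar> / (1 + (fst p)\<^sup>2)"
  let ?q = "\<lambda>p. slope_point (fst p) (snd p)"
  have "lborel = distr (density lborel ?d) borel ?q"
  proof (rule measure_eqI)
    fix A :: "plane set" assume "A \<in> sets lborel"
    then have [measurable]: "A \<in> sets borel" by simp
    have "emeasure (distr (density lborel ?d) borel ?q) A = (\<integral>\<^sup>+x. indicator A x \<partial>distr (density lborel ?d) borel ?q)"
      by simp
    also have "\<dots> = (\<integral>\<^sup>+p. ennreal (?d p) * indicator A (?q p) \<partial>lborel)"
      by (subst nn_integral_distr, measurable, subst nn_integral_density) auto
    also have "\<dots> = (\<integral>\<^sup>+x. indicator A x \<partial>lborel)"
      by (subst nn_integral_slope, measurable, subst nn_integral_lborel_pair(1)) (auto simp: mult.commute)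
    finally show "emeasure lborel A = emeasure (distr (density lborel ?d) borel ?q) A" by simp
  qed simp
  note D = this
  have i: "integrable lborel ?g"
    using f by (subst (asm) D, subst (asm) integrable_distr_eq, measurable, subst (asm) integrable_density)
       (auto simp: mult.commute intro!: divide_nonneg_pos)
  have "(LBINT x. f x) = (LBINT p. ?g p)"
    by (subst D, subst integral_distr, measurable, subst integral_density)
       (auto simp: mult.commute intro!: divide_nonneg_pos)
  also have "\<dots> = (LBINT s. LBINT r. f (slope_point s r) * (\<bar>r\<bar> / (1 + s\<^sup>2)))"
    using integral_lborel_pair(1)[OF i] by simp
  finally show ?thesis .
qed

section \<open>The half sphere function and its transform\<close>

definition cap :: "real \<Rightarrow> plane \<Rightarrow> real" where
  "cap R x = sqrt (max 0 (R\<^sup>2 - (norm x)\<^sup>2))"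

lemma continuous_on_cap [continuous_intros]: "continuous_on S (cap R)"
  unfolding cap_def by (intro continuous_intros)

lemma measurable_cap [measurable]: "cap R \<in> borel_measurable borel"
  by (intro borel_measurable_continuous_onI continuous_intros)

lemma cap_nonneg [simp]: "0 \<le> cap R x"
  by (simp add: cap_def)

lemma cap_eq_0: "0 < R \<Longrightarrow> R \<le> norm x \<Longrightarrow> cap R x = 0"
  by (simp add: cap_def max_def power_mono)

lemma cap_mono: "0 \<le> R \<Longrightarrow> R \<le> R' \<Longrightarrow> cap R x \<le> cap R' x"
  unfolding cap_def by (intro real_sqrt_le_mono max.mono diff_mono power_mono) auto

lemma L2_bounded_cap: "0 < R \<Longrightarrow> L2_bounded (cap R)"
proof (rule L2_bounded_bounded[where R=R and B=R])
  assume R: "0 < R"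
  show "\<bar>cap R x\<bar> \<le> R" for x
    using R by (auto simp: cap_def intro!: real_le_lsqrt)
qed (auto intro: cap_eq_0)

lemma FT_reflect_invariant:
  assumes e: "norm e = 1" and [measurable]: "f \<in> borel_measurable borel" and inv: "\<And>x. f (reflect e 0 x) = f x"
  shows "FT f (reflect e 0 \<xi>) = FT f \<xi>"
proof -
  have adj: "reflect e 0 x \<bullet> \<xi> = x \<bullet> reflect e 0 \<xi>" for x
    by (simp add: reflect_def inner_diff_left inner_diff_right inner_commute)
  have "(LBINT x. exp (- \<i> * complex_of_real (reflect e 0 x \<bullet> \<xi>)) * complex_of_real (f (reflect e 0 x)))
     = (LBINT x. exp (- \<i> * complex_of_real (x \<bullet> \<xi>)) * complex_of_real (f x))"
    by (rule integral_reflect[OF e, of "\<lambda>x. exp (- \<i> * complex_of_real (x \<bullet> \<xi>)) * complex_of_real (f x)"]) measurable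
  then show ?thesis by (simp add: FT_lborel adj inv)
qed

text \<open>If the norms agree, the perpendicular bisector of the two frequencies passes through the
  origin, and \<open>cap R\<close> is invariant under reflection in it.\<close>

lemma FT_cap_rotate: "norm \<xi> = norm \<eta> \<Longrightarrow> FT (cap R) \<xi> = FT (cap R) \<eta>"
proof (cases "\<xi> = \<eta>")
  case False
  assume n: "norm \<xi> = norm \<eta>"
  define e where "e = (\<xi> - \<eta>) /\<^sub>R norm (\<xi> - \<eta>)"
  note sw = reflect_swap[OF False, folded e_def]
  have "((\<xi> + \<eta>) /\<^sub>R 2) \<bullet> (\<xi> - \<eta>) = ((norm \<xi>)\<^sup>2 - (norm \<eta>)\<^sup>2) / 2"
    unfolding power2_norm_eq_inner by (simp add: inner_add_left inner_add_right inner_diff_left inner_diff_right inner_commute field_simps)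
  then have "((\<xi> + \<eta>) /\<^sub>R 2) \<bullet> e = 0" unfolding e_def using n by simp
  then have "reflect e 0 \<xi> = \<eta>" using sw(2) by simp
  moreover have "cap R (reflect e 0 x) = cap R x" for x
    using norm_reflect_reflect[OF sw(1), of 0 x 0] by (simp add: cap_def reflect_def)
  ultimately show ?thesis using FT_reflect_invariant[OF sw(1) measurable_cap, of R \<xi>] by simp
qed simp

text \<open>Half the area of a disc of radius \<open>sqrt A\<close>; the unit case is the Beta
  integral with value \<open>pi / 2\<close>.\<close>

lemma half_disc_area: "(LBINT b. sqrt (max 0 (A - b\<^sup>2))) = pi / 2 * max 0 A"
proof (cases "A > 0")
  case False
  then have "sqrt (max 0 (A - b\<^sup>2)) = 0" for b by (simp add: max_def) (smt (verit) zero_le_power2)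
  then show ?thesis using False by (simp add: max_def)
next
  case True
  define h where "h = sqrt A"
  have h: "h > 0" "h\<^sup>2 = A" using True by (auto simp: h_def)
  have "ennreal (sqrt (max 0 (1 - b\<^sup>2))) = ennreal (indicator {-1..1} b * sqrt (1 - b\<^sup>2) ^ 1)" for b :: real
  proof (cases "\<bar>b\<bar> \<le> 1")
    case True
    then have "b\<^sup>2 \<le> 1" by (simp add: abs_square_le_1)
    then show ?thesis using True by (auto simp: indicator_def abs_le_iff)
  next
    case False
    then have "1 < b\<^sup>2" by (metis abs_square_le_1 not_less)
    then show ?thesis using False by (auto simp: indicator_def abs_le_iff max_def)
  qed
  then have "(\<integral>\<^sup>+b. ennreal (sqrt (max 0 (1 - b\<^sup>2))) \<partial>lborel) = ennreal (Beta (1 / 2) (1 / 2 + 1))"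
    using emeasure_cball_aux_integral[of 1] by simp
  also have "Beta (1 / 2) (1 / 2 + 1) = pi / 2"
  proof -
    have "(1 / 2 :: real) \<notin> \<int>\<^sub>\<le>\<^sub>0" using nonpos_Ints_nonpos[of "1 / 2 :: real"] by auto
    from Gamma_plus1[OF this] have G: "Gamma (3 / 2 :: real) = sqrt pi / 2"
      using Gamma_one_half_real by simp
    show ?thesis
      by (simp add: Beta_def G Gamma_one_half_real Gamma_numeral)
  qed
  finally have 1: "(LBINT b. sqrt (max 0 (1 - b\<^sup>2))) = pi / 2"
    by (subst integral_eq_nn_integral) auto
  have "(LBINT b. sqrt (max 0 (A - b\<^sup>2))) = \<bar>h\<bar> *\<^sub>R (LBINT b. sqrt (max 0 (A - (0 + h * b)\<^sup>2)))"
    by (rule lborel_integral_real_affine) (use h in auto)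
  also have "\<dots> = h * (LBINT b. h * sqrt (max 0 (1 - b\<^sup>2)))"
  proof -
    have "sqrt (max 0 (A - (0 + h * b)\<^sup>2)) = h * sqrt (max 0 (1 - b\<^sup>2))" for b
    proof -
      have "max 0 (A - (0 + h * b)\<^sup>2) = h\<^sup>2 * max 0 (1 - b\<^sup>2)"
        unfolding h(2)[symmetric] by (simp add: max_mult_distrib_left power_mult_distrib right_diff_distrib)
      then show ?thesis using h(1) by (simp only: real_sqrt_mult real_sqrt_abs abs_of_pos)
    qed
    then show ?thesis using h by simp
  qed
  also have "\<dots> = h\<^sup>2 * (pi / 2)" by (simp only: integral_mult_right_zero 1) (simp add: power2_eq_square)
  also have "\<dots> = pi / 2 * max 0 A" using h True by simp
  finally show ?thesis .
qed

text \<open>Integrals of the half sphere over parallel lines form a parabola cut off at 0, up to a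
  factor. Its transform is elementary, so the two-dimensional transform is found without Bessel
  functions.\<close>

lemma fourier_parabola:
  assumes R: "R > 0" and r: "r > 0"
  shows "(LBINT a. exp (- \<i> * complex_of_real (a * r)) * complex_of_real (max 0 (R\<^sup>2 - a\<^sup>2)))
    = complex_of_real (4 * (sin (R * r) - R * r * cos (R * r)) / r ^ 3)"
proof -
  define k where "k = - \<i> * complex_of_real r"
  have k: "k \<noteq> 0" using r by (simp add: k_def)
  let ?f = "\<lambda>a. exp (k * complex_of_real a) * complex_of_real (R\<^sup>2 - a\<^sup>2)"
  \<comment> \<open>The antiderivative obtained by integrating by parts until the polynomial is used
    up.\<close>
  define F where "F a = exp (k * complex_of_real a) * (complex_of_real (R\<^sup>2 - a\<^sup>2) / k + 2 * complex_of_real a / k\<^sup>2 - 2 / k ^ 3)" for a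
  have "has_bochner_integral lborel (\<lambda>a. indicator {-R..R} a *\<^sub>R ?f a) (F R - F (- R))"
  proof (rule has_bochner_integral_FTC_Icc)
    show "continuous_on {- R..R} ?f" by (intro continuous_intros)
    fix a
    let ?G = "\<lambda>z. exp (k * z) * ((complex_of_real R ^ 2 - z\<^sup>2) / k + 2 * z / k\<^sup>2 - 2 / k ^ 3)"
    have "(?G has_field_derivative ?f a) (at (complex_of_real a))"
      using k by (auto intro!: derivative_eq_intros simp: field_simps power2_eq_square power3_eq_cube)
    then have "((\<lambda>x. ?G (complex_of_real x)) has_vector_derivative ?f a) (at a)"
      by (rule has_vector_derivative_real_field)
    then show "(F has_vector_derivative ?f a) (at a within {- R..R})"
      unfolding F_def by (auto intro: has_vector_derivative_at_within)
  qed (use R in auto)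
  then have "(LBINT a. indicator {-R..R} a *\<^sub>R ?f a) = F R - F (- R)" by (rule has_bochner_integral_integral_eq)
  moreover have "indicator {-R..R} a *\<^sub>R ?f a = exp (- \<i> * complex_of_real (a * r)) * complex_of_real (max 0 (R\<^sup>2 - a\<^sup>2))" for a
  proof (cases "\<bar>a\<bar> \<le> R")
    case True
    then have "a\<^sup>2 \<le> R\<^sup>2" using R by (metis abs_le_square_iff abs_of_pos)
    then show ?thesis using True by (simp add: abs_le_iff indicator_def k_def mult_ac max_def)
  next
    case False
    then have "\<not> a\<^sup>2 \<le> R\<^sup>2" using R by (metis abs_le_square_iff abs_of_pos)
    then show ?thesis using False by (auto simp: indicator_def max_def not_le)
  qed
  moreover have "F R - F (- R) = complex_of_real (4 * (sin (R * r) - R * r * cos (R * r)) / r ^ 3)"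
  proof -
    have k2: "k\<^sup>2 = - complex_of_real (r\<^sup>2)" "k ^ 3 = \<i> * complex_of_real (r ^ 3)"
      by (simp_all add: k_def power2_eq_square power3_eq_cube complex_eq_iff)
    have ex: "exp (k * complex_of_real R) = complex_of_real (cos (R * r)) - \<i> * complex_of_real (sin (R * r))"
      "exp (k * complex_of_real (- R)) = complex_of_real (cos (R * r)) + \<i> * complex_of_real (sin (R * r))"
      using cis_conv_exp[of "- (R * r)"] cis_conv_exp[of "R * r"] by (simp_all add: k_def complex_eq_iff mult_ac)
    show ?thesis
      unfolding F_def ex k2 using r
      by (simp add: complex_eq_iff field_simps power2_eq_square power3_eq_cube)
  qed
  ultimately show ?thesis by simp
qed

text \<open>With the frequency rotated onto the first axis the character depends on one coordinate
  only, so the other integral is \<open>half_disc_area\<close> and the remaining one is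
  \<open>fourier_parabola\<close>.\<close>

lemma FT_cap:
  assumes R: "R > 0" and \<xi>: "\<xi> \<noteq> 0"
  shows "FT (cap R) \<xi> = complex_of_real ((sin (R * norm \<xi>) - R * norm \<xi> * cos (R * norm \<xi>)) / norm \<xi> ^ 3)"
proof -
  define r where "r = norm \<xi>"
  have r: "r > 0" using \<xi> by (simp add: r_def)
  have n: "norm \<xi> = norm (pt r 0)" using r norm_plane_sq[of "pt r 0"] by (simp add: power2_eq_iff_nonneg r_def)
  have "FT (cap R) \<xi> = FT (cap R) (pt r 0)" by (rule FT_cap_rotate[OF n])
  also have "\<dots> = complex_of_real (1 / (2 * pi)) * (LBINT x. exp (- \<i> * complex_of_real (x \<bullet> pt r 0)) * complex_of_real (cap R x))"
    by (rule FT_lborel) measurable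
  also have "(LBINT x. exp (- \<i> * complex_of_real (x \<bullet> pt r 0)) * complex_of_real (cap R x))
     = (LBINT a. LBINT b. exp (- \<i> * complex_of_real (a * r)) * complex_of_real (cap R (pt a b)))"
    by (subst integral_plane[OF integrable_fourier_kernel[OF L2_bounded_integrable[OF L2_bounded_cap[OF R]]]])
       (simp add: inner_plane)
  also have "\<dots> = (LBINT a. exp (- \<i> * complex_of_real (a * r)) * complex_of_real (pi / 2 * max 0 (R\<^sup>2 - a\<^sup>2)))"
  proof -
    have "(LBINT b. exp (- \<i> * complex_of_real (a * r)) * complex_of_real (cap R (pt a b)))
       = exp (- \<i> * complex_of_real (a * r)) * complex_of_real (pi / 2 * max 0 (R\<^sup>2 - a\<^sup>2))" for a
      unfolding half_disc_area[symmetric]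
      by (simp add: cap_def norm_plane_sq diff_diff_eq flip: integral_complex_of_real)
    then show ?thesis by (simp only:)
  qed
  also have "\<dots> = complex_of_real (pi / 2) * (LBINT a. exp (- \<i> * complex_of_real (a * r)) * complex_of_real (max 0 (R\<^sup>2 - a\<^sup>2)))"
    by (subst integral_mult_right_zero[symmetric]) (simp only: of_real_mult mult_ac)
  also have "\<dots> = complex_of_real (pi / 2) * complex_of_real (4 * (sin (R * r) - R * r * cos (R * r)) / r ^ 3)"
    by (simp only: fourier_parabola[OF R r])
  finally have "FT (cap R) \<xi> = complex_of_real (1 / (2 * pi) * (pi / 2 * (4 * (sin (R * r) - R * r * cos (R * r)) / r ^ 3)))"
    by (simp only: of_real_mult)
  also have "1 / (2 * pi) * (pi / 2 * (4 * X / Y)) = X / Y" for X Y :: real by simp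
  finally show ?thesis by (simp add: r_def)
qed

section \<open>The Euler-Lagrange equation on a disc\<close>

text \<open>Together the two summands cover frequencies of norm at most 1, where the mass of the
  half sphere bounds the transform, and larger ones, where the explicit formula does. Evaluated at a
  radius \<open>R0\<close>, it serves all radii up to \<open>R0\<close>.\<close>

definition cap_bound :: "real \<Rightarrow> real" where
  "cap_bound R = (LBINT x. cap R x) / pi + 2 * (1 + R)"

lemma norm_FT_cap_le:
  assumes R: "0 < R" "R \<le> R0"
  shows "norm (FT (cap R) \<xi>) \<le> cap_bound R0 / (1 + (norm \<xi>)\<^sup>2)"
proof -
  let ?B = "(LBINT x. cap R0 x) / (2 * pi)" and ?r = "norm \<xi>"
  have i: "integrable lborel (cap R)" "integrable lborel (cap R0)"
    using R L2_bounded_cap[of R] L2_bounded_cap[of R0] by (auto intro: L2_bounded_integrable)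
  have "norm (FT (cap R) \<xi>) \<le> (LBINT x. \<bar>cap R x\<bar>) / (2 * pi)" by (rule norm_FT_le[OF i(1)])
  also have "\<dots> \<le> ?B" using i R by (intro divide_right_mono integral_mono) (auto intro: cap_mono)
  finally have 1: "norm (FT (cap R) \<xi>) \<le> ?B" .
  have B0: "?B \<ge> 0" by (intro divide_nonneg_nonneg integral_nonneg_AE) auto
  have eq: "cap_bound R0 = 2 * ?B + 2 * (1 + R0)" by (simp add: cap_bound_def)
  have "norm (FT (cap R) \<xi>) * (1 + ?r\<^sup>2) \<le> cap_bound R0"
  proof (cases "?r \<le> 1")
    case True
    then have "?r\<^sup>2 \<le> 1" by (simp add: power_le_one)
    then have "norm (FT (cap R) \<xi>) * (1 + ?r\<^sup>2) \<le> ?B * 2" using 1 B0 by (intro mult_mono) auto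
    then show ?thesis using R by (simp add: eq)
  next
    case False
    then have r: "?r > 1" "\<xi> \<noteq> 0" by auto
    have "\<bar>sin (R * ?r) - R * ?r * cos (R * ?r)\<bar> \<le> \<bar>sin (R * ?r)\<bar> + \<bar>R * ?r * cos (R * ?r)\<bar>" by (rule abs_triangle_ineq4)
    also have "\<dots> \<le> 1 + R0 * ?r"
    proof (intro add_mono)
      have "\<bar>R * ?r * cos (R * ?r)\<bar> = (R * ?r) * \<bar>cos (R * ?r)\<bar>" using R by (simp add: abs_mult)
      also have "\<dots> \<le> (R0 * ?r) * 1" using R by (intro mult_mono) auto
      finally show "\<bar>R * ?r * cos (R * ?r)\<bar> \<le> R0 * ?r" by simp
    qed simp
    also have "\<dots> \<le> (1 + R0) * ?r" using r R by (simp add: distrib_right)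
    finally have "norm (FT (cap R) \<xi>) \<le> (1 + R0) * ?r / ?r ^ 3"
      unfolding FT_cap[OF R(1) r(2)] norm_of_real abs_divide using r by (simp add: divide_right_mono)
    also have "\<dots> = (1 + R0) / ?r\<^sup>2" using r by (simp add: power2_eq_square power3_eq_cube)
    finally have "norm (FT (cap R) \<xi>) * (1 + ?r\<^sup>2) \<le> (1 + R0) / ?r\<^sup>2 * (2 * ?r\<^sup>2)"
      using r R by (intro mult_mono) (auto simp: power2_eq_square intro: one_le_mult_iff[THEN iffD2] less_1_mult less_imp_le)
    also have "\<dots> = 2 * (1 + R0)" using r by simp
    also have "\<dots> \<le> cap_bound R0" using B0 by (simp add: eq)
    finally show ?thesis .
  qed
  then show ?thesis by (simp add: pos_le_divide_eq add_pos_nonneg)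
qed

text \<open>In radial form the integrand, Jacobian included, is at most a multiple of
  \<open>1 / (1 + r\<^sup>2)\<close>.\<close>

lemma integrable_cap_decay: "integrable lborel (\<lambda>\<xi>::plane. norm \<xi> * (C / (1 + (norm \<xi>)\<^sup>2))\<^sup>2)"
proof -
  have eq: "(\<integral>\<^sup>+\<xi>. (\<lambda>r. ennreal (r * (C / (1 + r\<^sup>2))\<^sup>2)) (norm (\<xi>::plane)) \<partial>lborel)
     = ennreal pi * (\<integral>\<^sup>+r. ennreal (\<bar>r\<bar> * (C / (1 + \<bar>r\<bar>\<^sup>2))\<^sup>2) * ennreal \<bar>r\<bar> \<partial>lborel)"
    by (rule nn_integral_radial) measurable
  have "(\<integral>\<^sup>+r. ennreal (\<bar>r\<bar> * (C / (1 + \<bar>r\<bar>\<^sup>2))\<^sup>2) * ennreal \<bar>r\<bar> \<partial>lborel) \<le> (\<integral>\<^sup>+r. ennreal (C\<^sup>2 * (1 / (1 + r\<^sup>2))) \<partial>lborel)"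
  proof (rule nn_integral_mono)
    fix r :: real
    have "\<bar>r\<bar> * (C / (1 + \<bar>r\<bar>\<^sup>2))\<^sup>2 * \<bar>r\<bar> = C\<^sup>2 * (1 / (1 + r\<^sup>2)) * (r\<^sup>2 / (1 + r\<^sup>2))"
      by (simp add: power_divide power2_eq_square)
    also have "\<dots> \<le> C\<^sup>2 * (1 / (1 + r\<^sup>2)) * 1"
      by (intro mult_left_mono) (auto simp: divide_le_eq_1_pos)
    finally show "ennreal (\<bar>r\<bar> * (C / (1 + \<bar>r\<bar>\<^sup>2))\<^sup>2) * ennreal \<bar>r\<bar> \<le> ennreal (C\<^sup>2 * (1 / (1 + r\<^sup>2)))"
      by (simp add: ennreal_leI flip: ennreal_mult)
  qed
  also have "\<dots> < \<infinity>"
  proof -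
    have "integrable lborel (\<lambda>r::real. C\<^sup>2 * (1 / (1 + r\<^sup>2)))" by (rule integrable_mult_right[OF cauchy_density_integral(1)])
    then show ?thesis by (simp add: integrable_iff_bounded)
  qed
  finally have "(\<integral>\<^sup>+\<xi>. (\<lambda>r. ennreal (r * (C / (1 + r\<^sup>2))\<^sup>2)) (norm (\<xi>::plane)) \<partial>lborel) < \<infinity>"
    unfolding eq by (simp add: ennreal_mult_less_top)
  then show ?thesis by (simp add: integrable_iff_bounded)
qed

lemma finite_energy_cap:
  assumes R: "0 < R" shows "finite_energy (cap R)"
proof -
  have "half_energy (cap R) \<le> (\<integral>\<^sup>+\<xi>. ennreal (norm (\<xi>::plane) * (cap_bound R / (1 + (norm \<xi>)\<^sup>2))\<^sup>2) \<partial>lborel)"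
    unfolding half_energy_def
    by (intro nn_integral_mono ennreal_leI mult_left_mono power_mono norm_FT_cap_le R) auto
  also have "\<dots> < \<infinity>" using integrable_cap_decay[of "cap_bound R"] by (simp add: integrable_iff_bounded)
  finally show ?thesis using L2_bounded_cap[OF R] by (simp add: finite_energy_def)
qed

section \<open>The Gaussian-regularized symbol of the half sphere on one line\<close>

lemma gauss_cos_integral:
  assumes \<epsilon>: "\<epsilon> > 0"
  shows "integrable lborel (\<lambda>r::real. exp (- \<epsilon> * r\<^sup>2) * cos (a * r))"
    and "(LBINT r. exp (- \<epsilon> * r\<^sup>2) * cos (a * r)) = sqrt (pi / \<epsilon>) * exp (- a\<^sup>2 / (4 * \<epsilon>))"
proof -
  note g = fourier_gaussian_real[OF \<epsilon>]
  let ?h = "\<lambda>r. exp (- \<i> * complex_of_real (a * r)) * complex_of_real (exp (- \<epsilon> * r\<^sup>2))"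
  have i: "integrable lborel ?h"
    by (rule Bochner_Integration.integrable_bound[OF g(1)]) (auto simp: norm_mult)
  have eq: "Re (?h r) = exp (- \<epsilon> * r\<^sup>2) * cos (a * r)" for r
    using cis_conv_exp[of "- (a * r)"] by (simp add: mult.commute complex_eq_iff)
  show "integrable lborel (\<lambda>r::real. exp (- \<epsilon> * r\<^sup>2) * cos (a * r))"
    unfolding eq[symmetric] by (rule integrable_Re[OF i])
  show "(LBINT r. exp (- \<epsilon> * r\<^sup>2) * cos (a * r)) = sqrt (pi / \<epsilon>) * exp (- a\<^sup>2 / (4 * \<epsilon>))"
    unfolding eq[symmetric] integral_Re[OF i] g(2) by simp
qed

text \<open>The transform of the regularizing factor: an approximate identity of mass
  \<open>2 * pi\<close> as \<open>\<epsilon>\<close> tends to 0.\<close>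

definition gauss_bump :: "real \<Rightarrow> real \<Rightarrow> real" where
  "gauss_bump \<epsilon> a = sqrt (pi / \<epsilon>) * exp (- a\<^sup>2 / (4 * \<epsilon>))"

text \<open>The contribution of one line through the origin to the regularized half Laplacian of
  \<open>cap R\<close>, at the point with coordinate \<open>u\<close> on that line. The bracket is
  the symbol times the transform times the Jacobian, see \<open>cap_symbol_slope\<close>.\<close>

definition cap_kernel :: "real \<Rightarrow> real \<Rightarrow> real \<Rightarrow> real" where
  "cap_kernel \<epsilon> R u = (LBINT r. exp (- \<epsilon> * r\<^sup>2) * ((sin (R * r) / r - R * cos (R * r)) * cos (u * r)))"

lemma integral_cos_Icc:
  assumes r: "r \<noteq> 0" and R: "R > (0::real)"
  shows "(LBINT \<rho>. indicator {-R..R} \<rho> * cos ((\<rho> + u) * r)) = 2 * (sin (R * r) / r * cos (u * r))"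
proof -
  let ?F = "\<lambda>\<rho>. sin ((\<rho> + u) * r) / r"
  have "has_bochner_integral lborel (\<lambda>\<rho>. indicator {-R..R} \<rho> *\<^sub>R cos ((\<rho> + u) * r)) (?F R - ?F (- R))"
  proof (rule has_bochner_integral_FTC_Icc)
    show "continuous_on {- R..R} (\<lambda>\<rho>. cos ((\<rho> + u) * r))" by (intro continuous_intros)
    fix \<rho>
    have "(?F has_real_derivative cos ((\<rho> + u) * r)) (at \<rho> within {-R..R})"
      using r by (auto intro!: derivative_eq_intros)
    then show "(?F has_vector_derivative cos ((\<rho> + u) * r)) (at \<rho> within {- R..R})"
      by (simp add: has_real_derivative_iff_has_vector_derivative)
  qed (use R in auto)
  then have "(LBINT \<rho>. indicator {-R..R} \<rho> * cos ((\<rho> + u) * r)) = ?F R - ?F (- R)"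
    by (simp add: has_bochner_integral_integral_eq)
  also have "\<dots> = (sin (R * r + u * r) - sin (u * r - R * r)) / r" by (simp add: distrib_right left_diff_distrib diff_divide_distrib add.commute)
  also have "\<dots> = 2 * (sin (R * r) / r * cos (u * r))"
    using r by (simp add: sin_add sin_diff field_simps)
  finally show ?thesis .
qed

text \<open>\<open>sin (R * r) / r\<close> is half the transform of the indicator of
  \<open>[-R, R]\<close>, and \<open>R * cos (R * r)\<close> is the transform of two point masses at
  its ends. Up to a factor this is minus the second derivative of the parabola cut off at 0,
  smoothed by the bump: constant inside the interval and singular only at its ends.\<close>

lemma cap_kernel_eq:
  assumes \<epsilon>: "\<epsilon> > 0" and R: "R > 0"
  shows "cap_kernel \<epsilon> R u = (LBINT \<rho>. indicator {-R..R} \<rho> * gauss_bump \<epsilon> (\<rho> + u)) / 2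
     - R / 2 * (gauss_bump \<epsilon> (R + u) + gauss_bump \<epsilon> (R - u))"
proof -
  let ?h = "\<lambda>p. exp (- \<epsilon> * (fst p)\<^sup>2) * (indicator {-R..R} (snd p) * cos ((snd p + u) * fst p))"
  have "integrable lborel (\<lambda>p. exp (- \<epsilon> * (fst p)\<^sup>2) * indicator {-R..R} (snd p :: real) :: real)"
    by (rule integrable_lborel_pair_mult[OF fourier_gaussian_real(1)[OF \<epsilon>]], rule integrable_real_indicator) (simp_all add: emeasure_lborel_Icc_eq)
  then have i: "integrable lborel ?h"
    by (rule Bochner_Integration.integrable_bound) (auto simp: abs_mult indicator_def)
  have i': "integrable lborel (\<lambda>r. LBINT \<rho>. ?h (r, \<rho>))"
    using lborel_pair.integrable_fst'[of ?h] i by (simp add: lborel_prod)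
  note gc = gauss_cos_integral[OF \<epsilon>, folded gauss_bump_def]
  have "cap_kernel \<epsilon> R u = (LBINT r. (LBINT \<rho>. ?h (r, \<rho>)) / 2
      - R / 2 * (exp (- \<epsilon> * r\<^sup>2) * cos ((R + u) * r) + exp (- \<epsilon> * r\<^sup>2) * cos ((R - u) * r)))"
    unfolding cap_kernel_def
  proof (rule integral_cong_AE)
    show "(\<lambda>r. (LBINT \<rho>. ?h (r, \<rho>)) / 2 - R / 2 * (exp (- \<epsilon> * r\<^sup>2) * cos ((R + u) * r) + exp (- \<epsilon> * r\<^sup>2) * cos ((R - u) * r))) \<in> borel_measurable lborel"
      using i' by auto
    have "AE r in lborel. r \<noteq> (0::real)" by (rule AE_lborel_singleton)
    then show "AE r in lborel. exp (- \<epsilon> * r\<^sup>2) * ((sin (R * r) / r - R * cos (R * r)) * cos (u * r))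
       = (LBINT \<rho>. ?h (r, \<rho>)) / 2 - R / 2 * (exp (- \<epsilon> * r\<^sup>2) * cos ((R + u) * r) + exp (- \<epsilon> * r\<^sup>2) * cos ((R - u) * r))"
    proof eventually_elim
      case (elim r)
      have "(LBINT \<rho>. ?h (r, \<rho>)) = exp (- \<epsilon> * r\<^sup>2) * (2 * (sin (R * r) / r * cos (u * r)))"
        by (simp only: fst_conv snd_conv integral_mult_right_zero integral_cos_Icc[OF elim R])
      moreover have "cos ((R + u) * r) + cos ((R - u) * r) = 2 * (cos (R * r) * cos (u * r))"
        by (simp add: distrib_right left_diff_distrib cos_add cos_diff)
      ultimately show ?case by (simp add: left_diff_distrib right_diff_distrib flip: distrib_left)
    qed
  qed measurable
  also have "\<dots> = (LBINT r. LBINT \<rho>. ?h (r, \<rho>)) / 2 - R / 2 * (gauss_bump \<epsilon> (R + u) + gauss_bump \<epsilon> (R - u))"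
    using i' gc(1) by (simp add: gc(2)[unfolded mult_minus_left])
  also have "(LBINT r. LBINT \<rho>. ?h (r, \<rho>)) = (LBINT \<rho>. LBINT r. ?h (r, \<rho>))"
    using integral_lborel_pair(1)[OF i] integral_lborel_pair(2)[OF i] by metis
  also have "\<dots> = (LBINT \<rho>. indicator {-R..R} \<rho> * gauss_bump \<epsilon> (\<rho> + u))"
  proof (rule Bochner_Integration.integral_cong[OF refl])
    fix \<rho>
    have "(LBINT r. ?h (r, \<rho>)) = (LBINT r. indicator {-R..R} \<rho> * (exp (- \<epsilon> * r\<^sup>2) * cos ((\<rho> + u) * r)))"
      by (simp add: mult.left_commute)
    then show "(LBINT r. ?h (r, \<rho>)) = indicator {-R..R} \<rho> * gauss_bump \<epsilon> (\<rho> + u)"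
      by (simp add: gc(2)[unfolded mult_minus_left])
  qed
  finally show ?thesis .
qed

text \<open>Away from 0, the first bound is uniform in \<open>\<epsilon>\<close> and serves for
  domination; the second vanishes with \<open>\<epsilon>\<close> and gives the limit.\<close>

lemma gauss_bump_le:
  assumes \<epsilon>: "\<epsilon> > 0" and \<delta>: "\<delta> > 0" "\<delta> \<le> \<bar>a\<bar>"
  shows "gauss_bump \<epsilon> a \<le> sqrt pi / \<delta>" "gauss_bump \<epsilon> a \<le> 4 * sqrt (pi * \<epsilon>) / \<delta>\<^sup>2"
proof -
  have d: "\<delta>\<^sup>2 \<le> a\<^sup>2" using \<delta> by (metis abs_le_square_iff abs_of_pos)
  define s where "s = sqrt \<epsilon>"
  have s: "s > 0" "\<epsilon> = s\<^sup>2" using \<epsilon> by (auto simp: s_def)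
  define x where "x = \<delta>\<^sup>2 / (4 * \<epsilon>)"
  have x: "x > 0" using \<epsilon> \<delta> by (simp add: x_def)
  have "exp (- a\<^sup>2 / (4 * \<epsilon>)) \<le> exp (- x)" using d \<epsilon> by (simp add: x_def divide_right_mono)
  also have "\<dots> = 1 / exp x" by (simp add: exp_minus inverse_eq_divide)
  also have "\<dots> \<le> 1 / (1 + x)" using exp_ge_add_one_self[of x] x by (intro divide_left_mono) auto
  finally have e: "exp (- a\<^sup>2 / (4 * \<epsilon>)) \<le> 1 / (1 + x)" .
  have sq: "sqrt (pi / \<epsilon>) = sqrt pi / s" by (simp add: real_sqrt_divide s_def)
  have "\<delta> / s \<le> 1 + x"
  proof -
    \<comment> \<open>The arithmetic-geometric mean inequality, as \<open>x\<close> is the square of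
      \<open>\<delta> / (2 * s)\<close>.\<close>
    have "0 \<le> (1 - \<delta> / (2 * s))\<^sup>2" by simp
    also have "\<dots> = 1 + x - \<delta> / s" using s by (simp add: x_def power2_eq_square field_simps)
    finally show ?thesis by simp
  qed
  then have "1 / (1 + x) \<le> 1 / (\<delta> / s)" using \<delta> s x by (intro divide_left_mono) auto
  with e have "exp (- a\<^sup>2 / (4 * \<epsilon>)) \<le> s / \<delta>" by simp
  then have "gauss_bump \<epsilon> a \<le> sqrt pi / s * (s / \<delta>)"
    unfolding gauss_bump_def sq using s by (intro mult_left_mono) auto
  then show "gauss_bump \<epsilon> a \<le> sqrt pi / \<delta>" using s by simp
  have "1 / (1 + x) \<le> 1 / x" using x by (intro divide_left_mono) auto
  with e have "exp (- a\<^sup>2 / (4 * \<epsilon>)) \<le> 4 * s\<^sup>2 / \<delta>\<^sup>2" by (simp add: x_def s)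
  then have "gauss_bump \<epsilon> a \<le> sqrt pi / s * (4 * s\<^sup>2 / \<delta>\<^sup>2)"
    unfolding gauss_bump_def sq using s by (intro mult_left_mono) auto
  also have "\<dots> = 4 * sqrt (pi * \<epsilon>) / \<delta>\<^sup>2" using s by (simp add: real_sqrt_mult s_def[symmetric] power2_eq_square)
  finally show "gauss_bump \<epsilon> a \<le> 4 * sqrt (pi * \<epsilon>) / \<delta>\<^sup>2" .
qed

lemma gauss_bump_nonneg [simp]: "\<epsilon> > 0 \<Longrightarrow> 0 \<le> gauss_bump \<epsilon> a"
  by (simp add: gauss_bump_def)

lemma exp_square_integral:
  "integrable lborel (\<lambda>z::real. exp (- z\<^sup>2))" "(LBINT z. exp (- z\<^sup>2)) = sqrt pi"
  using gauss_cos_integral[of 1 0] by simp_all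

lemma integral_gauss_bump:
  assumes \<epsilon>: "\<epsilon> > 0"
  shows "(LBINT \<rho>. indicator {-R..R} \<rho> * gauss_bump \<epsilon> (\<rho> + u))
    = 2 * sqrt pi * (LBINT z. indicator {-R..R} (2 * sqrt \<epsilon> * z - u) * exp (- z\<^sup>2))"
proof -
  have s: "2 * sqrt \<epsilon> \<noteq> 0" using \<epsilon> by simp
  have "gauss_bump \<epsilon> (- u + 2 * sqrt \<epsilon> * z + u) = sqrt pi / sqrt \<epsilon> * exp (- z\<^sup>2)" for z
    using \<epsilon> by (simp add: gauss_bump_def power_mult_distrib real_sqrt_divide)
  then have "(LBINT \<rho>. indicator {-R..R} \<rho> * gauss_bump \<epsilon> (\<rho> + u))
    = \<bar>2 * sqrt \<epsilon>\<bar> *\<^sub>R (LBINT z. indicator {-R..R} (- u + 2 * sqrt \<epsilon> * z) * (sqrt pi / sqrt \<epsilon> * exp (- z\<^sup>2)))"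
    by (subst lborel_integral_real_affine[OF s, of _ "- u"]) simp
  also have "\<dots> = 2 * sqrt \<epsilon> * (sqrt pi / sqrt \<epsilon> * (LBINT z. indicator {-R..R} (2 * sqrt \<epsilon> * z - u) * exp (- z\<^sup>2)))"
    using \<epsilon> by (simp add: mult.left_commute[of _ "sqrt pi / sqrt \<epsilon>"] add.commute[of "- u"] del: times_divide_eq_left times_divide_eq_right)
  finally show ?thesis using \<epsilon> by simp
qed

text \<open>The end-point terms blow up as \<open>\<bar>u\<bar>\<close> approaches \<open>R\<close>.
  The margin \<open>R - R'\<close> keeps the bound uniform in \<open>\<epsilon>\<close>, which is
  why test functions are first supported in a smaller disc.\<close>

lemma abs_cap_kernel_le:
  assumes \<epsilon>: "\<epsilon> > 0" and u: "\<bar>u\<bar> \<le> R'" "0 < R'" "R' < R"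
  shows "\<bar>cap_kernel \<epsilon> R u\<bar> \<le> pi + R * sqrt pi / (R - R')"
proof -
  have R: "R > 0" using u by simp
  let ?I = "LBINT z. indicator {-R..R} (2 * sqrt \<epsilon> * z - u) * exp (- z\<^sup>2)"
  have I0: "0 \<le> ?I" by (intro integral_nonneg_AE) auto
  have "?I \<le> (\<integral>z. exp (- z\<^sup>2) \<partial>(lborel :: real measure))"
  proof (rule integral_mono)
    show "integrable lborel (\<lambda>z. indicator {-R..R} (2 * sqrt \<epsilon> * z - u) * exp (- z\<^sup>2))"
      by (rule Bochner_Integration.integrable_bound[OF exp_square_integral(1)]) (auto simp: indicator_def)
  qed (auto simp: exp_square_integral indicator_def)
  then have I1: "?I \<le> sqrt pi" by (simp add: exp_square_integral)
  have b: "gauss_bump \<epsilon> (R + u) \<le> sqrt pi / (R - R')" "gauss_bump \<epsilon> (R - u) \<le> sqrt pi / (R - R')"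
    using u by (auto intro!: gauss_bump_le(1)[OF \<epsilon>])
  have eq: "cap_kernel \<epsilon> R u = sqrt pi * ?I - R / 2 * (gauss_bump \<epsilon> (R + u) + gauss_bump \<epsilon> (R - u))"
    unfolding cap_kernel_eq[OF \<epsilon> R] integral_gauss_bump[OF \<epsilon>] by simp
  have 1: "0 \<le> sqrt pi * ?I" using I0 by simp
  have "sqrt pi * ?I \<le> sqrt pi * sqrt pi" using I1 by (intro mult_left_mono) auto
  then have 2: "sqrt pi * ?I \<le> pi" by simp
  have 3: "0 \<le> R / 2 * (gauss_bump \<epsilon> (R + u) + gauss_bump \<epsilon> (R - u))"
    using R \<epsilon> by (intro mult_nonneg_nonneg add_nonneg_nonneg) auto
  have "R / 2 * (gauss_bump \<epsilon> (R + u) + gauss_bump \<epsilon> (R - u)) \<le> R / 2 * (sqrt pi / (R - R') + sqrt pi / (R - R'))"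
    using R b by (intro mult_left_mono add_mono) auto
  also have "\<dots> = R * sqrt pi / (R - R')" by simp
  finally show ?thesis unfolding eq using 1 2 3 by linarith
qed

text \<open>Inside the interval the bump contributes its whole mass \<open>2 * pi\<close>, taken
  with the factor 1/2, while the bumps centered at the ends die out.\<close>

lemma cap_kernel_tendsto:
  assumes u: "\<bar>u\<bar> < R"
  shows "(\<lambda>n. cap_kernel (1 / real (Suc n)) R u) \<longlonglongrightarrow> pi"
proof -
  have R: "R > 0" using u by simp
  let ?\<epsilon> = "\<lambda>n. 1 / real (Suc n)"
  let ?I = "\<lambda>n. LBINT z. indicator {-R..R} (2 * sqrt (?\<epsilon> n) * z - u) * exp (- z\<^sup>2)"
  have s0: "(\<lambda>n. sqrt (?\<epsilon> n)) \<longlonglongrightarrow> 0"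
  proof -
    have "(\<lambda>n. sqrt (?\<epsilon> n)) \<longlonglongrightarrow> sqrt 0" by (intro tendsto_intros LIMSEQ_Suc lim_const_over_n)
    then show ?thesis by simp
  qed
  have "?I \<longlonglongrightarrow> (\<integral>z. exp (- z\<^sup>2) \<partial>(lborel :: real measure))"
  proof (rule integral_dominated_convergence[where w="\<lambda>z. exp (- z\<^sup>2)"])
    show "AE z in lborel. (\<lambda>n. indicator {-R..R} (2 * sqrt (?\<epsilon> n) * z - u) * exp (- z\<^sup>2)) \<longlonglongrightarrow> exp (- z\<^sup>2)"
    proof (intro AE_I2)
      fix z :: real
      have "(\<lambda>n. 2 * sqrt (?\<epsilon> n) * z - u) \<longlonglongrightarrow> 2 * 0 * z - u" by (intro tendsto_intros s0)
      then have "\<forall>\<^sub>F n in sequentially. 2 * sqrt (?\<epsilon> n) * z - u \<in> {-R<..<R}"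
        by (rule topological_tendstoD) (use u in auto)
      then show "(\<lambda>n. indicator {-R..R} (2 * sqrt (?\<epsilon> n) * z - u) * exp (- z\<^sup>2)) \<longlonglongrightarrow> exp (- z\<^sup>2)"
        by (intro tendsto_eventually) (auto elim!: eventually_mono)
    qed
  qed (auto simp: exp_square_integral indicator_def)
  then have I: "?I \<longlonglongrightarrow> sqrt pi" by (simp only: exp_square_integral)
  have b: "(\<lambda>n. gauss_bump (?\<epsilon> n) a) \<longlonglongrightarrow> 0" if "a \<noteq> 0" for a
  proof (rule tendsto_sandwich[OF _ _ tendsto_const])
    show "\<forall>\<^sub>F n in sequentially. 0 \<le> gauss_bump (?\<epsilon> n) a" by simp
    show "\<forall>\<^sub>F n in sequentially. gauss_bump (?\<epsilon> n) a \<le> 4 * (sqrt pi * sqrt (?\<epsilon> n)) / \<bar>a\<bar>\<^sup>2"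
    proof (intro always_eventually allI)
      fix n show "gauss_bump (?\<epsilon> n) a \<le> 4 * (sqrt pi * sqrt (?\<epsilon> n)) / \<bar>a\<bar>\<^sup>2"
        using gauss_bump_le(2)[of "?\<epsilon> n" "\<bar>a\<bar>" a] that unfolding real_sqrt_mult by simp
    qed
    have "(\<lambda>n. 4 * (sqrt pi * sqrt (?\<epsilon> n)) / \<bar>a\<bar>\<^sup>2) \<longlonglongrightarrow> 4 * (sqrt pi * 0) / \<bar>a\<bar>\<^sup>2"
      by (intro tendsto_intros s0) (use that in auto)
    then show "(\<lambda>n. 4 * (sqrt pi * sqrt (?\<epsilon> n)) / \<bar>a\<bar>\<^sup>2) \<longlonglongrightarrow> 0" by simp
  qed
  have "(\<lambda>n. sqrt pi * ?I n - R / 2 * (gauss_bump (?\<epsilon> n) (R + u) + gauss_bump (?\<epsilon> n) (R - u))) \<longlonglongrightarrow>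
     sqrt pi * sqrt pi - R / 2 * (0 + 0)"
    by (intro tendsto_intros I b) (use u in auto)
  moreover have "cap_kernel (?\<epsilon> n) R u = sqrt pi * ?I n - R / 2 * (gauss_bump (?\<epsilon> n) (R + u) + gauss_bump (?\<epsilon> n) (R - u))" for n
  proof -
    have "?\<epsilon> n > 0" by simp
    then show ?thesis by (simp add: cap_kernel_eq[OF _ R] integral_gauss_bump)
  qed
  ultimately show ?thesis by simp
qed

text \<open>One factor \<open>\<bar>r\<bar>\<close> is the symbol of the half Laplacian, the other
  comes from the Jacobian. Their product is free of absolute values, and the result is an even
  function of \<open>r\<close> in which the sign of \<open>r\<close> disappears.\<close>

lemma cap_symbol_slope:
  assumes R: "R > 0" and r: "r \<noteq> 0"
  shows "\<bar>r\<bar> * Re (FT (cap R) (slope_point s r)) * \<bar>r\<bar> = sin (R * r) / r - R * cos (R * r)"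
proof -
  have "slope_point s r \<noteq> 0" using norm_slope_point[of s r] r by (metis abs_eq_0 norm_zero)
  then have "Re (FT (cap R) (slope_point s r)) = (sin (R * \<bar>r\<bar>) - R * \<bar>r\<bar> * cos (R * \<bar>r\<bar>)) / \<bar>r\<bar> ^ 3"
    by (simp add: FT_cap[OF R])
  also have "\<dots> = (sin (R * r) / r - R * cos (R * r)) / (r * r)"
    using r by (cases "r > 0") (auto simp: field_simps power3_eq_cube abs_if)
  finally show ?thesis using r by (simp add: field_simps abs_mult_self_eq)
qed

text \<open>This is \<open>2 * pi\<close> times the regularized half Laplacian of
  \<open>cap R\<close> at \<open>x\<close>, expressed as an average over lines through the
  origin.\<close>

lemma integral_cap_symbol:
  assumes \<epsilon>: "\<epsilon> > 0" and R: "R > 0"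
  shows "integrable lborel (\<lambda>\<xi>. exp (- \<epsilon> * (norm \<xi>)\<^sup>2) * (norm \<xi> * Re (FT (cap R) \<xi>)))"
    and "(LBINT \<xi>. exp (- \<epsilon> * (norm \<xi>)\<^sup>2) * (norm \<xi> * Re (FT (cap R) \<xi>)) * cos (x \<bullet> \<xi>))
      = (LBINT s. 1 / (1 + s\<^sup>2) * cap_kernel \<epsilon> R (slope_height s x))"
proof -
  let ?W = "\<lambda>\<xi>. exp (- \<epsilon> * (norm \<xi>)\<^sup>2) * (norm \<xi> * Re (FT (cap R) \<xi>))"
  have i0: "integrable lborel (\<lambda>\<xi>::plane. exp (- \<epsilon> * (norm \<xi>)\<^sup>2) * cap_bound R)"
    by (rule integrable_mult_left[OF fourier_gaussian(1)[OF \<epsilon>]])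
  have bound: "norm \<xi> * \<bar>Re (FT (cap R) \<xi>)\<bar> \<le> cap_bound R" for \<xi> :: plane
  proof -
    have "norm \<xi> \<le> 1 + (norm \<xi>)\<^sup>2" using sum_squares_bound[of 1 "norm \<xi>"] norm_ge_zero[of \<xi>]
      unfolding power_one by linarith
    then have "norm \<xi> * \<bar>Re (FT (cap R) \<xi>)\<bar> \<le> (1 + (norm \<xi>)\<^sup>2) * (cap_bound R / (1 + (norm \<xi>)\<^sup>2))"
      using norm_FT_cap_le[OF R order.refl, of \<xi>] abs_Re_le_cmod[of "FT (cap R) \<xi>"]
      by (intro mult_mono) (auto intro: order_trans)
    then show ?thesis by simp
  qed
  show i: "integrable lborel ?W"
  proof (rule Bochner_Integration.integrable_bound[OF i0])
    show "AE \<xi> in lborel. norm (?W \<xi>) \<le> norm (exp (- \<epsilon> * (norm \<xi>)\<^sup>2) * cap_bound R)"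
      using bound by (auto simp: abs_mult intro!: AE_I2 mult_left_mono intro: order_trans[OF _ abs_ge_self])
  qed measurable
  have i': "integrable lborel (\<lambda>\<xi>. ?W \<xi> * cos (x \<bullet> \<xi>))"
    by (rule Bochner_Integration.integrable_bound[OF i]) (auto simp: abs_mult intro!: AE_I2 mult_left_mono mult_left_le)
  have "(LBINT \<xi>. ?W \<xi> * cos (x \<bullet> \<xi>))
     = (LBINT s. LBINT r. ?W (slope_point s r) * cos (x \<bullet> slope_point s r) * (\<bar>r\<bar> / (1 + s\<^sup>2)))"
    by (rule integral_slope[OF i'])
  also have "\<dots> = (LBINT s. 1 / (1 + s\<^sup>2) * cap_kernel \<epsilon> R (slope_height s x))"
  proof (rule Bochner_Integration.integral_cong[OF refl])
    fix s
    let ?h = "slope_height s x"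
    have "(LBINT r. ?W (slope_point s r) * cos (x \<bullet> slope_point s r) * (\<bar>r\<bar> / (1 + s\<^sup>2)))
      = (LBINT r. 1 / (1 + s\<^sup>2) * (exp (- \<epsilon> * r\<^sup>2) * ((sin (R * r) / r - R * cos (R * r)) * cos (?h * r))))"
    proof (rule integral_cong_AE)
      have "AE r in lborel. r \<noteq> (0::real)" by (rule AE_lborel_singleton)
      then show "AE r in lborel. ?W (slope_point s r) * cos (x \<bullet> slope_point s r) * (\<bar>r\<bar> / (1 + s\<^sup>2))
        = 1 / (1 + s\<^sup>2) * (exp (- \<epsilon> * r\<^sup>2) * ((sin (R * r) / r - R * cos (R * r)) * cos (?h * r)))"
      proof eventually_elim
        case (elim r)
        show ?case unfolding cap_symbol_slope[OF R elim, of s, symmetric]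
          by (simp add: inner_slope_point mult_ac)
      qed
      show "(\<lambda>r. ?W (slope_point s r) * cos (x \<bullet> slope_point s r) * (\<bar>r\<bar> / (1 + s\<^sup>2))) \<in> borel_measurable lborel"
        using measurable_compose[OF measurable_slope_point'[of s] measurable_FT[OF measurable_cap[of R]]] by measurable
    qed measurable
    then show "(LBINT r. ?W (slope_point s r) * cos (x \<bullet> slope_point s r) * (\<bar>r\<bar> / (1 + s\<^sup>2)))
      = 1 / (1 + s\<^sup>2) * cap_kernel \<epsilon> R ?h"
      by (simp only: cap_kernel_def integral_mult_right_zero)
  qed
  finally show "(LBINT \<xi>. ?W \<xi> * cos (x \<bullet> \<xi>)) = (LBINT s. 1 / (1 + s\<^sup>2) * cap_kernel \<epsilon> R (slope_height s x))" .
qed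

lemma measurable_slope_height [measurable]:
  assumes "f \<in> borel_measurable M" "g \<in> borel_measurable M"
  shows "(\<lambda>p. slope_height (f p) (g p)) \<in> borel_measurable M"
proof (rule borel_measurable_continuous_Pair[OF assms])
  show "continuous_on UNIV (\<lambda>x. slope_height (fst x) (snd x))"
    unfolding slope_height_def by (intro continuous_intros) auto
qed

lemma measurable_cap_kernel [measurable]: "cap_kernel \<epsilon> R \<in> borel_measurable borel"
  unfolding cap_kernel_def by measurable

text \<open>Each line gives \<open>pi\<close> in the limit, and the total mass of the slopes is
  \<open>pi\<close>. Divided by \<open>2 * pi\<close>, this is the value \<open>pi / 2\<close> of
  the half Laplacian of the half sphere inside the disc.\<close>

lemma slope_average_tendsto:
  assumes x: "norm x \<le> R'" and R: "0 < R'" "R' < R"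
  shows "(\<lambda>n. LBINT s. 1 / (1 + s\<^sup>2) * cap_kernel (1 / real (Suc n)) R (slope_height s x)) \<longlonglongrightarrow> pi\<^sup>2"
    and "\<bar>LBINT s. 1 / (1 + s\<^sup>2) * cap_kernel (1 / real (Suc n)) R (slope_height s x)\<bar> \<le> pi * (pi + R * sqrt pi / (R - R'))"
proof -
  let ?K = "pi + R * sqrt pi / (R - R')"
  let ?F = "\<lambda>n s. 1 / (1 + s\<^sup>2) * cap_kernel (1 / real (Suc n)) R (slope_height s x)"
  have h: "\<bar>slope_height s x\<bar> \<le> R'" for s using abs_slope_height_le[of s x] x by simp
  have b: "norm (?F n s) \<le> 1 / (1 + s\<^sup>2) * ?K" for n s
    unfolding norm_mult using abs_cap_kernel_le[OF _ h R, of "1 / real (Suc n)" s]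
    by (intro mult_mono) (auto simp: abs_of_pos)
  have i: "integrable lborel (\<lambda>s::real. 1 / (1 + s\<^sup>2) * ?K)" by (rule integrable_mult_left[OF cauchy_density_integral(1)])
  have "(\<lambda>n. LBINT s. ?F n s) \<longlonglongrightarrow> (LBINT s. 1 / (1 + s\<^sup>2) * pi)"
  proof (rule integral_dominated_convergence[OF _ _ i])
    show "AE s in lborel. (\<lambda>n. ?F n s) \<longlonglongrightarrow> 1 / (1 + s\<^sup>2) * pi"
      using h R by (intro AE_I2 tendsto_intros cap_kernel_tendsto) (auto intro: le_less_trans)
    show "AE s in lborel. norm (?F n s) \<le> 1 / (1 + s\<^sup>2) * ?K" for n using b by auto
  qed measurable
  also have "(LBINT s. 1 / (1 + s\<^sup>2) * pi) = pi\<^sup>2"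
    unfolding integral_mult_left_zero cauchy_density_integral(2) by (simp add: power2_eq_square)
  finally show "(\<lambda>n. LBINT s. ?F n s) \<longlonglongrightarrow> pi\<^sup>2" .
  have "integrable lborel (?F n)"
  proof (rule Bochner_Integration.integrable_bound[OF i])
    show "AE s in lborel. norm (?F n s) \<le> norm (1 / (1 + s\<^sup>2) * ?K)"
      by (intro AE_I2 order_trans[OF b]) (simp only: real_norm_def abs_ge_self)
  qed measurable
  have "\<bar>LBINT s. ?F n s\<bar> \<le> (LBINT s. \<bar>?F n s\<bar>)" by (rule integral_abs_bound)
  also have "\<dots> \<le> (LBINT s. 1 / (1 + s\<^sup>2) * ?K)"
    using b by (intro integral_mono integrable_abs \<open>integrable lborel (?F n)\<close> i) (simp only: real_norm_def)
  also have "\<dots> = pi * ?K" unfolding integral_mult_left_zero cauchy_density_integral(2) ..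
  finally show "\<bar>LBINT s. ?F n s\<bar> \<le> pi * ?K" .
qed

lemma Re_FT:
  assumes f: "integrable lborel f"
  shows "Re (FT f \<xi>) = (LBINT x. cos (x \<bullet> \<xi>) * f x) / (2 * pi)"
proof -
  have [measurable]: "f \<in> borel_measurable borel" using f by auto
  have "Re (exp (- \<i> * complex_of_real (x \<bullet> \<xi>)) * complex_of_real (f x)) = cos (x \<bullet> \<xi>) * f x" for x
    using cis_conv_exp[of "- (x \<bullet> \<xi>)"] by (simp add: complex_eq_iff)
  then have "Re (LBINT x. exp (- \<i> * complex_of_real (x \<bullet> \<xi>)) * complex_of_real (f x)) = (LBINT x. cos (x \<bullet> \<xi>) * f x)"
    by (simp only: integral_Re[OF integrable_fourier_kernel[OF f], symmetric])
  then show ?thesis by (simp add: FT_lborel)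
qed

lemma AE_FT_cap_real:
  assumes R: "R > 0"
  shows "AE \<xi> in lborel. Re (complex_of_real (norm \<xi>) * FT (cap R) \<xi> * cnj (FT g \<xi>)) = norm \<xi> * Re (FT (cap R) \<xi>) * Re (FT g \<xi>)"
proof -
  have "AE \<xi> in lborel. \<xi> \<noteq> (0::plane)" by (rule AE_lborel_singleton)
  then show ?thesis by eventually_elim (simp add: FT_cap[OF R])
qed

text \<open>The regularized pairing has two limits. On the Fourier side the Gaussian is removed by
  dominated convergence, since the pairing converges absolutely; on the physical side the slope
  average converges boundedly on the support of \<open>\<phi>\<close>. Comparing them gives the
  claim.\<close>

lemma half_pairing_cap_smaller:
  assumes \<phi>: "finite_energy \<phi>" and s: "\<And>x. norm x > R' \<Longrightarrow> \<phi> x = 0" and R: "0 < R'" "R' < R"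
  shows "half_pairing (cap R) \<phi> = pi / 2 * (LBINT x. \<phi> x)"
proof -
  have R0: "R > 0" using R by simp
  note L = finite_energy_L2[OF \<phi>]
  note [measurable] = L2_bounded_measurable[OF L]
  note \<phi>i = L2_bounded_integrable[OF L]
  let ?\<epsilon> = "\<lambda>n. 1 / real (Suc n)"
  let ?e = "\<lambda>n (\<xi>::plane). exp (- ?\<epsilon> n * (norm \<xi>)\<^sup>2)"
  let ?M = "\<lambda>\<xi>. norm \<xi> * Re (FT (cap R) \<xi>)"
  let ?A = "\<lambda>n x. LBINT s. 1 / (1 + s\<^sup>2) * cap_kernel (?\<epsilon> n) R (slope_height s x)"
  let ?P = "\<lambda>n. LBINT \<xi>. ?e n \<xi> * (?M \<xi> * Re (FT \<phi> \<xi>))"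
  note ip = integrable_half_pairing[OF finite_energy_cap[OF R0] \<phi>]
  have iM: "integrable lborel (\<lambda>\<xi>. ?M \<xi> * Re (FT \<phi> \<xi>))"
  proof (subst integrable_cong_AE)
    show "AE \<xi> in lborel. ?M \<xi> * Re (FT \<phi> \<xi>) = Re (complex_of_real (norm \<xi>) * FT (cap R) \<xi> * cnj (FT \<phi> \<xi>))"
      using AE_FT_cap_real[OF R0, of \<phi>] by eventually_elim simp
    show "integrable lborel (\<lambda>\<xi>. Re (complex_of_real (norm \<xi>) * FT (cap R) \<xi> * cnj (FT \<phi> \<xi>)))" by (rule integrable_Re[OF ip])
  qed measurable
  have hp: "half_pairing (cap R) \<phi> = (LBINT \<xi>. ?M \<xi> * Re (FT \<phi> \<xi>))"
    unfolding half_pairing_def integral_Re[OF ip, symmetric]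
    by (rule integral_cong_AE) (use AE_FT_cap_real[OF R0, of \<phi>] in auto)
  have lim1: "?P \<longlonglongrightarrow> half_pairing (cap R) \<phi>"
    unfolding hp
  proof (rule integral_dominated_convergence[OF _ _ integrable_norm[OF iM]])
    show "AE \<xi> in lborel. (\<lambda>n. ?e n \<xi> * (?M \<xi> * Re (FT \<phi> \<xi>))) \<longlonglongrightarrow> ?M \<xi> * Re (FT \<phi> \<xi>)"
    proof (intro AE_I2)
      fix \<xi> :: plane
      have "(\<lambda>n. ?e n \<xi> * (?M \<xi> * Re (FT \<phi> \<xi>))) \<longlonglongrightarrow> exp (- 0 * (norm \<xi>)\<^sup>2) * (?M \<xi> * Re (FT \<phi> \<xi>))"
        by (intro tendsto_intros LIMSEQ_Suc lim_const_over_n)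
      then show "(\<lambda>n. ?e n \<xi> * (?M \<xi> * Re (FT \<phi> \<xi>))) \<longlonglongrightarrow> ?M \<xi> * Re (FT \<phi> \<xi>)" by simp
    qed
    show "AE \<xi> in lborel. norm (?e n \<xi> * (?M \<xi> * Re (FT \<phi> \<xi>))) \<le> norm (?M \<xi> * Re (FT \<phi> \<xi>))" for n
      unfolding norm_mult by (intro AE_I2 mult_left_le_one_le) auto
  qed measurable
  have P: "?P n = (LBINT x. \<phi> x * ?A n x) / (2 * pi)" for n
  proof -
    have \<epsilon>: "?\<epsilon> n > 0" by simp
    note W = integral_cap_symbol[OF \<epsilon> R0]
    let ?h = "\<lambda>p. ?e n (fst p) * ?M (fst p) * cos (snd p \<bullet> fst p) * \<phi> (snd p)"
    have ih: "integrable lborel ?h"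
      by (rule Bochner_Integration.integrable_bound[OF integrable_lborel_pair_mult[OF W(1) \<phi>i]])
         (auto simp: abs_mult intro!: AE_I2 mult_left_mono mult_left_le_one_le)
    have "?P n = (LBINT \<xi>. (LBINT x. ?h (\<xi>, x)) / (2 * pi))"
      by (simp add: Re_FT[OF \<phi>i] mult.assoc)
    also have "\<dots> = (LBINT \<xi>. LBINT x. ?h (\<xi>, x)) / (2 * pi)" by simp
    also have "(LBINT \<xi>. LBINT x. ?h (\<xi>, x)) = (LBINT x. LBINT \<xi>. ?h (\<xi>, x))"
      using integral_lborel_pair(1)[OF ih] integral_lborel_pair(2)[OF ih] by metis
    also have "\<dots> = (LBINT x. \<phi> x * ?A n x)"
      by (simp only: fst_conv snd_conv integral_mult_left_zero W(2) mult.commute[of "\<phi> _"])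
    finally show ?thesis .
  qed
  have "(\<lambda>n. LBINT x. \<phi> x * ?A n x) \<longlonglongrightarrow> (LBINT x. \<phi> x * pi\<^sup>2)"
  proof (rule integral_dominated_convergence[where w="\<lambda>x. \<bar>\<phi> x\<bar> * (pi * (pi + R * sqrt pi / (R - R')))"])
    show "integrable lborel (\<lambda>x. \<bar>\<phi> x\<bar> * (pi * (pi + R * sqrt pi / (R - R'))))"
      using \<phi>i by (intro integrable_mult_left integrable_abs)
    show "AE x in lborel. (\<lambda>n. \<phi> x * ?A n x) \<longlonglongrightarrow> \<phi> x * pi\<^sup>2"
    proof (intro AE_I2)
      fix x show "(\<lambda>n. \<phi> x * ?A n x) \<longlonglongrightarrow> \<phi> x * pi\<^sup>2"
      proof (cases "norm x > R'")
        case False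
        then show ?thesis using R by (intro tendsto_intros slope_average_tendsto(1)[of x R']) auto
      qed (simp add: s)
    qed
    show "AE x in lborel. norm (\<phi> x * ?A n x) \<le> \<bar>\<phi> x\<bar> * (pi * (pi + R * sqrt pi / (R - R')))" for n
    proof (intro AE_I2)
      fix x show "norm (\<phi> x * ?A n x) \<le> \<bar>\<phi> x\<bar> * (pi * (pi + R * sqrt pi / (R - R')))"
      proof (cases "norm x > R'")
        case False
        then show ?thesis
          unfolding real_norm_def abs_mult using R by (intro mult_left_mono slope_average_tendsto(2)) auto
      qed (simp add: s)
    qed
    show "(\<lambda>x. \<phi> x * ?A n x) \<in> borel_measurable lborel" for n
      by measurable
  qed measurable
  then have "(\<lambda>n. (LBINT x. \<phi> x * ?A n x) / (2 * pi)) \<longlonglongrightarrow> (LBINT x. \<phi> x * pi\<^sup>2) / (2 * pi)"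
    by (intro tendsto_intros) auto
  then have "?P \<longlonglongrightarrow> (LBINT x. \<phi> x * pi\<^sup>2) / (2 * pi)" unfolding P .
  then have "half_pairing (cap R) \<phi> = (LBINT x. \<phi> x * pi\<^sup>2) / (2 * pi)"
    using lim1 LIMSEQ_unique by blast
  also have "\<dots> = pi / 2 * (LBINT x. \<phi> x)" by (simp add: power2_eq_square)
  finally show ?thesis .
qed

text \<open>To admit supports reaching the circle, the radius is enlarged to
  \<open>R + 1 / real (Suc n)\<close>. The transform of the half sphere is continuous in the radius,
  and \<open>cap_bound (R + 1)\<close> dominates all of them.\<close>

lemma half_pairing_cap:
  assumes \<phi>: "finite_energy \<phi>" and s: "\<And>x. norm x > R \<Longrightarrow> \<phi> x = 0" and R: "0 < R"
  shows "half_pairing (cap R) \<phi> = pi / 2 * (LBINT x. \<phi> x)"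
proof -
  note L = finite_energy_L2[OF \<phi>]
  note [measurable] = L2_bounded_measurable[OF L]
  let ?R = "\<lambda>n. R + 1 / real (Suc n)"
  let ?F = "\<lambda>R \<xi>. complex_of_real (norm \<xi>) * FT (cap R) \<xi> * cnj (FT \<phi> \<xi>)"
  let ?C = "cap_bound (R + 1)"
  let ?b = "\<lambda>\<xi>::plane. norm \<xi> * (?C / (1 + (norm \<xi>)\<^sup>2))\<^sup>2"
  have Rn: "0 < ?R n" "?R n \<le> R + 1" for n using R by (auto intro: add_pos_pos)
  have Rlim: "?R \<longlonglongrightarrow> R"
  proof -
    have "?R \<longlonglongrightarrow> R + 0" by (intro tendsto_intros LIMSEQ_Suc lim_const_over_n)
    then show ?thesis by simp
  qed
  note bi = integrable_cap_decay[of ?C]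
  have "(\<lambda>n. LBINT \<xi>. ?F (?R n) \<xi>) \<longlonglongrightarrow> (LBINT \<xi>. ?F R \<xi>)"
  proof (rule integral_dominated_convergence[where w="\<lambda>\<xi>. ?b \<xi> + norm \<xi> * (norm (FT \<phi> \<xi>))\<^sup>2"])
    show "integrable lborel (\<lambda>\<xi>. ?b \<xi> + norm \<xi> * (norm (FT \<phi> \<xi>))\<^sup>2)"
      by (intro Bochner_Integration.integrable_add bi finite_energy_integrable \<phi>)
    have "AE \<xi> in lborel. \<xi> \<noteq> (0::plane)" by (rule AE_lborel_singleton)
    then show "AE \<xi> in lborel. (\<lambda>n. ?F (?R n) \<xi>) \<longlonglongrightarrow> ?F R \<xi>"
    proof eventually_elim
      case (elim \<xi>)
      have "(\<lambda>n. complex_of_real ((sin (?R n * norm \<xi>) - ?R n * norm \<xi> * cos (?R n * norm \<xi>)) / norm \<xi> ^ 3))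
         \<longlonglongrightarrow> complex_of_real ((sin (R * norm \<xi>) - R * norm \<xi> * cos (R * norm \<xi>)) / norm \<xi> ^ 3)"
        by (intro tendsto_intros Rlim) (use elim in auto)
      then have "(\<lambda>n. FT (cap (?R n)) \<xi>) \<longlonglongrightarrow> FT (cap R) \<xi>"
        unfolding FT_cap[OF R elim] FT_cap[OF Rn(1) elim] .
      then show ?case by (intro tendsto_intros)
    qed
    show "AE \<xi> in lborel. norm (?F (?R n) \<xi>) \<le> ?b \<xi> + norm \<xi> * (norm (FT \<phi> \<xi>))\<^sup>2" for n
    proof (intro AE_I2)
      fix \<xi> :: plane
      have "norm (?F (?R n) \<xi>) = norm \<xi> * (norm (FT (cap (?R n)) \<xi>) * norm (FT \<phi> \<xi>))"
        by (simp add: norm_mult mult.assoc)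
      also have "\<dots> \<le> norm \<xi> * (?C / (1 + (norm \<xi>)\<^sup>2) * norm (FT \<phi> \<xi>))"
        by (intro mult_left_mono mult_right_mono norm_FT_cap_le Rn) auto
      also have "\<dots> \<le> norm \<xi> * ((?C / (1 + (norm \<xi>)\<^sup>2))\<^sup>2 + (norm (FT \<phi> \<xi>))\<^sup>2)"
        by (intro mult_left_mono order_trans[OF abs_ge_self abs_mult_le]) auto
      finally show "norm (?F (?R n) \<xi>) \<le> ?b \<xi> + norm \<xi> * (norm (FT \<phi> \<xi>))\<^sup>2" by (simp add: distrib_left)
    qed
  qed measurable
  then have "(\<lambda>n. half_pairing (cap (?R n)) \<phi>) \<longlonglongrightarrow> half_pairing (cap R) \<phi>"
    unfolding half_pairing_def by (rule tendsto_Re)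
  moreover have "half_pairing (cap (?R n)) \<phi> = pi / 2 * (LBINT x. \<phi> x)" for n
    by (rule half_pairing_cap_smaller[OF \<phi> s R]) auto
  ultimately have "(\<lambda>n::nat. pi / 2 * (LBINT x. \<phi> x)) \<longlonglongrightarrow> half_pairing (cap R) \<phi>" by (simp only:)
  then show ?thesis by (simp only: LIMSEQ_const_iff)
qed

section \<open>Translation to an arbitrary center\<close>

lemma FT_translate:
  assumes f: "integrable lborel f"
  shows "FT (\<lambda>x. f (x + c)) \<xi> = exp (\<i> * complex_of_real (c \<bullet> \<xi>)) * FT f \<xi>"
proof -
  have [measurable]: "f \<in> borel_measurable borel" using f by auto
  have k: "exp (- \<i> * complex_of_real (x \<bullet> \<xi>)) = exp (\<i> * complex_of_real (c \<bullet> \<xi>)) * exp (- \<i> * complex_of_real ((x + c) \<bullet> \<xi>))" for x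
    by (simp add: inner_add_left algebra_simps flip: exp_add)
  have "(LBINT x. exp (- \<i> * complex_of_real (x \<bullet> \<xi>)) * complex_of_real (f (x + c)))
     = exp (\<i> * complex_of_real (c \<bullet> \<xi>)) * (LBINT x. exp (- \<i> * complex_of_real ((x + c) \<bullet> \<xi>)) * complex_of_real (f (x + c)))"
    by (subst integral_mult_right_zero[symmetric], rule Bochner_Integration.integral_cong[OF refl]) (subst k, rule mult.assoc)
  also have "(LBINT x. exp (- \<i> * complex_of_real ((x + c) \<bullet> \<xi>)) * complex_of_real (f (x + c)))
     = (LBINT x. exp (- \<i> * complex_of_real (x \<bullet> \<xi>)) * complex_of_real (f x))"
    by (rule integral_translate[of "\<lambda>x. exp (- \<i> * complex_of_real (x \<bullet> \<xi>)) * complex_of_real (f x)"]) measurable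
  finally show ?thesis by (simp add: FT_lborel mult_ac)
qed

lemma finite_energy_translate:
  assumes f: "finite_energy f" shows "finite_energy (\<lambda>x. f (x + c))"
proof -
  note L = finite_energy_L2[OF f]
  have "norm (FT (\<lambda>x. f (x + c)) \<xi>) = norm (FT f \<xi>)" for \<xi>
    by (simp add: FT_translate[OF L2_bounded_integrable[OF L]] norm_mult)
  then have "half_energy (\<lambda>x. f (x + c)) = half_energy f" by (simp add: half_energy_def)
  then show ?thesis using f L2_bounded_translate[OF L] by (simp add: finite_energy_def)
qed

lemma half_pairing_translate:
  assumes f: "integrable lborel f" and g: "integrable lborel g"
  shows "half_pairing (\<lambda>x. f (x - c)) g = half_pairing f (\<lambda>x. g (x + c))"
proof -
  have "FT (\<lambda>x. f (x - c)) \<xi> * cnj (FT g \<xi>) = FT f \<xi> * cnj (FT (\<lambda>x. g (x + c)) \<xi>)" for \<xi>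
    using FT_translate[OF f, of "- c" \<xi>] by (simp add: FT_translate[OF g] exp_cnj mult_ac)
  then show ?thesis by (simp add: half_pairing_def mult.assoc)
qed

lemma half_pairing_cmult:
  assumes f: "integrable lborel f"
  shows "half_pairing (\<lambda>x. a * f x) g = a * half_pairing f g"
proof -
  have "(LBINT \<xi>. complex_of_real (norm \<xi>) * FT (\<lambda>x. a * f x) \<xi> * cnj (FT g \<xi>))
    = (LBINT \<xi>. complex_of_real a * (complex_of_real (norm \<xi>) * FT f \<xi> * cnj (FT g \<xi>)))"
    by (simp add: FT_cmult[OF f] mult_ac)
  then show ?thesis by (simp add: half_pairing_def)
qed

lemma finite_energy_cmult:
  assumes f: "finite_energy f" shows "finite_energy (\<lambda>x. a * f x)"
proof -
  note L = finite_energy_L2[OF f]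
  note [measurable] = L2_bounded_measurable[OF L]
  have "half_energy (\<lambda>x. a * f x) = (\<integral>\<^sup>+\<xi>. ennreal (a\<^sup>2) * ennreal (norm \<xi> * (norm (FT f \<xi>))\<^sup>2) \<partial>lborel)"
    unfolding half_energy_def FT_cmult[OF L2_bounded_integrable[OF L]]
    by (intro nn_integral_cong) (simp add: norm_mult power_mult_distrib mult.left_commute flip: ennreal_mult)
  also have "\<dots> = ennreal (a\<^sup>2) * half_energy f" unfolding half_energy_def by (rule nn_integral_cmult) measurable
  also have "\<dots> < \<infinity>" using f by (simp add: finite_energy_def ennreal_mult_less_top)
  finally show ?thesis using L2_bounded_cmult[OF L] by (simp add: finite_energy_def)
qed

lemma EL_solution_cap:
  assumes R: "R > 0"
  shows "EL_solution (ball c R) (\<lambda>x. 2 / pi * cap R (x - c))"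
proof -
  note Lc = L2_bounded_cap[OF R]
  have fe: "finite_energy (\<lambda>x. 2 / pi * cap R (x - c))"
    using finite_energy_cmult[OF finite_energy_translate[OF finite_energy_cap[OF R], of "- c"], of "2 / pi"] by simp
  moreover have "supported_in (\<lambda>x. 2 / pi * cap R (x - c)) (ball c R)"
    using cap_eq_0[OF R] by (auto simp: supported_in_def dist_norm norm_minus_commute not_less)
  moreover have "half_pairing (\<lambda>x. 2 / pi * cap R (x - c)) g = (LBINT x. g x)"
    if g: "finite_energy g" "supported_in g (ball c R)" for g
  proof -
    have gm: "g \<in> borel_measurable borel" using L2_bounded_measurable[OF finite_energy_L2[OF g(1)]] .
    have ic: "integrable lborel (\<lambda>x. cap R (x - c))"
      using integrable_translate[OF L2_bounded_integrable[OF Lc], of "- c"] by simp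
    have "half_pairing (\<lambda>x. 2 / pi * cap R (x - c)) g = 2 / pi * half_pairing (cap R) (\<lambda>x. g (x + c))"
      using half_pairing_translate[OF L2_bounded_integrable[OF Lc] L2_bounded_integrable[OF finite_energy_L2[OF g(1)]], of c]
      by (simp only: half_pairing_cmult[OF ic])
    also have "half_pairing (cap R) (\<lambda>x. g (x + c)) = pi / 2 * (LBINT x. g (x + c))"
    proof (rule half_pairing_cap[OF finite_energy_translate[OF g(1)] _ R])
      fix x :: plane assume "norm x > R"
      then show "g (x + c) = 0" using g(2) by (auto simp: supported_in_def dist_norm norm_minus_commute)
    qed
    also have "(LBINT x. g (x + c)) = (LBINT x. g x)" by (rule integral_translate[OF gm])
    finally show ?thesis by simp
  qed
  ultimately show ?thesis by (simp add: EL_solution_def)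
qed

section \<open>Minimizers and boundary behaviour\<close>

lemma FT_cong_AE:
  assumes [measurable]: "f \<in> borel_measurable borel" "g \<in> borel_measurable borel"
    and eq: "AE x in lborel. f x = g x"
  shows "FT f = FT g"
proof
  fix \<xi>
  have "(LBINT x. exp (- \<i> * complex_of_real (x \<bullet> \<xi>)) * complex_of_real (f x))
     = (LBINT x. exp (- \<i> * complex_of_real (x \<bullet> \<xi>)) * complex_of_real (g x))"
    by (rule integral_cong_AE) (use eq in auto)
  then show "FT f \<xi> = FT g \<xi>" by (simp add: FT_lborel)
qed

lemma energy_cong_AE:
  assumes f: "finite_energy f" and g: "L2_bounded g" and eq: "AE x in lborel. f x = g x"
  shows "finite_energy g" "half_pairing g h = half_pairing f h" "dirichlet_energy g = dirichlet_energy f"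
proof -
  note L = L2_bounded_measurable[OF finite_energy_L2[OF f]] L2_bounded_measurable[OF g]
  note FT = FT_cong_AE[OF L eq]
  show "finite_energy g" using f g by (simp add: finite_energy_def half_energy_def FT)
  show "half_pairing g h = half_pairing f h" by (simp add: half_pairing_def FT)
  have "(LBINT x. f x) = (LBINT x. g x)" by (rule integral_cong_AE) (use L eq in auto)
  then show "dirichlet_energy g = dirichlet_energy f" by (simp add: dirichlet_energy_def half_pairing_def FT)
qed

text \<open>Polarized supports are compared pointwise, so nonnegativity must hold at every point and
  not only almost everywhere.\<close>

lemma EL_solution_nonneg_representative:
  assumes f: "EL_solution \<Omega> f" and \<Omega>: "open \<Omega>" "bounded \<Omega>"
  obtains g where "EL_solution \<Omega> g" "\<And>x. 0 \<le> g x" "AE x in lborel. f x = g x"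
proof -
  have fe: "finite_energy f" using f by (simp add: EL_solution_def)
  note L = finite_energy_L2[OF fe]
  note [measurable] = L2_bounded_measurable[OF L]
  define g where "g x = max 0 (f x)" for x
  have g: "L2_bounded g" unfolding g_def by (rule L2_bounded_dominated[OF L]) auto
  have eq: "AE x in lborel. f x = g x" using EL_solution_nonneg[OF f \<Omega>] by eventually_elim (simp add: g_def)
  have gs: "supported_in g \<Omega>" using f by (simp add: EL_solution_def supported_in_def g_def)
  have "EL_solution \<Omega> g"
    using f gs energy_cong_AE[OF fe g eq] by (simp add: EL_solution_def)
  then show ?thesis using that eq by (simp add: g_def)
qed

text \<open>Polarization preserves the integral and does not raise the half energy, while minimality
  among open sets of equal measure forbids lowering it. So the equality case of
  \<open>gauss_form_polarize\<close> applies at some time.\<close>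

lemma polarization_of_minimizer:
  assumes f: "EL_solution \<Omega> f" and nn: "\<And>x. 0 \<le> f x" and \<Omega>: "open \<Omega>" "bounded \<Omega>" and e: "norm e = 1"
    and min: "\<And>\<Omega>'. open \<Omega>' \<Longrightarrow> emeasure lebesgue \<Omega>' = emeasure lebesgue \<Omega> \<Longrightarrow> J \<Omega> \<le> J \<Omega>'"
  shows "AE x in lborel. AE y in lborel. \<tau> < x \<bullet> e \<longrightarrow> \<tau> < y \<bullet> e \<longrightarrow>
        0 \<le> (f x - f (reflect e \<tau> x)) * (f y - f (reflect e \<tau> y))"
proof -
  have fe: "finite_energy f" "supported_in f \<Omega>" using f by (auto simp: EL_solution_def)
  note L = finite_energy_L2[OF fe(1)]
  let ?P = "polarize e \<tau> f"
  note LP = L2_bounded_polarize[OF e L, of \<tau>]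
  note mono = half_energy_mono[OF L LP integral_polarize(2)[OF e L] gauss_form_polarize(1)[OF e L]]
  have Pe: "finite_energy ?P" using mono(1) LP fe(1) by (simp add: finite_energy_def le_less_trans)
  have "ereal (dirichlet_energy f) \<le> J \<Omega>" by (rule EL_solution_minimal[OF f \<Omega>])
  also have "\<dots> \<le> J (polarize_set e \<tau> \<Omega>)"
    by (intro min open_polarize_set \<Omega> emeasure_polarize_set e)
  also have "\<dots> \<le> ereal (dirichlet_energy ?P)"
    by (intro J_le_dirichlet_energy Pe supported_in_polarize fe nn)
  finally have "half_pairing f f \<le> half_pairing ?P ?P"
    by (simp add: dirichlet_energy_def integral_polarize(1)[OF e L])
  then have "half_energy f \<le> half_energy ?P"
    by (simp add: half_pairing_self(2)[OF fe(1)] half_pairing_self(2)[OF Pe] ennreal_leI)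
  then obtain t where "t > 0" "gauss_form t ?P = gauss_form t f"
    using mono(2) fe(1) by (auto simp: finite_energy_def)
  then show ?thesis by (intro gauss_form_polarize(2)[OF e L])
qed

lemma emeasure_disc: "R \<ge> 0 \<Longrightarrow> emeasure lborel (ball (c::plane) R) = ennreal (pi * R\<^sup>2)"
  by (simp add: emeasure_ball unit_ball_vol_2)

text \<open>The solution, cut off by a null modification, is admissible on a disc of the same
  measure. Minimality of \<open>\<Omega>\<close> makes its energy at most that of the explicit disc
  solution, and the quadratic excess over the latter must then vanish.\<close>

lemma minimizer_is_cap:
  assumes f: "EL_solution \<Omega> f" and \<Omega>: "open \<Omega>" "bounded \<Omega>" and m: "emeasure lebesgue \<Omega> = ennreal (pi * R\<^sup>2)"
    and R: "R > 0"
    and min: "\<And>\<Omega>'. open \<Omega>' \<Longrightarrow> emeasure lebesgue \<Omega>' = emeasure lebesgue \<Omega> \<Longrightarrow> J \<Omega> \<le> J \<Omega>'"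
  shows "\<exists>c. AE x in lborel. f x = 2 / pi * cap R (x - c)"
proof -
  obtain g where g: "EL_solution \<Omega> g" "\<And>x. 0 \<le> g x" and fg: "AE x in lborel. f x = g x"
    using EL_solution_nonneg_representative[OF f \<Omega>] by blast
  have ge: "finite_energy g" "supported_in g \<Omega>" using g(1) by (auto simp: EL_solution_def)
  note L = finite_energy_L2[OF ge(1)]
  note [measurable] = L2_bounded_measurable[OF L]
  have [measurable]: "\<Omega> \<in> sets borel" using \<Omega> by auto
  obtain c where c: "\<And>e \<tau>. norm e = 1 \<Longrightarrow> \<tau> < c \<bullet> e \<Longrightarrow> AE y in lborel. \<tau> < y \<bullet> e \<longrightarrow> g (reflect e \<tau> y) \<le> g y"
    using symmetric_center[OF L g(2) polarization_of_minimizer[OF g(1) g(2) \<Omega> _ min]] by blast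
  have disc: "emeasure lebesgue (ball c R) = emeasure lebesgue \<Omega>" "emeasure lborel \<Omega> \<le> emeasure lborel (ball c R)"
    using m emeasure_disc[of R c] R by simp_all
  have supp: "AE x in lborel. x \<notin> ball c R \<longrightarrow> g x = 0"
    by (rule supported_in_disc[OF L g(2) c ge(2) _ disc(2)]) auto
  define h where "h x = indicator (ball c R) x * g x" for x
  have hL: "L2_bounded h" unfolding h_def by (rule L2_bounded_dominated[OF L]) (auto simp: indicator_def)
  have gh: "AE x in lborel. g x = h x" using supp by eventually_elim (auto simp: h_def indicator_def)
  note h = energy_cong_AE[OF ge(1) hL gh]
  have hs: "supported_in h (ball c R)" by (simp add: supported_in_def h_def)
  let ?v = "\<lambda>x. 2 / pi * cap R (x - c)"
  note v = EL_solution_cap[OF R, of c]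
  have ve: "finite_energy ?v" "supported_in ?v (ball c R)" using v by (auto simp: EL_solution_def)
  have "ereal (dirichlet_energy g) \<le> J \<Omega>" by (rule EL_solution_minimal[OF g(1) \<Omega>])
  also have "\<dots> \<le> J (ball c R)" by (rule min[OF open_ball disc(1)])
  also have "\<dots> \<le> ereal (dirichlet_energy ?v)" by (rule J_le_dirichlet_energy[OF ve])
  finally have "dirichlet_energy h \<le> dirichlet_energy ?v" by (simp add: h(3))
  then have "half_pairing (\<lambda>x. h x - ?v x) (\<lambda>x. h x - ?v x) \<le> 0"
    using EL_solution_energy[OF v h(1) hs] by simp
  then have "AE x in lborel. h x - ?v x = 0"
    by (rule half_pairing_zero_AE[OF finite_energy_diff[OF h(1) ve(1)]])
  with fg gh have "AE x in lborel. f x = ?v x" by eventually_elim simp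
  then show ?thesis by blast
qed

section \<open>From equality almost everywhere to the disc and its normal\<close>

lemma open_null_empty:
  fixes S :: "'a::euclidean_space set"
  assumes "open S" "AE x in lborel. x \<notin> S" shows "S = {}"
proof (rule ccontr)
  assume ne: "S \<noteq> {}"
  have [measurable]: "S \<in> sets borel" using assms by auto
  have "S \<in> null_sets lborel" using assms(2) by (subst AE_iff_null_sets) auto
  then have "negligible S" by (simp add: negligible_iff_null_sets null_sets_completionI)
  then show False using open_not_negligible[OF assms(1) ne] by simp
qed

lemma chart_continuous: "boundary_chart \<Omega> x e1 e2 \<gamma> \<Longrightarrow> continuous_on UNIV \<gamma>"
  unfolding boundary_chart_def smooth_real_def
  by (metis continuous_at_imp_continuous_on differentiable_imp_continuous_within funpow_0)

lemma chart_DERIV: "boundary_chart \<Omega> x e1 e2 \<gamma> \<Longrightarrow> DERIV \<gamma> 0 :> deriv \<gamma> 0"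
  unfolding boundary_chart_def smooth_real_def
  by (metis DERIV_deriv_iff_real_differentiable funpow_0)

lemma open_chart_epigraph:
  assumes "boundary_chart \<Omega> x e1 e2 \<gamma>"
  shows "open {y. \<gamma> ((y - x) \<bullet> e1) < (y - x) \<bullet> e2}"
  by (intro open_Collect_less continuous_intros continuous_on_compose2[OF chart_continuous[OF assms]]) auto

text \<open>A point of the disc missing from \<open>\<Omega>\<close> would be a boundary point of
  \<open>\<Omega>\<close>. Its chart provides a nonempty open piece of the complement above the
  graph, inside the disc, contradicting that the disc is covered up to a null set.\<close>

lemma set_eq_disc:
  assumes \<Omega>: "open \<Omega>" and smooth: "smooth_boundary \<Omega>"
    and ball_sub: "AE x in lborel. x \<in> ball c R \<longrightarrow> x \<in> \<Omega>"
    and sub_ball: "AE x in lborel. x \<in> \<Omega> \<longrightarrow> x \<in> ball c R" and R: "R > 0"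
  shows "\<Omega> = ball c R"
proof
  \<comment> \<open>The closed ball makes the difference open; the sphere is excluded afterwards
    because \<open>\<Omega>\<close> is open.\<close>
  have "\<Omega> - cball c R = {}"
    by (rule open_null_empty) (use \<Omega> sub_ball in \<open>auto elim!: eventually_mono\<close>)
  then show "\<Omega> \<subseteq> ball c R" using interior_maximal[of \<Omega> "cball c R"] \<Omega> by auto
  have cl: "ball c R - closure \<Omega> = {}"
    by (rule open_null_empty) (use ball_sub closure_subset[of \<Omega>] in \<open>auto elim!: eventually_mono\<close>)
  show "ball c R \<subseteq> \<Omega>"
  proof
    fix x assume x: "x \<in> ball c R"
    show "x \<in> \<Omega>"
    proof (rule ccontr)
      assume nx: "x \<notin> \<Omega>"
      then have "x \<in> frontier \<Omega>" using x cl \<Omega> by (auto simp: frontier_def interior_open)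
      then obtain e1 e2 \<gamma> where ch: "boundary_chart \<Omega> x e1 e2 \<gamma>" using smooth by (auto simp: smooth_boundary_def)
      then obtain r where r: "r > 0" "\<Omega> \<inter> ball x r = {y \<in> ball x r. (y - x) \<bullet> e2 < \<gamma> ((y - x) \<bullet> e1)}"
        and e: "norm e2 = 1" "e1 \<bullet> e2 = 0" by (auto simp: boundary_chart_def)
      define A where "A = {y. \<gamma> ((y - x) \<bullet> e1) < (y - x) \<bullet> e2} \<inter> ball x r \<inter> ball c R"
      have disj: "y \<notin> \<Omega>" if "y \<in> A" for y
      proof
        assume "y \<in> \<Omega>"
        then have "y \<in> \<Omega> \<inter> ball x r" using that by (simp add: A_def)
        then show False unfolding r(2) using that by (simp add: A_def)
      qed
      have A: "A = {}"
      proof (rule open_null_empty)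
        show "open A" unfolding A_def by (intro open_Int open_chart_epigraph[OF ch] open_ball)
        show "AE y in lborel. y \<notin> A" using ball_sub
          by eventually_elim (use disj in \<open>auto simp: A_def\<close>)
      qed
      \<comment> \<open>\<open>boundary_chart\<close> does not require the graph to pass through
        \<open>x\<close>. This inequality suffices to put the points
        \<open>x + s *\<^sub>R e2\<close> strictly above it.\<close>
      have "\<gamma> 0 \<le> 0"
      proof (rule ccontr)
        assume "\<not> \<gamma> 0 \<le> 0"
        then have "x \<in> \<Omega> \<inter> ball x r" unfolding r(2) using r(1) by simp
        then show False using nx by simp
      qed
      obtain \<delta> where \<delta>: "\<delta> > 0" "ball x \<delta> \<subseteq> ball c R" using x open_ball open_contains_ball by blast
      define s where "s = min r \<delta> / 2"
      have s: "s > 0" "s < r" "s < \<delta>" using r \<delta> by (auto simp: s_def min_def)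
      have ds: "dist x (x + s *\<^sub>R e2) = s" using s e by (simp add: dist_norm)
      have "x + s *\<^sub>R e2 \<in> ball c R" using ds s by (intro subsetD[OF \<delta>(2)]) simp
      moreover have "e2 \<bullet> e2 = 1" "e2 \<bullet> e1 = 0" using e by (auto simp: norm_eq_1 inner_commute)
      ultimately have "x + s *\<^sub>R e2 \<in> A"
        unfolding A_def using s ds \<open>\<gamma> 0 \<le> 0\<close> by simp
      then show False using A by simp
    qed
  qed
qed

text \<open>A nonzero remainder would be a third independent vector in the plane.\<close>

lemma plane_orthonormal_expansion:
  assumes "norm e1 = 1" "norm e2 = 1" "e1 \<bullet> e2 = 0"
  shows "a = (a \<bullet> e1) *\<^sub>R e1 + (a \<bullet> e2) *\<^sub>R (e2 :: plane)"
proof (rule ccontr)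
  assume ne: "\<not> ?thesis"
  define w where "w = a - (a \<bullet> e1) *\<^sub>R e1 - (a \<bullet> e2) *\<^sub>R e2"
  have e: "e1 \<bullet> e1 = 1" "e2 \<bullet> e2 = 1" "e2 \<bullet> e1 = 0" using assms by (auto simp: norm_eq_1 inner_commute)
  have w0: "w \<noteq> 0"
  proof
    assume "w = 0"
    then have "a = (a \<bullet> e1) *\<^sub>R e1 + (a \<bullet> e2) *\<^sub>R e2" unfolding w_def by (simp only: diff_diff_eq right_minus_eq)
    then show False using ne by blast
  qed
  have w: "w \<bullet> e1 = 0" "w \<bullet> e2 = 0" "e1 \<bullet> w = 0" "e2 \<bullet> w = 0"
    using e assms(3) by (auto simp: w_def inner_diff_left inner_diff_right inner_commute)
  have "pairwise orthogonal {e1, e2, w}"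
    using assms w w0 e by (auto simp: pairwise_def orthogonal_def)
  moreover have nz: "0 \<notin> {e1, e2, w}" using w0 e by auto
  ultimately have "independent {e1, e2, w}" by (rule pairwise_orthogonal_independent)
  then have "card {e1, e2, w} \<le> DIM(plane)" by (rule independent_card_le)
  moreover have "e1 \<noteq> e2" "e1 \<noteq> w" "e2 \<noteq> w" using e w assms(3) by (metis zero_neq_one)+
  then have "card {e1, e2, w} = 3" by simp
  ultimately show False by simp
qed

text \<open>The normal is defined by an arbitrary chart. Graph points near \<open>x\<close> lie
  outside the disc, so along the graph the distance to \<open>c\<close> is minimal at
  \<open>x\<close>, and its derivative shows that \<open>x - c\<close> is orthogonal to the tangent.
  The side on which the disc lies gives the sign.\<close>

lemma disc_outward_unit_normal:
  assumes R: "R > 0" and \<nu>: "outward_unit_normal (ball c R) x \<nu>"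
  shows "x - c = R *\<^sub>R \<nu>"
proof -
  define a where "a = x - c"
  obtain e1 e2 \<gamma> where xf: "x \<in> frontier (ball c R)" and ch: "boundary_chart (ball c R) x e1 e2 \<gamma>"
    and n: "\<nu> = (1 / sqrt (1 + (deriv \<gamma> 0)\<^sup>2)) *\<^sub>R (e2 - deriv \<gamma> 0 *\<^sub>R e1)"
    using \<nu> by (auto simp: outward_unit_normal_def)
  obtain r where r: "r > 0" "ball c R \<inter> ball x r = {y \<in> ball x r. (y - x) \<bullet> e2 < \<gamma> ((y - x) \<bullet> e1)}"
    and e: "norm e1 = 1" "norm e2 = 1" "e1 \<bullet> e2 = 0" using ch by (auto simp: boundary_chart_def)
  have mem: "y \<in> ball c R \<longleftrightarrow> (y - x) \<bullet> e2 < \<gamma> ((y - x) \<bullet> e1)" if "y \<in> ball x r" for y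
    using r(2) that by blast
  have e': "e1 \<bullet> e1 = 1" "e2 \<bullet> e2 = 1" "e2 \<bullet> e1 = 0" using e by (auto simp: norm_eq_1 inner_commute)
  have xR: "norm a = R" using xf R by (auto simp: a_def frontier_ball dist_norm norm_minus_commute)
  have xx: "x \<in> ball x r" using r by simp
  have "x \<notin> ball c R" using xR by (simp add: a_def dist_norm norm_minus_commute)
  then have "\<gamma> 0 \<le> 0" using mem[OF xx] by simp
  \<comment> \<open>If the graph ran below \<open>x\<close>, a whole neighborhood of
    \<open>x\<close> would be above it and hence outside the disc, although \<open>x\<close> is in
    the closure.\<close>
  moreover have "\<not> \<gamma> 0 < 0"
  proof
    assume "\<gamma> 0 < 0"
    then have "x \<in> {y. \<gamma> ((y - x) \<bullet> e1) < (y - x) \<bullet> e2} \<inter> ball x r" using r by simp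
    moreover have "open ({y. \<gamma> ((y - x) \<bullet> e1) < (y - x) \<bullet> e2} \<inter> ball x r)"
      by (intro open_Int open_chart_epigraph[OF ch] open_ball)
    moreover have "x \<in> closure (ball c R)" using xf by (simp add: frontier_def)
    ultimately obtain y where "y \<in> ball c R" "y \<in> {y. \<gamma> ((y - x) \<bullet> e1) < (y - x) \<bullet> e2} \<inter> ball x r"
      using open_Int_closure_eq_empty by blast
    then show False using mem[of y] by auto
  qed
  ultimately have g0: "\<gamma> 0 = 0" by simp
  define g' where "g' = deriv \<gamma> 0"
  have D: "DERIV \<gamma> 0 :> g'" unfolding g'_def by (rule chart_DERIV[OF ch])
  \<comment> \<open>The squared distance from \<open>c\<close> along the graph, expanded in the
    frame so that it can be differentiated at 0.\<close>
  define \<phi> where "\<phi> s = R\<^sup>2 + 2 * s * (a \<bullet> e1) + 2 * \<gamma> s * (a \<bullet> e2) + s\<^sup>2 + (\<gamma> s)\<^sup>2" for s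
  have \<phi>: "\<phi> s = (norm (x + s *\<^sub>R e1 + \<gamma> s *\<^sub>R e2 - c))\<^sup>2" for s
  proof -
    have "x + s *\<^sub>R e1 + \<gamma> s *\<^sub>R e2 - c = a + s *\<^sub>R e1 + \<gamma> s *\<^sub>R e2" by (simp add: a_def)
    then have "(norm (x + s *\<^sub>R e1 + \<gamma> s *\<^sub>R e2 - c))\<^sup>2 = a \<bullet> a + 2 * s * (a \<bullet> e1) + 2 * \<gamma> s * (a \<bullet> e2) + s * s + \<gamma> s * \<gamma> s"
      unfolding \<open>x + s *\<^sub>R e1 + \<gamma> s *\<^sub>R e2 - c = a + s *\<^sub>R e1 + \<gamma> s *\<^sub>R e2\<close> power2_norm_eq_inner using e' e(3)
      by (simp add: inner_add_left inner_add_right inner_commute)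
    then show ?thesis using xR by (simp add: \<phi>_def power2_eq_square flip: power2_norm_eq_inner)
  qed
  have "DERIV \<phi> 0 :> 2 * (a \<bullet> e1) + 2 * g' * (a \<bullet> e2)"
    unfolding \<phi>_def by (rule derivative_eq_intros D refl | simp add: g0)+
  moreover obtain d where d: "d > 0" "\<And>s. \<bar>s\<bar> < d \<Longrightarrow> \<phi> 0 \<le> \<phi> s"
  proof -
    have "isCont \<gamma> 0" using D by (rule DERIV_isCont)
    then have "((\<lambda>s. s *\<^sub>R e1 + \<gamma> s *\<^sub>R e2) \<longlongrightarrow> 0 *\<^sub>R e1 + \<gamma> 0 *\<^sub>R e2) (at 0)"
      unfolding isCont_def by (intro tendsto_intros)
    then have "((\<lambda>s. s *\<^sub>R e1 + \<gamma> s *\<^sub>R e2) \<longlongrightarrow> 0) (at 0)" by (simp add: g0)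
    then obtain d where d: "d > 0" "\<And>s. s \<noteq> 0 \<Longrightarrow> \<bar>s\<bar> < d \<Longrightarrow> norm (s *\<^sub>R e1 + \<gamma> s *\<^sub>R e2) < r"
      using r(1) unfolding LIM_def by (auto simp: dist_norm)
    have "\<phi> 0 \<le> \<phi> s" if "\<bar>s\<bar> < d" for s
    proof (cases "s = 0")
      case False
      let ?y = "x + s *\<^sub>R e1 + \<gamma> s *\<^sub>R e2"
      have yx: "?y - x = s *\<^sub>R e1 + \<gamma> s *\<^sub>R e2" by simp
      have "dist ?y x < r" by (simp only: dist_norm yx d(2)[OF False that])
      then have "?y \<in> ball x r" by (simp only: mem_ball dist_commute)
      moreover have "(?y - x) \<bullet> e1 = s" "(?y - x) \<bullet> e2 = \<gamma> s"
        unfolding yx using e' e(3) by (simp_all add: inner_add_left)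
      ultimately have "?y \<notin> ball c R" using mem[of ?y] by simp
      then have "R \<le> norm (?y - c)" by (simp add: dist_norm norm_minus_commute)
      then have "R\<^sup>2 \<le> \<phi> s" unfolding \<phi> using R by (intro power_mono) auto
      then show ?thesis by (simp add: \<phi>_def g0)
    qed simp
    then show ?thesis using that d(1) by blast
  qed
  ultimately have "2 * (a \<bullet> e1) + 2 * g' * (a \<bullet> e2) = 0"
    by (intro DERIV_local_min[of \<phi> _ 0 d]) auto
  then have a1: "a \<bullet> e1 = - g' * (a \<bullet> e2)" by simp
  \<comment> \<open>A point slightly below the graph belongs to the disc, so moving from
    \<open>x\<close> against \<open>e2\<close> must decrease the distance to
    \<open>c\<close>.\<close>
  have a2: "a \<bullet> e2 > 0"
  proof -
    define s where "s = r / 2"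
    have s: "s > 0" "s < r" using r by (auto simp: s_def)
    let ?y = "x - s *\<^sub>R e2"
    have "?y \<in> ball x r" using s e by (simp add: dist_norm)
    then have "?y \<in> ball c R" using mem[of ?y] e' e(3) s g0 by (simp add: inner_commute)
    then have "(norm (a - s *\<^sub>R e2))\<^sup>2 < R\<^sup>2"
      using R by (intro power_strict_mono) (auto simp: a_def dist_norm norm_minus_commute algebra_simps)
    also have "(norm (a - s *\<^sub>R e2))\<^sup>2 = R\<^sup>2 - 2 * s * (a \<bullet> e2) + s * s"
    proof -
      have "a \<bullet> a = R\<^sup>2" using xR by (simp flip: power2_norm_eq_inner)
      then show ?thesis
        using e' unfolding power2_norm_eq_inner
        by (simp add: inner_diff_left inner_diff_right inner_commute)
    qed
    finally have "s * s < 2 * s * (a \<bullet> e2)" by simp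
    then have "0 < 2 * s * (a \<bullet> e2)" using s by (metis less_trans mult_pos_pos)
    then show ?thesis using s by (simp add: zero_less_mult_iff)
  qed
  have ax: "a = (a \<bullet> e2) *\<^sub>R (e2 - g' *\<^sub>R e1)"
    using plane_orthonormal_expansion[OF e, of a] unfolding a1 by (simp add: algebra_simps)
  have k: "sqrt (1 + g'\<^sup>2) > 0" by (simp add: add_pos_nonneg)
  have "norm (e2 - g' *\<^sub>R e1) = sqrt (1 + g'\<^sup>2)"
    unfolding norm_eq_sqrt_inner using e' e(3) by (simp add: inner_diff_left inner_diff_right power2_eq_square)
  then have "R = (a \<bullet> e2) * sqrt (1 + g'\<^sup>2)"
    using arg_cong[OF ax, of norm] a2 xR by (simp add: norm_scaleR)
  then have "R *\<^sub>R \<nu> = (a \<bullet> e2) *\<^sub>R (e2 - g' *\<^sub>R e1)"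
    unfolding n g'_def[symmetric] using k by simp
  then show ?thesis using ax by (simp add: a_def)
qed

text \<open>For \<open>y\<close> in the disc put \<open>z = y - x\<close> and
  \<open>d = \<bar>z \<bullet> \<nu>\<bar>\<close>. The radicand of \<open>cap\<close> factors as
  \<open>d * (2 * R - (norm z)\<^sup>2 / d)\<close>, and in the cone of aperture
  \<open>\<kappa>\<close> the correction is at most \<open>norm z / \<kappa>\<close>. Tangential
  approach is exactly where this control is lost.\<close>

lemma cap_half_normal_derivative:
  assumes R: "R > 0" and a: "norm \<nu> = 1" "x - c = R *\<^sub>R \<nu>"
  shows "has_half_normal_derivative (ball c R) (\<lambda>y. k * cap R (y - c)) x \<nu> (k * sqrt (2 * R))"
  unfolding has_half_normal_derivative_def
proof (intro allI impI)
  fix \<kappa> :: real assume \<kappa>: "0 < \<kappa> \<and> \<kappa> < 1"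
  let ?F = "at x within {y \<in> ball c R. \<kappa> * norm (y - x) \<le> \<bar>(y - x) \<bullet> \<nu>\<bar>}"
  let ?q = "\<lambda>y. (norm (y - x))\<^sup>2 / \<bar>(y - x) \<bullet> \<nu>\<bar>"
  have ev: "\<forall>\<^sub>F y in ?F. y \<in> ball c R \<and> \<kappa> * norm (y - x) \<le> \<bar>(y - x) \<bullet> \<nu>\<bar> \<and> y \<noteq> x"
    by (auto simp: eventually_at_filter)
  have q: "?q y \<le> norm (y - x) / \<kappa>" if "\<kappa> * norm (y - x) \<le> \<bar>(y - x) \<bullet> \<nu>\<bar>" "y \<noteq> x" for y
  proof -
    have n: "norm (y - x) > 0" using that(2) by simp
    have "?q y \<le> (norm (y - x))\<^sup>2 / (\<kappa> * norm (y - x))"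
      using that(1) n \<kappa> by (intro divide_left_mono) (auto intro!: mult_pos_pos less_le_trans[OF _ that(1)])
    also have "\<dots> = norm (y - x) / \<kappa>" using n \<kappa> by (simp add: power2_eq_square)
    finally show ?thesis .
  qed
  have "((\<lambda>y. norm (y - x) / \<kappa>) \<longlongrightarrow> norm (x - x) / \<kappa>) ?F" using \<kappa> by (intro tendsto_intros) auto
  then have "((\<lambda>y. norm (y - x) / \<kappa>) \<longlongrightarrow> 0) ?F" by simp
  then have q0: "(?q \<longlongrightarrow> 0) ?F"
    by (rule tendsto_sandwich[OF _ _ tendsto_const, rotated 2]) (use ev q in \<open>auto elim!: eventually_mono\<close>)
  have "((\<lambda>y. k * sqrt (2 * R - ?q y)) \<longlongrightarrow> k * sqrt (2 * R - 0)) ?F" by (intro tendsto_intros q0)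
  moreover have "\<forall>\<^sub>F y in ?F. k * cap R (y - c) / sqrt \<bar>(y - x) \<bullet> \<nu>\<bar> = k * sqrt (2 * R - ?q y)"
    using ev
  proof eventually_elim
    case (elim y)
    let ?z = "y - x"
    have yc: "y - c = ?z + R *\<^sub>R \<nu>" using a(2) by (simp add: algebra_simps)
    have nc: "(norm (y - c))\<^sup>2 = (norm ?z)\<^sup>2 + 2 * R * (?z \<bullet> \<nu>) + R\<^sup>2"
    proof -
      have "(norm (w + R *\<^sub>R \<nu>))\<^sup>2 = (norm w)\<^sup>2 + 2 * R * (w \<bullet> \<nu>) + R\<^sup>2" for w
        unfolding power2_norm_eq_inner using a(1)
        by (simp add: inner_add_left inner_add_right inner_commute norm_eq_1 power2_eq_square)
      then show ?thesis unfolding yc .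
    qed
    have "(norm (y - c))\<^sup>2 < R\<^sup>2" using elim R by (intro power_strict_mono) (auto simp: dist_norm norm_minus_commute)
    moreover have "(norm ?z)\<^sup>2 > 0" using elim by simp
    ultimately have "2 * R * (?z \<bullet> \<nu>) < 0" unfolding nc by linarith
    then have zn: "?z \<bullet> \<nu> < 0" using R by (simp add: mult_less_0_iff)
    define d where "d = \<bar>?z \<bullet> \<nu>\<bar>"
    have d: "d > 0" "?z \<bullet> \<nu> = - d" using zn by (auto simp: d_def)
    have "max 0 (R\<^sup>2 - (norm (y - c))\<^sup>2) = d * (2 * R - (norm ?z)\<^sup>2 / d)"
      using \<open>(norm (y - c))\<^sup>2 < R\<^sup>2\<close> d(1) unfolding nc d(2) by (simp add: right_diff_distrib)
    then have "cap R (y - c) = sqrt d * sqrt (2 * R - (norm ?z)\<^sup>2 / d)" by (simp only: cap_def real_sqrt_mult)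
    then show ?case unfolding d_def[symmetric] using d(1) by simp
  qed
  ultimately show "((\<lambda>y. k * cap R (y - c) / sqrt \<bar>(y - x) \<bullet> \<nu>\<bar>) \<longlongrightarrow> k * sqrt (2 * R)) ?F"
    by (simp add: tendsto_cong)
qed

text \<open>The solution is determined only up to null sets, while a boundary limit needs values at
  points. The representative \<open>w\<close>, continuous on the open set \<open>\<Omega>\<close>
  and 0 outside, is the one to which the limit refers; continuity makes it unique.\<close>

theorem corollary2:
  fixes \<Omega> :: "(real ^ 2) set" and u :: "real ^ 2 \<Rightarrow> real" and n :: "real ^ 2 \<Rightarrow> real ^ 2"
  assumes "open \<Omega>" and "bounded \<Omega>" and "smooth_boundary \<Omega>"
    and "emeasure lebesgue \<Omega> = 1"
    and "J \<Omega> = (INF \<Omega>' \<in> {\<Omega>'. open \<Omega>' \<and> emeasure lebesgue \<Omega>' = 1}. J \<Omega>')"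
    and "solves_euler_lagrange \<Omega> u"
    and "\<And>x. x \<in> frontier \<Omega> \<Longrightarrow> outward_unit_normal \<Omega> x (n x)"
  shows "\<exists>w. (AE x in lebesgue. w x = u x) \<and> continuous_on \<Omega> w \<and> (\<forall>x. x \<notin> \<Omega> \<longrightarrow> w x = 0) \<and>
           (\<exists>c\<^sub>0\<ge>0. \<forall>x \<in> frontier \<Omega>. has_half_normal_derivative \<Omega> w x (n x) c\<^sub>0)"
proof -
  \<comment> \<open>The radius of the disc of area 1.\<close>
  define R where "R = 1 / sqrt pi"
  have R: "R > 0" "pi * R\<^sup>2 = 1" by (simp_all add: R_def power_divide)
  have min: "J \<Omega> \<le> J \<Omega>'" if "open \<Omega>'" "emeasure lebesgue \<Omega>' = emeasure lebesgue \<Omega>" for \<Omega>'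
    unfolding assms(5) using that assms(4) by (intro INF_lower) simp
  obtain f where f: "EL_solution \<Omega> f" "AE x in lborel. u x = f x"
    using solves_euler_lagrange_representative[OF assms(6,1,2)] by blast
  obtain c where c: "AE x in lborel. f x = 2 / pi * cap R (x - c)"
    using minimizer_is_cap[OF f(1) assms(1,2) _ R(1) min] assms(4) R(2) by auto
  let ?w = "\<lambda>x. 2 / pi * cap R (x - c)"
  have [measurable]: "\<Omega> \<in> sets borel" using assms(1) by auto
  have fs: "supported_in f \<Omega>" using f(1) by (simp add: EL_solution_def)
  have pos: "?w x > 0" if "x \<in> ball c R" for x
  proof -
    have "(norm (x - c))\<^sup>2 < R\<^sup>2" using that R by (intro power_strict_mono) (auto simp: dist_norm norm_minus_commute)
    then show ?thesis by (simp add: cap_def)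
  qed
  have 1: "AE x in lborel. x \<in> ball c R \<longrightarrow> x \<in> \<Omega>"
    using c
  proof eventually_elim
    case (elim x)
    show ?case
    proof
      assume "x \<in> ball c R"
      from pos[OF this] elim have "f x \<noteq> 0" by (metis less_irrefl)
      then show "x \<in> \<Omega>" using fs by (auto simp: supported_in_def)
    qed
  qed
  \<comment> \<open>The disc is contained in \<open>\<Omega>\<close> up to a null set because the
    solution is positive on it; equality of the finite measures gives the reverse inclusion up to a
    null set.\<close>
  have e\<Omega>: "emeasure lborel \<Omega> = 1" using assms(4) by simp
  have eB: "emeasure lborel (ball c R) = 1" using emeasure_disc[of R c] R by simp
  have "emeasure lborel (\<Omega> \<inter> ball c R) = emeasure lborel (ball c R)"
    by (rule emeasure_eq_AE) (use 1 in auto)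
  then have "emeasure lborel (\<Omega> - \<Omega> \<inter> ball c R) = 0"
    using e\<Omega> eB by (subst emeasure_Diff) auto
  then have "\<Omega> - \<Omega> \<inter> ball c R \<in> null_sets lborel" by (intro null_setsI) auto
  from AE_not_in[OF this] have 2: "AE x in lborel. x \<in> \<Omega> \<longrightarrow> x \<in> ball c R" by eventually_elim auto
  have \<Omega>: "\<Omega> = ball c R" by (rule set_eq_disc[OF assms(1,3) 1 2 R(1)])
  have 3: "has_half_normal_derivative \<Omega> ?w x (n x) (2 / pi * sqrt (2 * R))" if "x \<in> frontier \<Omega>" for x
  proof -
    have nx: "x - c = R *\<^sub>R n x"
      by (rule disc_outward_unit_normal[OF R(1)]) (use assms(7)[OF that] \<Omega> in simp)
    have "norm (x - c) = R" using that R(1) unfolding \<Omega> by (auto simp: frontier_ball dist_norm norm_minus_commute)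
    then have "norm (n x) = 1" unfolding nx using R(1) by simp
    then show ?thesis unfolding \<Omega> by (rule cap_half_normal_derivative[OF R(1) _ nx])
  qed
  have "AE x in lebesgue. ?w x = u x"
    unfolding AE_completion_iff using f(2) c by eventually_elim simp
  moreover have "continuous_on \<Omega> ?w"
    by (intro continuous_intros continuous_on_compose2[OF continuous_on_cap[of UNIV R]]) auto
  moreover have "\<forall>x. x \<notin> \<Omega> \<longrightarrow> ?w x = 0"
    using cap_eq_0[OF R(1)] unfolding \<Omega> by (auto simp: dist_norm norm_minus_commute not_less)
  moreover have "2 / pi * sqrt (2 * R) \<ge> 0" using R by simp
  ultimately show ?thesis
    using 3 by (intro exI[of _ ?w] exI[of _ "2 / pi * sqrt (2 * R)"] conjI ballI) simp_all
qed

end
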